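(* Let $k\ge2$ and $0\le\mu\le k-1$. Consider, for vectors $\{c_j\}_{j\in\mathcal U_k}\in\mathbb R^{|\mathcal U_k|}$, the Galerkin orthogonality constraints $$\text{(G)}\qquad \alpha_m=\sum_{\substack{0\le r\le\mu-1\\ r\equiv m+1\ (\mathrm{mod}\ 2)}}2\lambda_r L_m^{(r)}(1),\qquad 1\le m\le k-2,\ m\equiv k\ (\mathrm{mod}\ 2),$$ for some real parameters $\lambda_0,\dots,\lambda_{\mu-1}$, where $\alpha_m=\sum_{j\in\mathcal U_k,\ j\ge m+1}c_j$, and the nodal superconvergence constraints $$\text{(N)}\qquad \sum_{j\in\mathcal U_k}c_jL_j^{(s)}(1)=0,\qquad 0\le s\le\mu,\ s\equiv k\ (\mathrm{mod}\ 2).$$ Then the constraints (G) (regarded, after elimination of the parameters $\lambda_r$, as a set of linearly independent linear equations in $\{c_j\}_{j\in\mathcal U_k}$) and the constraints (N) are together linearly independent. They uniquely determine the ratios $c_j/c_{k+1}$ for $j\in\mathcal U_k\setminus\{k+1\}$ when $k$ is even, and the ratios $c_j/c_{k+1}$ for $j\in\mathcal U_k\setminus\{0,k+1\}$ when $k$ is odd. The error in these ratios is of the same order as the remainder, i.e. if $\rho_j$ denotes the ratio so determined, the actual leading-order coefficients of the finite element error satisfy $c_j=\rho_j c_{k+1}+O(h^{k+2})$ for these $j$.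
   Context: $L_j$ is the Legendre polynomial of degree $j$ (with $L_j(1)=1$), and $\mathcal U_k=\{j\in\{0,1,\dots,k+1\}: j\equiv k+1\ (\mathrm{mod}\ 2)\}$. Origin of the coefficients. Let $\Omega=(a,b)$, let $u$ (sufficiently smooth) solve $-u''=f$ in $\Omega$, $u(a)=u(b)=0$; let $a=x_1<\dots<x_{N+1}=b$ be a quasi-uniform family of partitions, $h=\max_i(x_{i+1}-x_i)$, $I_i=[x_i,x_{i+1}]$; $S_h^{k,\mu}(\Omega)=\{\chi\in C^\mu(\Omega):\chi|_{I_i}\in\mathcal P_k(I_i)\ \forall i\}$, $V_h=S_h^{k,\mu}(\Omega)\cap H_0^1(\Omega)$; $u_h\in V_h$ satisfies $\int_\Omega(u-u_h)'\chi'\,dx=0$ for all $\chi\in V_h$; $e=u-u_h$. Fix $x_0\in\Omega$ such that the mesh is uniform (elements of length $h$) within $B_d(x_0)\subset\Omega$, a union of whole elements centered at $x_0$ of size $d=C^*h|\ln h|$, $C^*$ a sufficiently large constant. For elements $I_i$ whose midpoints $x_{i+1/2}$ satisfy $|x_{i+1/2}-x_0|=O(h)$, put $t=2(x-x_{i+1/2})/h\in[-1,1]$ and $c_{j,i}=\frac{2j+1}{2}\int_{-1}^1 e|_{I_i}(t)L_j(t)\,dt$, $0\le j\le k+1$. The leading-order coefficients $c_j$ are numbers independent of $i$ with $c_{j,i}=c_j+O(h^{k+2})$ for all such elements; only $j\in\mathcal U_k$ contribute at leading order ($c_{j,i}=O(h^{k+2})$ if $j\equiv k\pmod 2$). These coefficients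 satisfy (G) and (N) up to higher-order remainders. $A=O(h^m)$ means $|A|\le Ch^m$ with $C$ independent of $h$. *)

theory Defs
  imports "HOL-Analysis.Analysis" "HOL-Computational_Algebra.Polynomial"
begin

(* Rodrigues' formula; this normalisation has value 1 at 1. *)
definition legendre :: "nat \<Rightarrow> real poly" where
  "legendre n = smult (1 / (2 ^ n * fact n)) ((pderiv ^^ n) ([:-1, 0, 1:] ^ n))"

definition legendre_deriv_at_1 :: "nat \<Rightarrow> nat \<Rightarrow> real" where
  "legendre_deriv_at_1 r n = poly ((pderiv ^^ r) (legendre n)) 1"


section \<open>The constraints\<close>

(* A vector indexed by the finite set U k is a function on nat of which only the
   values on U k matter. *)

definition U :: "nat \<Rightarrow> nat set" where
  "U k = {j \<in> {0..k+1}. j mod 2 = (k + 1) mod 2}"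

definition alpha :: "nat \<Rightarrow> (nat \<Rightarrow> real) \<Rightarrow> nat \<Rightarrow> real" where
  "alpha k c m = (\<Sum>j \<in> {j \<in> U k. j \<ge> m + 1}. c j)"

(* The parameters are common to all m.  The range 0 <= r <= mu - 1, empty for mu = 0,
   is written r < mu because of truncated subtraction. *)
definition G_constraints :: "nat \<Rightarrow> nat \<Rightarrow> (nat \<Rightarrow> real) \<Rightarrow> bool" where
  "G_constraints k mu c \<longleftrightarrow>
     (\<exists>lam :: nat \<Rightarrow> real. \<forall>m \<in> {1..k-2}. m mod 2 = k mod 2 \<longrightarrow>
        alpha k c m =
          (\<Sum>r \<in> {r. r < mu \<and> r mod 2 = (m + 1) mod 2}. 2 * lam r * legendre_deriv_at_1 r m))"

definition N_index :: "nat \<Rightarrow> nat \<Rightarrow> nat set" where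
  "N_index k mu = {s \<in> {0..mu}. s mod 2 = k mod 2}"

definition N_constraints :: "nat \<Rightarrow> nat \<Rightarrow> (nat \<Rightarrow> real) \<Rightarrow> bool" where
  "N_constraints k mu c \<longleftrightarrow>
     (\<forall>s \<in> N_index k mu. (\<Sum>j \<in> U k. c j * legendre_deriv_at_1 s j) = 0)"

(* Linear independence of a family, indexed by the finite set I, of coordinate vectors
   with coordinates in J.  Unlike independence of the set of members, it also excludes
   repeated members. *)
definition lin_indep_family :: "nat set \<Rightarrow> 'a set \<Rightarrow> ('a \<Rightarrow> nat \<Rightarrow> real) \<Rightarrow> bool" where
  "lin_indep_family J I v \<longleftrightarrow>
     (\<forall>w. (\<forall>j\<in>J. (\<Sum>i\<in>I. w i * v i j) = 0) \<longrightarrow> (\<forall>i\<in>I. w i = 0))"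

(* The result of eliminating the parameters from (G): linearly independent homogeneous
   equations in c alone (q of them, the i-th with coefficient vector g i) whose common
   solutions are the vectors satisfying (G) for some choice of the parameters. *)
definition G_eliminated :: "nat \<Rightarrow> nat \<Rightarrow> nat \<Rightarrow> (nat \<Rightarrow> nat \<Rightarrow> real) \<Rightarrow> bool" where
  "G_eliminated k mu q g \<longleftrightarrow>
     lin_indep_family (U k) {..<q} g \<and>
     (\<forall>c. (\<forall>i<q. (\<Sum>j \<in> U k. g i j * c j) = 0) \<longleftrightarrow> G_constraints k mu c)"

definition ratio_index :: "nat \<Rightarrow> nat set" where
  "ratio_index k = (if even k then U k - {k + 1} else U k - {0, k + 1})"

definition determine_ratios :: "nat \<Rightarrow> nat \<Rightarrow> (nat \<Rightarrow> real) \<Rightarrow> bool" where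
  "determine_ratios k mu rho \<longleftrightarrow>
     (\<exists>c. G_constraints k mu c \<and> N_constraints k mu c \<and> c (k + 1) \<noteq> 0) \<and>
     (\<forall>c. G_constraints k mu c \<and> N_constraints k mu c \<and> c (k + 1) \<noteq> 0 \<longrightarrow>
        (\<forall>j \<in> ratio_index k. c j / c (k + 1) = rho j))"


section \<open>The finite element method\<close>

(* Intended for intervals; at an end point belonging to S the derivatives are one-sided. *)
definition C_on :: "nat \<Rightarrow> real set \<Rightarrow> (real \<Rightarrow> real) \<Rightarrow> bool" where
  "C_on m S v \<longleftrightarrow>
     (\<exists>D :: nat \<Rightarrow> real \<Rightarrow> real.
        (\<forall>y\<in>S. D 0 y = v y) \<and>
        (\<forall>n<m. \<forall>y\<in>S. (D n has_real_derivative D (Suc n) y) (at y within S)) \<and>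
        continuous_on S (D m))"

(* H^1_0(a,b) in one dimension, via the absolutely continuous representative: v is the
   primitive vanishing at a of a square-integrable function, and v vanishes at b. *)
definition H01 :: "real \<Rightarrow> real \<Rightarrow> (real \<Rightarrow> real) set" where
  "H01 a b = {v. \<exists>g \<in> borel_measurable lborel.
       set_integrable lborel {a..b} (\<lambda>y. (g y)\<^sup>2) \<and>
       (\<forall>y \<in> {a..b}. v y = set_lebesgue_integral lborel {a..y} g) \<and> v b = 0}"

(* Nodes x 1 < ... < x (N + 1), elements {x i..x (i + 1)} for i in {1..N}. *)
definition is_mesh :: "real \<Rightarrow> real \<Rightarrow> nat \<Rightarrow> (nat \<Rightarrow> real) \<Rightarrow> bool" where
  "is_mesh a b N x \<longleftrightarrow>
     N \<ge> 1 \<and> x 1 = a \<and> x (N + 1) = b \<and> (\<forall>i \<in> {1..N}. x i < x (i + 1))"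

definition mesh_size :: "nat \<Rightarrow> (nat \<Rightarrow> real) \<Rightarrow> real" where
  "mesh_size N x = Max ((\<lambda>i. x (i + 1) - x i) ` {1..N})"

definition midpoint_of :: "(nat \<Rightarrow> real) \<Rightarrow> nat \<Rightarrow> real" where
  "midpoint_of x i = (x i + x (i + 1)) / 2"

definition quasi_uniform :: "('i \<Rightarrow> nat) \<Rightarrow> ('i \<Rightarrow> nat \<Rightarrow> real) \<Rightarrow> bool" where
  "quasi_uniform N x \<longleftrightarrow>
     (\<exists>K. \<forall>\<iota>. \<forall>i \<in> {1..N \<iota>}. mesh_size (N \<iota>) (x \<iota>) \<le> K * (x \<iota> (i + 1) - x \<iota> i))"

definition spline_space :: "nat \<Rightarrow> nat \<Rightarrow> nat \<Rightarrow> (nat \<Rightarrow> real) \<Rightarrow> (real \<Rightarrow> real) set" where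
  "spline_space k mu N x = {v. C_on mu {x 1<..<x (N + 1)} v \<and>
     (\<forall>i \<in> {1..N}. \<exists>p :: real poly. degree p \<le> k \<and> (\<forall>y \<in> {x i..x (i + 1)}. v y = poly p y))}"

definition V_h :: "nat \<Rightarrow> nat \<Rightarrow> nat \<Rightarrow> (nat \<Rightarrow> real) \<Rightarrow> (real \<Rightarrow> real) set" where
  "V_h k mu N x = spline_space k mu N x \<inter> H01 (x 1) (x (N + 1))"

(* The derivatives below exist except possibly at the finitely many nodes, which do not
   affect the integral. *)
definition is_galerkin_solution ::
  "nat \<Rightarrow> nat \<Rightarrow> nat \<Rightarrow> (nat \<Rightarrow> real) \<Rightarrow> (real \<Rightarrow> real) \<Rightarrow> (real \<Rightarrow> real) \<Rightarrow> bool" where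
  "is_galerkin_solution k mu N x u uh \<longleftrightarrow>
     uh \<in> V_h k mu N x \<and>
     (\<forall>v \<in> V_h k mu N x.
        integral {x 1<..<x (N + 1)} (\<lambda>y. deriv (\<lambda>z. u z - uh z) y * deriv v y) = 0)"

(* The closed interval of radius d about x0 is a non-empty union of whole elements, all
   of length mesh_size N x. *)
definition uniform_patch :: "nat \<Rightarrow> (nat \<Rightarrow> real) \<Rightarrow> real \<Rightarrow> real \<Rightarrow> bool" where
  "uniform_patch N x x0 d \<longleftrightarrow>
     (\<exists>l r. 1 \<le> l \<and> l < r \<and> r \<le> N + 1 \<and> x l = x0 - d \<and> x r = x0 + d \<and>
        (\<forall>i \<in> {l..<r}. x (i + 1) - x i = mesh_size N x))"

(* Every quantity attached to a mesh carries the index iota of the mesh in the family,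
   which is arbitrary; a, b, f, u, x0 and Cstar do not depend on the mesh.  As d is a
   multiple of half the element length, d = Cstar h |ln h| is required up to rounding by
   at most one element. *)
definition fe_setting ::
  "nat \<Rightarrow> nat \<Rightarrow> real \<Rightarrow> real \<Rightarrow> (real \<Rightarrow> real) \<Rightarrow> (real \<Rightarrow> real) \<Rightarrow> real \<Rightarrow> real \<Rightarrow>
   ('i \<Rightarrow> nat) \<Rightarrow> ('i \<Rightarrow> nat \<Rightarrow> real) \<Rightarrow> ('i \<Rightarrow> real) \<Rightarrow> ('i \<Rightarrow> real \<Rightarrow> real) \<Rightarrow> bool" where
  "fe_setting k mu a b f u x0 Cstar N x d uh \<longleftrightarrow>
     a < b \<and> C_on (k + 2) {a..b} u \<and>
     (\<forall>y \<in> {a<..<b}. - (deriv ^^ 2) u y = f y) \<and> u a = 0 \<and> u b = 0 \<and>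
     x0 \<in> {a<..<b} \<and> Cstar > 0 \<and>
     quasi_uniform N x \<and>
     (\<forall>\<iota>. is_mesh a b (N \<iota>) (x \<iota>) \<and>
          is_galerkin_solution k mu (N \<iota>) (x \<iota>) u (uh \<iota>) \<and>
          ball x0 (d \<iota>) \<subseteq> {a<..<b} \<and>
          uniform_patch (N \<iota>) (x \<iota>) x0 (d \<iota>) \<and>
          (let h = mesh_size (N \<iota>) (x \<iota>) in \<bar>d \<iota> - Cstar * h * \<bar>ln h\<bar>\<bar> \<le> h))"

definition legendre_coeff :: "(real \<Rightarrow> real) \<Rightarrow> real \<Rightarrow> real \<Rightarrow> nat \<Rightarrow> real" where
  "legendre_coeff e xm h j =
     (2 * real j + 1) / 2 * integral {-1..1} (\<lambda>t. e (xm + h / 2 * t) * poly (legendre j) t)"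

(* The elements with |midpoint - x0| = O(h) are those within M h of x0, M being arbitrary
   but independent of the mesh; the constant C may depend on M.  Elements outside the
   uniform patch, which can only be that close to x0 on coarse meshes, are left out. *)
definition leading_order_coeffs ::
  "nat \<Rightarrow> (real \<Rightarrow> real) \<Rightarrow> real \<Rightarrow> ('i \<Rightarrow> nat) \<Rightarrow> ('i \<Rightarrow> nat \<Rightarrow> real) \<Rightarrow> ('i \<Rightarrow> real) \<Rightarrow>
   ('i \<Rightarrow> real \<Rightarrow> real) \<Rightarrow> ('i \<Rightarrow> nat \<Rightarrow> real) \<Rightarrow> bool" where
  "leading_order_coeffs k u x0 N x d uh c \<longleftrightarrow>
     (\<forall>M. \<exists>C. \<forall>\<iota>. \<forall>i \<in> {1..N \<iota>}.
        (let h = mesh_size (N \<iota>) (x \<iota>);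
             xm = midpoint_of (x \<iota>) i;
             cc = legendre_coeff (\<lambda>y. u y - uh \<iota> y) xm h
         in {x \<iota> i..x \<iota> (i + 1)} \<subseteq> {x0 - d \<iota>..x0 + d \<iota>} \<and> \<bar>xm - x0\<bar> \<le> M * h \<longrightarrow>
              (\<forall>j \<in> U k. \<bar>cc j - c \<iota> j\<bar> \<le> C * h ^ (k + 2)) \<and>
              (\<forall>j \<in> {0..k+1} - U k. \<bar>cc j\<bar> \<le> C * h ^ (k + 2))))"

end

theory Submission
  imports Defs
begin

text \<open>
  Attach to a vector \<open>c\<close> the polynomial \<open>E = \<Sum>j\<in>U k. c j L_j\<close> on \<open>[-1, 1]\<close> (\<open>upoly k c\<close>), which has the
  parity of \<open>k + 1\<close>, and call a polynomial admissible if its 2-periodic extension is of class \<open>C^mu\<close>.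
  Both sets of constraints speak about admissible polynomials. (N) says that \<open>E\<close> is admissible: the
  jumps of the derivatives across the period that (N) leaves out vanish by parity. (G) says that \<open>E\<close> is
  orthogonal, in the form \<open>\<integral> p' q'\<close>, to all admissible polynomials of degree at most \<open>k\<close>; the parameters
  \<open>\<lambda>_r\<close> are Lagrange multipliers for the jump conditions on the test polynomial.

  Bernoulli polynomials \<open>b_n\<close> scaled to \<open>[-1, 1]\<close> diagonalise the jumps: only the derivative of order
  \<open>n - 1\<close> of \<open>b_n\<close> jumps. Hence constants and \<open>b_{mu+2}, ..., b_k\<close> span the admissible polynomials of
  degree at most \<open>k\<close>, and (G) becomes the explicit system \<open>\<integral> E' b_n' = 0\<close> with \<open>n\<close> in this range and
  of the parity of \<open>k + 1\<close> (lemma \<open>G_constraints_iff\<close>).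

  The linear algebra follows. If \<open>c (k + 1) = 0\<close> and both constraints hold, then \<open>E\<close> has degree at most
  \<open>k\<close> and is admissible, so it may be tested with itself; \<open>E\<close> is constant and only \<open>c 0\<close> can survive
  (\<open>constraints_kernel\<close>). Conversely, subtracting from any polynomial its projection onto the test space
  enforces (G) and leaves the jumps up to order \<open>mu\<close> alone (\<open>ex_G_constraints_with_jumps\<close>). Starting
  from \<open>b_{k+1}\<close> this gives a solution with \<open>c (k + 1) \<noteq> 0\<close>, hence the ratios; starting from \<open>b_{s+1}\<close> it
  gives vectors satisfying (G) on which the equations (N) take independent values, hence the joint
  independence.

  For the finite element error, \<open>c j - \<rho>_j c (k + 1)\<close> vanishes wherever all the constraints do, so it is a
  fixed linear combination of them, and it remains to bound the residuals of the constraints by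
  \<open>O(h^(k+2))\<close>. On an element near \<open>x0\<close> the error, in the variable \<open>t\<close>, is \<open>E\<close> up to \<open>O(h^(k+2))\<close> together
  with its derivatives (\<open>element_expansion\<close>). Continuity of the derivatives at a common node of two such
  elements gives the residual of (N). For (G), a spline of degree \<open>n\<close> and class \<open>C^(n-2)\<close> is built that
  vanishes outside \<open>n\<close> consecutive elements and whose pieces, moved to the reference element, add up to a
  constant minus \<open>b_n / 2\<close> (\<open>h1_form_tfold\<close>). Since \<open>E\<close> is the same on all these elements, Galerkin
  orthogonality to this spline is \<open>\<integral> E' b_n' = O(h^(k+2))\<close>. All this needs \<open>k\<close> elements in the uniform
  patch; on the remaining meshes \<open>h\<close> is bounded below, and the energy estimate, which bounds the error by
  a constant, is enough.
\<close>

section \<open>Integrals, reflections and boundary jumps of polynomials on the reference element\<close>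

definition pint :: "real poly \<Rightarrow> real" where
  "pint p = integral {-1..1} (poly p)"

definition jump :: "nat \<Rightarrow> real poly \<Rightarrow> real" where
  "jump s p = poly ((pderiv ^^ s) p) 1 - poly ((pderiv ^^ s) p) (-1)"

abbreviation reflect :: "real poly \<Rightarrow> real poly" where
  "reflect p \<equiv> pcompose p [:0, -1:]"

lemma poly_integrable_on: "poly (p :: real poly) integrable_on {a..b}"
  by (intro integrable_continuous_interval continuous_intros)

lemma pint_add: "pint (p + q) = pint p + pint q"
  unfolding pint_def poly_add by (intro integral_add poly_integrable_on)

lemma pint_smult: "pint (smult c p) = c * pint p"
  unfolding pint_def poly_smult by simp

lemma pint_diff: "pint (p - q) = pint p - pint q"
  unfolding pint_def poly_diff by (intro integral_diff poly_integrable_on)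

lemma pint_0 [simp]: "pint 0 = 0"
  using pint_smult[of 0 0] by simp

lemma pint_sum: "pint (sum f A) = (\<Sum>x\<in>A. pint (f x))"
  by (induction A rule: infinite_finite_induct) (simp_all add: pint_add)

lemma pint_const: "pint [:c:] = 2 * c"
proof -
  have "poly [:c:] = (\<lambda>_. c)" by auto
  then show ?thesis by (simp add: pint_def)
qed

lemma pint_pderiv: "pint (pderiv p) = jump 0 p"
proof -
  have "(poly (pderiv p) has_integral (poly p 1 - poly p (-1))) {-1..1}"
    by (rule fundamental_theorem_of_calculus)
       (auto intro!: derivative_eq_intros simp flip: has_real_derivative_iff_has_vector_derivative)
  then show ?thesis by (simp add: pint_def jump_def integral_unique)
qed

lemma pint_by_parts: "pint (pderiv p * q) = jump 0 (p * q) - pint (p * pderiv q)"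
proof -
  have "pint (pderiv (p * q)) = jump 0 (p * q)" by (rule pint_pderiv)
  then show ?thesis by (simp add: pderiv_mult pint_add mult.commute)
qed

lemma pint_square_eq_0: assumes "pint (p * p) = 0" shows "p = 0"
proof (rule ccontr)
  assume "p \<noteq> 0"
  have "\<forall>x\<in>{-1..1}. poly (p * p) x = 0"
    using assms unfolding pint_def
    by (subst (asm) integral_eq_0_iff) (auto intro!: continuous_intros)
  then have "{-1..1} \<subseteq> {x. poly p x = 0}" by auto
  moreover have "finite {x. poly p x = 0}" using \<open>p \<noteq> 0\<close> by (rule poly_roots_finite)
  ultimately have "finite {-1..1::real}" by (rule finite_subset)
  then show False using infinite_Icc[of "-1::real" 1] by simp
qed

lemma jump_add: "jump s (p + q) = jump s p + jump s q"
  by (simp add: jump_def higher_pderiv_add)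

lemma jump_smult: "jump s (smult c p) = c * jump s p"
  by (simp add: jump_def higher_pderiv_smult algebra_simps)

lemma jump_0 [simp]: "jump s 0 = 0"
  by (simp add: jump_def)

lemma jump_sum: "jump s (sum f A) = (\<Sum>x\<in>A. jump s (f x))"
  by (induction A rule: infinite_finite_induct) (simp_all add: jump_add)

lemma jump_diff: "jump s (p - q) = jump s p - jump s q"
  using jump_add[of s p "smult (-1) q"] jump_smult[of s "-1" q] by simp

lemma jump_pderiv: "jump s (pderiv p) = jump (Suc s) p"
  by (simp add: jump_def funpow_swap1)

lemma jump_eq_0_if_degree: assumes "degree p \<le> s" shows "jump s p = 0"
proof -
  have "degree ((pderiv ^^ s) p) = 0" using assms by (simp add: degree_higher_pderiv)
  then obtain a where "(pderiv ^^ s) p = [:a:]" by (rule degree_eq_zeroE)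
  then show ?thesis by (simp add: jump_def)
qed

lemma higher_pderiv_affine:
  "(pderiv ^^ s) (pcompose p [:a, b:]) = smult (b ^ s) (pcompose ((pderiv ^^ s) p) [:a, b :: real:])"
  by (induction s) (simp_all add: pderiv_smult pderiv_pcompose pderiv_pCons mult.commute)

text \<open>Half of the jumps vanish by parity, the others double the value at 1; this is the source of the
restrictions modulo 2 in both sets of constraints.\<close>

lemma jump_parity:
  assumes "reflect p = smult ((-1) ^ n) p"
  shows "jump s p = (if even (n + s) then 0 else 2 * poly ((pderiv ^^ s) p) 1)"
proof -
  have "smult ((-1) ^ n) ((pderiv ^^ s) p) = smult ((-1) ^ s) (reflect ((pderiv ^^ s) p))"
    using higher_pderiv_affine[of s p 0 "-1"] by (simp add: assms higher_pderiv_smult)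
  from arg_cong[where f="\<lambda>q. poly q 1", OF this]
  have "(-1) ^ n * poly ((pderiv ^^ s) p) 1 = (-1) ^ s * poly ((pderiv ^^ s) p) (-1)"
    by (simp add: poly_pcompose)
  then show ?thesis
    by (cases "even n"; cases "even s") (auto simp: jump_def)
qed

lemma pint_reflect: "pint (reflect p) = pint p"
proof -
  have "pint p = integral {-1..1} (\<lambda>x. poly p (- x))"
    using Henstock_Kurzweil_Integration.integral_reflect_real[of 1 "-1" "\<lambda>x. poly p x"] by (simp add: pint_def)
  moreover have "poly (reflect p) = (\<lambda>x. poly p (- x))" by (auto simp: poly_pcompose)
  ultimately show ?thesis by (simp add: pint_def)
qed

section \<open>Bernoulli polynomials of the reference element\<close>

definition antideriv :: "real poly \<Rightarrow> real poly" where
  "antideriv p = (\<Sum>i\<le>degree p. monom (coeff p i / real (Suc i)) (Suc i))"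

text \<open>The Bernoulli polynomials \<open>B_n / n!\<close>, transported from \<open>[0, 1]\<close> to \<open>[-1, 1]\<close> and rescaled so that
differentiation lowers the index.\<close>

primrec bern :: "nat \<Rightarrow> real poly" where
  "bern 0 = 1"
| "bern (Suc n) = antideriv (bern n) - [:pint (antideriv (bern n)) / 2:]"

lemma pderiv_antideriv: "pderiv (antideriv p) = p"
proof -
  have "pderiv (antideriv p) = (\<Sum>i\<le>degree p. monom (coeff p i) i)"
    unfolding antideriv_def
    by (simp add: higher_pderiv_sum[where n=1, simplified] pderiv_monom)
  then show ?thesis by (simp add: poly_as_sum_of_monoms)
qed

lemma pderiv_bern: "pderiv (bern (Suc n)) = bern n"
  by (simp add: pderiv_diff pderiv_antideriv)

lemma pint_bern: "pint (bern (Suc n)) = 0"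
  by (simp add: pint_diff pint_const)

text \<open>This is what inductions over the Bernoulli polynomials rest on: an identity between polynomials is
reduced to its derivative and one integral.\<close>

lemma eq_if_pderiv_pint_eq:
  assumes "pderiv p = pderiv q" "pint p = pint q"
  shows "p = q"
proof -
  from assms(1) have "pderiv (p - q) = 0" by (simp add: pderiv_diff)
  then obtain c where c: "p - q = [:c:]" using pderiv_iszero by blast
  with assms(2) have "c = 0" using pint_const[of c] pint_diff[of p q] by simp
  with c show ?thesis by simp
qed

lemma degree_bern_le: "degree (bern n) \<le> n"
proof (induction n)
  case (Suc n)
  then show ?case using degree_pderiv[of "bern (Suc n)"] unfolding pderiv_bern by linarith
qed simp

text \<open>A jump of a derivative of \<open>b_n\<close> is the jump of some \<open>b_m\<close>, that is the integral of \<open>b_{m-1}\<close>, and the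
latter is zero unless \<open>m = 1\<close>.\<close>

lemma jump_bern: "jump s (bern n) = (if n = Suc s then 2 else 0)"
proof (induction s arbitrary: n)
  case 0
  show ?case
  proof (cases n)
    case (Suc m)
    have "jump 0 (bern n) = pint (bern m)"
      unfolding Suc by (metis pderiv_bern pint_pderiv)
    then show ?thesis using Suc pint_bern by (cases m) (auto simp: pint_const one_pCons)
  qed (simp add: jump_def)
next
  case (Suc s)
  show ?case
  proof (cases n)
    case (Suc m)
    have "jump (Suc s) (bern n) = jump s (bern m)"
      unfolding Suc by (metis pderiv_bern jump_pderiv)
    then show ?thesis using Suc.IH[of m] Suc by simp
  qed (simp add: jump_eq_0_if_degree)
qed

lemma reflect_bern: "reflect (bern n) = smult ((-1) ^ n) (bern n)"
proof (induction n)
  case 0 show ?case by (simp add: pcompose_1)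
next
  case (Suc n)
  have "pderiv (reflect (bern (Suc n))) = smult (-1) (reflect (bern n))"
    using pderiv_pcompose[of "bern (Suc n)" "[:0, -1:]"] by (simp add: pderiv_bern pderiv_pCons del: bern.simps)
  then have "pderiv (reflect (bern (Suc n))) = pderiv (smult ((-1) ^ Suc n) (bern (Suc n)))"
    by (simp add: Suc.IH pderiv_smult pderiv_minus pderiv_bern del: bern.simps)
  moreover have "pint (reflect (bern (Suc n))) = pint (smult ((-1) ^ Suc n) (bern (Suc n)))"
    by (simp only: pint_reflect pint_smult pint_bern mult_zero_right)
  ultimately show ?case by (rule eq_if_pderiv_pint_eq)
qed

text \<open>The Euler-Maclaurin expansion without remainder. Coordinates in the Bernoulli basis are halved jumps,
so a jump condition is the vanishing of one coordinate.\<close>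

lemma bern_expansion:
  assumes "degree p \<le> n"
  shows "p = [:pint p / 2:] + (\<Sum>j=1..n. smult (jump (j - 1) p / 2) (bern j))"
  using assms
proof (induction n arbitrary: p)
  case 0
  then obtain a where "p = [:a:]" using degree_eq_zeroE by blast
  then show ?case by (simp add: pint_const)
next
  case (Suc n)
  let ?q = "\<Sum>j=1..Suc n. smult (jump (j - 1) p / 2) (bern j)"
  have q: "?q = (\<Sum>j=0..n. smult (jump j p / 2) (bern (Suc j)))"
    by (rule sum.reindex_bij_witness[where i=Suc and j="\<lambda>j. j - 1"]) auto
  have "degree (pderiv p) \<le> n" using Suc.prems by (simp add: degree_pderiv)
  then have IH: "pderiv p = [:pint (pderiv p) / 2:] + (\<Sum>j=1..n. smult (jump (j - 1) (pderiv p) / 2) (bern j))"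
    by (rule Suc.IH)
  have "pderiv ?q = (\<Sum>j=0..n. smult (jump j p / 2) (bern j))"
    unfolding q by (simp only: higher_pderiv_sum[where n=1, simplified] pderiv_smult pderiv_bern)
  also have "\<dots> = smult (jump 0 p / 2) (bern 0) + (\<Sum>j=1..n. smult (jump j p / 2) (bern j))"
    by (simp add: sum.atLeast_Suc_atMost)
  also have "(\<Sum>j=1..n. smult (jump j p / 2) (bern j)) = (\<Sum>j=1..n. smult (jump (j - 1) (pderiv p) / 2) (bern j))"
    by (intro sum.cong) (auto simp: jump_pderiv)
  also have "smult (jump 0 p / 2) (bern 0) + \<dots> = pderiv p"
    by (subst IH) (simp add: pint_pderiv one_pCons)
  finally have d: "pderiv ?q = pderiv p" .
  have i: "pint ?q = 0"
    unfolding q by (simp add: pint_sum pint_smult pint_bern del: bern.simps)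
  have "pderiv p = pderiv ([:pint p / 2:] + ?q)"
    by (simp only: pderiv_add d pderiv_singleton add_0_left)
  moreover have "pint p = pint ([:pint p / 2:] + ?q)"
    by (simp only: pint_add i pint_const)
  ultimately show ?case by (rule eq_if_pderiv_pint_eq)
qed

lemma smult_sum_right: "smult a (sum f A) = (\<Sum>x\<in>A. smult a (f x))"
  by (induction A rule: infinite_finite_induct) (simp_all add: smult_add_right)

section \<open>Legendre polynomials from Rodrigues' formula\<close>

lemma linear_power_dvd_pderiv:
  fixes p :: "real poly"
  assumes "[:- a, 1:] ^ Suc n dvd p"
  shows "[:- a, 1:] ^ n dvd pderiv p"
proof -
  obtain q where "p = [:- a, 1:] ^ Suc n * q" using assms by (rule dvdE)
  then have "pderiv p = [:- a, 1:] ^ n * (smult (real (Suc n)) q + [:- a, 1:] * pderiv q)"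
    by (simp only: pderiv_mult pderiv_power_Suc) (simp add: pderiv_pCons algebra_simps)
  then show ?thesis by simp
qed

lemma linear_power_dvd_higher_pderiv:
  fixes p :: "real poly"
  assumes "[:- a, 1:] ^ n dvd p" "i \<le> n"
  shows "[:- a, 1:] ^ (n - i) dvd (pderiv ^^ i) p"
  using assms(2)
proof (induction i)
  case (Suc i)
  then have "[:- a, 1:] ^ Suc (n - Suc i) dvd (pderiv ^^ i) p" by (simp add: Suc_diff_Suc)
  then show ?case using linear_power_dvd_pderiv by simp
qed (use assms in simp)

text \<open>Every term of the Leibniz rule but one retains a factor vanishing at \<open>a\<close>.\<close>

lemma poly_higher_pderiv_linear_power:
  "poly ((pderiv ^^ n) ([:- a, 1:] ^ n * q)) a = fact n * poly q (a :: real)"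
proof (induction n arbitrary: q)
  case (Suc n)
  have "pderiv ([:- a, 1:] ^ Suc n * q) = [:- a, 1:] ^ n * (smult (real (Suc n)) q + [:- a, 1:] * pderiv q)"
    by (simp only: pderiv_mult pderiv_power_Suc) (simp add: pderiv_pCons algebra_simps)
  then show ?case by (simp add: funpow_Suc_right Suc.IH del: funpow.simps power_Suc)
qed simp

lemma rodrigues_factors: "[:-1, 0, 1::real:] ^ n = [:- 1, 1:] ^ n * [:1, 1:] ^ n"
  by (simp flip: power_mult_distrib)

lemma poly_higher_pderiv_rodrigues_eq_0:
  assumes "i < n" "x = 1 \<or> x = -1"
  shows "poly ((pderiv ^^ i) ([:-1, 0, 1::real:] ^ n)) x = 0"
proof -
  have "[:- x, 1:] ^ n dvd [:-1, 0, 1::real:] ^ n" using assms(2) by (auto simp: rodrigues_factors)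
  then have "[:- x, 1:] ^ (n - i) dvd (pderiv ^^ i) ([:-1, 0, 1::real:] ^ n)"
    using assms(1) linear_power_dvd_higher_pderiv by simp
  moreover have "[:- x, 1:] dvd [:- x, 1:] ^ (n - i)" using assms(1) by (intro dvd_power) auto
  ultimately have "[:- x, 1:] dvd (pderiv ^^ i) ([:-1, 0, 1::real:] ^ n)" by (rule dvd_trans[rotated])
  then show ?thesis by (simp add: poly_eq_0_iff_dvd)
qed

lemma legendre_at_1: "poly (legendre n) 1 = 1"
  unfolding legendre_def rodrigues_factors poly_smult poly_higher_pderiv_linear_power
  by (simp add: poly_power)

lemma reflect_legendre: "reflect (legendre n) = smult ((-1) ^ n) (legendre n)"
proof -
  let ?f = "[:-1, 0, 1::real:] ^ n"
  have "reflect [:-1, 0, 1::real:] = [:-1, 0, 1:]" by (simp add: pcompose_pCons)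
  then have f: "reflect ?f = ?f" by (induction n) (simp_all only: power_0 power_Suc pcompose_1 pcompose_mult)
  have "(pderiv ^^ n) ?f = smult ((-1) ^ n) (reflect ((pderiv ^^ n) ?f))"
    using higher_pderiv_affine[of n ?f 0 "-1"] f by simp
  from arg_cong[where f="smult ((-1) ^ n)", OF this]
  have "reflect ((pderiv ^^ n) ?f) = smult ((-1) ^ n) ((pderiv ^^ n) ?f)"
    by (simp flip: power_mult_distrib)
  then show ?thesis by (simp add: legendre_def pcompose_smult mult.commute)
qed

lemma degree_legendre: "degree (legendre n) = n"
proof -
  have "degree ([:-1, 0, 1::real:] ^ n) = 2 * n" by (simp add: degree_power_eq)
  then show ?thesis by (simp add: legendre_def degree_higher_pderiv)
qed

lemma legendre_neq_0: "legendre n \<noteq> 0"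
  using legendre_at_1[of n] by auto

text \<open>Repeated integration by parts; the hypothesis removes the boundary terms.\<close>

lemma pint_mult_higher_pderiv:
  assumes "\<And>i. i < n \<Longrightarrow> poly ((pderiv ^^ i) f) 1 = 0 \<and> poly ((pderiv ^^ i) f) (-1) = 0"
  shows "pint (q * (pderiv ^^ n) f) = (-1) ^ n * pint ((pderiv ^^ n) q * f)"
  using assms
proof (induction n arbitrary: q)
  case (Suc n)
  have "pint (q * (pderiv ^^ Suc n) f) = pint (pderiv ((pderiv ^^ n) f) * q)"
    by (simp add: mult.commute)
  also have "\<dots> = - pint (pderiv q * (pderiv ^^ n) f)"
    using Suc.prems[of n] by (simp add: pint_by_parts jump_def mult.commute)
  also have "\<dots> = (-1) ^ Suc n * pint ((pderiv ^^ Suc n) q * f)"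
    using Suc by (simp add: funpow_Suc_right del: funpow.simps)
  finally show ?case .
qed simp

text \<open>By Rodrigues' formula all \<open>n\<close> derivatives can be moved to \<open>q\<close>, which they annihilate.\<close>

lemma legendre_orthogonal:
  assumes "degree q < n"
  shows "pint (q * legendre n) = 0"
proof -
  have "(pderiv ^^ n) q = 0"
  proof -
    have "degree ((pderiv ^^ (n - 1)) q) = 0" using assms by (simp add: degree_higher_pderiv)
    then have "pderiv ((pderiv ^^ (n - 1)) q) = 0" by (simp add: pderiv_eq_0_iff)
    then show ?thesis using assms by (cases n) simp_all
  qed
  then have "pint (q * (pderiv ^^ n) ([:-1, 0, 1:] ^ n)) = 0"
    using poly_higher_pderiv_rodrigues_eq_0
    by (subst pint_mult_higher_pderiv) auto
  then show ?thesis by (simp add: legendre_def pint_smult)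
qed

lemma poly_legendre_minus_1: "poly (legendre n) (-1) = (-1) ^ n"
proof -
  have "poly (reflect (legendre n)) 1 = (-1) ^ n" by (simp add: reflect_legendre legendre_at_1)
  then show ?thesis by (simp add: poly_pcompose)
qed

text \<open>The polynomial \<open>x L_n' - n L_n\<close> has degree less than \<open>n\<close>, so \<open>\<integral> x L_n' L_n = n \<integral> L_n\<^sup>2\<close>; integrating
the left-hand side by parts gives a second relation between the same two integrals.\<close>

lemma pint_legendre_square: "pint (legendre n * legendre n) = 2 / (2 * real n + 1)"
proof -
  let ?L = "legendre n"
  let ?x = "[:0, 1::real:]"
  define r where "r = ?x * pderiv ?L - smult (real n) ?L"
  have coeff_r: "coeff r i = (real i - real n) * coeff ?L i" for i
    by (cases i) (simp_all add: r_def coeff_pderiv algebra_simps)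
  have "pint (r * ?L) = 0"
  proof (cases "r = 0")
    case False
    have "coeff r i = 0" if "i \<ge> n" for i
      using that by (cases "i = n") (simp_all add: coeff_r coeff_eq_0 degree_legendre)
    then have "degree r < n" using False leading_coeff_neq_0 not_le by metis
    then show ?thesis by (rule legendre_orthogonal)
  qed simp
  moreover have "r * ?L = pderiv ?L * (?x * ?L) - smult (real n) (?L * ?L)"
    by (simp add: r_def algebra_simps)
  ultimately have 1: "pint (pderiv ?L * (?x * ?L)) = real n * pint (?L * ?L)"
    by (simp add: pint_diff pint_smult)
  have "pint (pderiv ?L * (?x * ?L)) = jump 0 (?L * (?x * ?L)) - pint (?L * pderiv (?x * ?L))"
    by (rule pint_by_parts)
  also have "jump 0 (?L * (?x * ?L)) = 2"
    by (simp add: jump_def legendre_at_1 poly_legendre_minus_1 flip: power_mult_distrib)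
  also have "?L * pderiv (?x * ?L) = ?L * ?L + pderiv ?L * (?x * ?L)"
    unfolding pderiv_mult by (simp add: pderiv_pCons algebra_simps)
  finally have "2 * pint (pderiv ?L * (?x * ?L)) = 2 - pint (?L * ?L)" by (simp add: pint_add)
  with 1 have "(2 * real n + 1) * pint (?L * ?L) = 2" by (simp add: algebra_simps)
  then show ?thesis by (simp add: field_simps)
qed

lemma pint_legendre_mult:
  "pint (legendre i * legendre j) = (if i = j then 2 / (2 * real j + 1) else 0)"
  using legendre_orthogonal[of "legendre i" j] legendre_orthogonal[of "legendre j" i]
  by (cases i j rule: linorder_cases) (simp_all add: degree_legendre pint_legendre_square mult.commute)

text \<open>For \<open>m < j\<close> one integration by parts leaves only the boundary term, since the degree of the
derivative of \<open>L_m\<close> is less than \<open>j\<close>. The lemma expresses the Legendre coefficients of \<open>E'\<close> through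
the partial sums \<open>alpha\<close>.\<close>

lemma pint_pderiv_legendre_mult:
  "pint (pderiv (legendre j) * legendre m) = (if m < j \<and> odd (j + m) then 2 else 0)"
proof (cases "m < j")
  case True
  have "pint (legendre j * pderiv (legendre m)) = 0"
    using legendre_orthogonal[of "pderiv (legendre m)" j] True
    by (simp add: degree_pderiv degree_legendre mult.commute)
  then have "pint (pderiv (legendre j) * legendre m) = 1 - (-1) ^ (j + m)"
    unfolding pint_by_parts
    by (simp add: jump_def legendre_at_1 poly_legendre_minus_1 power_add)
  then show ?thesis using True by (cases "even (j + m)") simp_all
next
  case False
  have "pint (pderiv (legendre j) * legendre m) = 0"
  proof (cases "j = 0")
    case True
    then have "pderiv (legendre j) = 0" by (simp add: pderiv_eq_0_iff degree_legendre)
    then show ?thesis by simp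
  next
    case False
    with \<open>\<not> m < j\<close> show ?thesis by (intro legendre_orthogonal) (simp add: degree_pderiv degree_legendre)
  qed
  then show ?thesis using False by simp
qed

lemma eq_0_if_orthogonal_to_legendre:
  assumes "degree r \<le> n" "\<And>j. j \<le> n \<Longrightarrow> pint (r * legendre j) = 0"
  shows "r = 0"
proof (rule ccontr)
  assume "r \<noteq> 0"
  define m where "m = degree r"
  define L where "L = legendre m"
  define c where "c = lead_coeff r / lead_coeff L"
  define r' where "r' = r - smult c L"
  have L: "degree L = m" "L \<noteq> 0" by (simp_all add: L_def degree_legendre legendre_neq_0)
  have c: "c \<noteq> 0" using \<open>r \<noteq> 0\<close> L leading_coeff_neq_0[of L] by (auto simp: c_def)
  have "pint (r' * L) = 0"
  proof (cases "r' = 0")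
    case False
    have "coeff r' i = 0" if "i \<ge> m" for i
      using that L leading_coeff_neq_0[of L] by (cases "i = m") (simp_all add: r'_def c_def m_def coeff_eq_0)
    then have "degree r' < m" using False leading_coeff_neq_0 not_le by metis
    then show ?thesis unfolding L_def by (rule legendre_orthogonal)
  qed simp
  moreover have "pint (r * L) = 0" using assms by (simp add: L_def m_def)
  moreover have "r' * L = r * L - smult c (L * L)" by (simp add: r'_def algebra_simps)
  ultimately have "c * pint (L * L) = 0" by (simp add: pint_diff pint_smult)
  then show False using c by (simp add: L_def pint_legendre_square)
qed

lemma legendre_expansion:
  assumes "degree p \<le> n"
  shows "p = (\<Sum>j\<le>n. smult ((2 * real j + 1) / 2 * pint (p * legendre j)) (legendre j))"
    (is "p = ?q")
proof -
  have "degree ?q \<le> n"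
    by (intro degree_sum_le) (auto intro: order.trans[OF degree_smult_le] simp: degree_legendre)
  then have "degree (p - ?q) \<le> n" using assms by (rule degree_diff_le[rotated])
  moreover have "pint ((p - ?q) * legendre j) = 0" if "j \<le> n" for j
  proof -
    have pos: "1 + real i * 2 \<noteq> 0" "2 * real i + 1 \<noteq> 0" for i by linarith+
    have "pint (?q * legendre j) = (\<Sum>i\<le>n. (if i = j then pint (p * legendre j) else 0))"
      unfolding sum_distrib_right pint_sum
      by (intro sum.cong) (auto simp: pint_smult pint_legendre_mult pos)
    also have "\<dots> = pint (p * legendre j)" using that by simp
    finally show ?thesis by (simp add: left_diff_distrib pint_diff)
  qed
  ultimately have "p - ?q = 0" by (rule eq_0_if_orthogonal_to_legendre)
  then show ?thesis by simp
qed

lemma jump_legendre: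
  "jump s (legendre j) = (if even (j + s) then 0 else 2 * legendre_deriv_at_1 s j)"
  by (simp add: jump_parity[OF reflect_legendre] legendre_deriv_at_1_def)

text \<open>The leading part of the error on the reference element.\<close>

definition upoly :: "nat \<Rightarrow> (nat \<Rightarrow> real) \<Rightarrow> real poly" where
  "upoly k c = (\<Sum>j\<in>U k. smult (c j) (legendre j))"

lemma mod_2_eq_iff: "a mod 2 = b mod 2 \<longleftrightarrow> (even a \<longleftrightarrow> even (b :: nat))"
  by (auto simp: even_iff_mod_2_eq_zero)

lemma finite_U [simp]: "finite (U k)"
  by (simp add: U_def)

lemma parity_legendre_expansion:
  assumes "degree p \<le> k + 1" "reflect p = smult ((-1) ^ (k + 1)) p"
  shows "p = upoly k (\<lambda>j. (2 * real j + 1) / 2 * pint (p * legendre j))"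
proof -
  have "pint (p * legendre j) = 0" if "j mod 2 \<noteq> (k + 1) mod 2" for j
  proof -
    have "pint (p * legendre j) = pint (reflect (p * legendre j))" by (simp add: pint_reflect)
    also have "reflect (p * legendre j) = smult ((-1) ^ (k + 1) * (-1) ^ j) (p * legendre j)"
      by (simp only: pcompose_mult assms(2) reflect_legendre mult_smult_left mult_smult_right smult_smult mult.commute[of "(-1) ^ j"])
    also have "pint \<dots> = (-1) ^ (k + 1) * (-1) ^ j * pint (p * legendre j)" by (rule pint_smult)
    also have "(-1) ^ (k + 1) * (-1) ^ j = (-1 :: real)" 
      using that by (auto simp: mod_2_eq_iff minus_one_power_iff)
    finally show ?thesis by simp
  qed
  then have "(\<Sum>j\<le>k+1. smult ((2 * real j + 1) / 2 * pint (p * legendre j)) (legendre j)) = upoly k (\<lambda>j. (2 * real j + 1) / 2 * pint (p * legendre j))"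
    unfolding upoly_def by (intro sum.mono_neutral_right) (auto simp: U_def)
  then show ?thesis using legendre_expansion[OF assms(1)] by simp
qed

lemma degree_upoly_le:
  assumes "c (k + 1) = 0"
  shows "degree (upoly k c) \<le> k"
  unfolding upoly_def
proof (intro degree_sum_le)
  fix i assume "i \<in> U k"
  then show "degree (smult (c i) (legendre i)) \<le> k"
    using assms by (cases "i = k + 1") (auto simp: U_def degree_legendre intro: order.trans[OF degree_smult_le])
qed simp

lemma reflect_upoly: "reflect (upoly k c) = smult ((-1) ^ (k + 1)) (upoly k c)"
proof -
  have "(-1) ^ j = ((-1) ^ (k + 1) :: real)" if "j \<in> U k" for j
    using that by (auto simp: U_def mod_2_eq_iff minus_one_power_iff)
  then show ?thesis
    unfolding upoly_def pcompose_sum smult_sum_right pcompose_smult reflect_legendre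
    by (intro sum.cong refl) (simp add: mult.commute)
qed

lemma pint_upoly_legendre:
  "pint (upoly k c * legendre j) = (if j \<in> U k then 2 / (2 * real j + 1) * c j else 0)"
proof -
  have "pint (upoly k c * legendre j) = (\<Sum>i\<in>U k. if i = j then 2 / (2 * real j + 1) * c j else 0)"
    unfolding upoly_def sum_distrib_right pint_sum
    by (intro sum.cong) (auto simp: pint_smult pint_legendre_mult)
  then show ?thesis by simp
qed

section \<open>Linear functionals vanishing on a common kernel\<close>

text \<open>The induction removes one functional at a time: if the functional \<open>i\<close> does not vanish on the common
kernel of the others, a vector \<open>x\<close> of that kernel on which it does not vanish allows subtracting from
\<open>w\<close> the multiple of \<open>v i\<close> that makes the difference vanish on this kernel.

The lemma serves three purposes below: solvability of the normal equations, existence of a numerical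
differentiation formula, and the error bound for the ratios.\<close>

lemma functional_in_span:
  fixes v :: "'i \<Rightarrow> 'j \<Rightarrow> real"
  assumes "finite I" "finite J"
    and "\<And>c. (\<forall>i\<in>I. (\<Sum>j\<in>J. v i j * c j) = 0) \<Longrightarrow> (\<Sum>j\<in>J. w j * c j) = 0"
  shows "\<exists>a. \<forall>j\<in>J. w j = (\<Sum>i\<in>I. a i * v i j)"
  using assms(1,3)
proof (induction I arbitrary: w rule: finite_induct)
  case empty
  have "w j = 0" if "j \<in> J" for j
    using empty[of "\<lambda>i. if i = j then 1 else 0"] that \<open>finite J\<close> by (simp add: if_distrib cong: if_cong)
  then show ?case by simp
next
  case (insert i I)
  define F where "F = (\<lambda>i c. \<Sum>j\<in>J. v i j * c j)"
  define W where "W = (\<lambda>c. \<Sum>j\<in>J. w j * c j)"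
  show ?case
  proof (cases "\<exists>x. (\<forall>m\<in>I. F m x = 0) \<and> F i x \<noteq> 0")
    case False
    then have "\<exists>a. \<forall>j\<in>J. w j = (\<Sum>m\<in>I. a m * v m j)"
      using insert.prems by (intro insert.IH) (auto simp: F_def)
    then obtain a where a: "\<forall>j\<in>J. w j = (\<Sum>m\<in>I. a m * v m j)" ..
    have "\<forall>j\<in>J. w j = (\<Sum>m\<in>insert i I. (a(i := 0)) m * v m j)"
      using a insert.hyps by (auto intro!: sum.cong)
    then show ?thesis by blast
  next
    case True
    then obtain x where x: "\<forall>m\<in>I. F m x = 0" "F i x \<noteq> 0" by blast
    define t where "t = W x / F i x"
    have "\<exists>a. \<forall>j\<in>J. w j - t * v i j = (\<Sum>m\<in>I. a m * v m j)"
    proof (rule insert.IH)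
      fix c assume c: "\<forall>m\<in>I. (\<Sum>j\<in>J. v m j * c j) = 0"
      define s where "s = F i c / F i x"
      define d where "d = (\<lambda>j. c j - s * x j)"
      have F: "F m d = F m c - s * F m x" for m
        by (simp add: F_def d_def right_diff_distrib sum_subtractf sum_distrib_left mult_ac)
      have "\<forall>m\<in>insert i I. F m d = 0" using x c unfolding F by (auto simp: F_def s_def)
      then have "W d = 0" using insert.prems[of d] by (simp add: F_def W_def)
      moreover have "W d = W c - s * W x"
        by (simp add: W_def d_def right_diff_distrib sum_subtractf sum_distrib_left mult_ac)
      ultimately have "W c - t * F i c = 0" by (simp add: t_def s_def)
      then show "(\<Sum>j\<in>J. (w j - t * v i j) * c j) = 0"
        by (simp add: W_def F_def left_diff_distrib sum_subtractf sum_distrib_left mult.assoc)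
    qed
    then obtain a where a: "\<forall>j\<in>J. w j - t * v i j = (\<Sum>m\<in>I. a m * v m j)" ..
    have "w j = (\<Sum>m\<in>insert i I. (a(i := t)) m * v m j)" if "j \<in> J" for j
    proof -
      have "(\<Sum>m\<in>I. (a(i := t)) m * v m j) = (\<Sum>m\<in>I. a m * v m j)"
        using insert.hyps by (intro sum.cong) auto
      then show ?thesis using a that insert.hyps by (simp add: algebra_simps)
    qed
    then show ?thesis by blast
  qed
qed

section \<open>The constraints as jump and orthogonality conditions\<close>

text \<open>The form of the \<open>H^1\<close> seminorm on \<open>[-1, 1]\<close>.\<close>

definition h1_form :: "real poly \<Rightarrow> real poly \<Rightarrow> real" where
  "h1_form p q = pint (pderiv p * pderiv q)"

text \<open>The Bernoulli polynomials with these indices and the constants span, within the parity of \<open>k + 1\<close>, the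
polynomials of degree at most \<open>k\<close> with a periodic extension of class \<open>C^mu\<close>.\<close>

definition bern_index :: "nat \<Rightarrow> nat \<Rightarrow> nat set" where
  "bern_index k mu = {n \<in> {mu + 2..k}. n mod 2 = (k + 1) mod 2}"

lemma finite_bern_index [simp]: "finite (bern_index k mu)"
  by (simp add: bern_index_def)

lemma finite_N_index [simp]: "finite (N_index k mu)"
  by (simp add: N_index_def)

lemma h1_form_commute: "h1_form p q = h1_form q p"
  by (simp add: h1_form_def mult.commute)

lemma h1_form_add: "h1_form (p + q) r = h1_form p r + h1_form q r"
  by (simp add: h1_form_def pderiv_add distrib_right pint_add)

lemma h1_form_diff: "h1_form (p - q) r = h1_form p r - h1_form q r"
  by (simp add: h1_form_def pderiv_diff left_diff_distrib pint_diff)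

lemma h1_form_smult: "h1_form (smult a p) r = a * h1_form p r"
  by (simp add: h1_form_def pderiv_smult pint_smult)

lemma h1_form_0 [simp]: "h1_form 0 r = 0"
  by (simp add: h1_form_def)

lemma h1_form_sum: "h1_form (sum f A) r = (\<Sum>x\<in>A. h1_form (f x) r)"
  by (induction A rule: infinite_finite_induct) (simp_all add: h1_form_add)

lemma h1_form_smult_right: "h1_form r (smult a p) = a * h1_form r p"
  using h1_form_smult h1_form_commute by metis

lemma h1_form_sum_right: "h1_form r (sum f A) = (\<Sum>x\<in>A. h1_form r (f x))"
  using h1_form_sum[of f A r] by (simp add: h1_form_commute)

lemma pderiv_eq_0_if_h1_form_self: "h1_form p p = 0 \<Longrightarrow> pderiv p = 0"
  unfolding h1_form_def by (rule pint_square_eq_0)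

lemma h1_form_eq_0_if_pderiv: "pderiv p = 0 \<Longrightarrow> h1_form p r = 0"
  by (simp add: h1_form_def)

lemma h1_form_upoly: "h1_form (upoly k c) r = (\<Sum>j\<in>U k. c j * h1_form (legendre j) r)"
  by (simp add: upoly_def h1_form_sum h1_form_smult)

lemma jump_upoly: "jump s (upoly k c) = (\<Sum>j\<in>U k. c j * jump s (legendre j))"
  by (simp add: upoly_def jump_sum jump_smult)

lemma parity_eq: "reflect p = smult ((-1) ^ n) p \<Longrightarrow> n mod 2 = m mod 2 \<Longrightarrow> reflect p = smult ((-1) ^ m) p"
  by (auto simp: mod_2_eq_iff minus_one_power_iff)

lemma pint_pderiv_upoly_legendre:
  "pint (pderiv (upoly k c) * legendre m) = (if m mod 2 = k mod 2 then 2 * alpha k c m else 0)"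
proof -
  have "pint (pderiv (upoly k c) * legendre m) = (\<Sum>j\<in>U k. c j * (if m < j \<and> odd (j + m) then 2 else 0))"
    unfolding upoly_def higher_pderiv_sum[where n=1, simplified] sum_distrib_right pint_sum
    by (simp add: pderiv_smult pint_smult pint_pderiv_legendre_mult)
  also have "\<dots> = (if m mod 2 = k mod 2 then 2 * alpha k c m else 0)"
  proof (cases "m mod 2 = k mod 2")
    case True
    have "odd (j + m)" if "j \<in> U k" for j using that True by (auto simp: U_def mod_2_eq_iff)
    then have "(\<Sum>j\<in>U k. c j * (if m < j \<and> odd (j + m) then 2 else 0)) = (\<Sum>j\<in>U k. if j \<ge> m + 1 then 2 * c j else 0)"
      by (intro sum.cong) auto
    also have "\<dots> = 2 * alpha k c m"
      unfolding alpha_def sum_distrib_left by (simp add: sum.inter_filter)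
    finally show ?thesis using True by simp
  next
    case False
    have "\<not> odd (j + m)" if "j \<in> U k" for j using that False by (auto simp: U_def mod_2_eq_iff)
    then have "(\<Sum>j\<in>U k. c j * (if m < j \<and> odd (j + m) then 2 else 0)) = 0"
      by (intro sum.neutral) auto
    then show ?thesis using False by simp
  qed
  finally show ?thesis .
qed

lemma h1_form_bern: "n \<ge> 1 \<Longrightarrow> h1_form p (bern n) = pint (pderiv p * bern (n - 1))"
  by (cases n) (simp_all add: h1_form_def pderiv_bern del: bern.simps)

text \<open>Put \<open>q = b_n' = b_{n-1}\<close> and expand it in Legendre polynomials. By (G) the integral \<open>\<integral> E' q\<close> turns into a
combination, with coefficients \<open>2 \<lambda>_r\<close>, of the jumps of \<open>q\<close> of orders \<open>r < mu\<close>, and these are zero because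
only the jump of order \<open>n - 2 \<ge> mu\<close> of \<open>q\<close> is not.\<close>

lemma G_constraints_imp_orthogonal:
  assumes "G_constraints k mu c" "n \<in> bern_index k mu"
  shows "h1_form (upoly k c) (bern n) = 0"
proof -
  define E where "E = upoly k c"
  obtain lam where lam: "\<And>m. m \<in> {1..k-2} \<Longrightarrow> m mod 2 = k mod 2 \<Longrightarrow>
        alpha k c m = (\<Sum>r | r < mu \<and> r mod 2 = (m + 1) mod 2. 2 * lam r * legendre_deriv_at_1 r m)"
    using assms(1) unfolding G_constraints_def by blast
  have n: "mu + 2 \<le> n" "n \<le> k" "n mod 2 = (k + 1) mod 2" using assms(2) by (auto simp: bern_index_def)
  define q where "q = bern (n - 1)"
  define b where "b = (\<lambda>m. (2 * real m + 1) / 2 * pint (q * legendre m))"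
  define R where "R = {r. r < mu \<and> r mod 2 = (k + 1) mod 2}"
  \<comment> \<open>The index range of (G). It contains every degree of the right parity that can occur in \<open>q\<close>, except \<open>0\<close>,
    which is absent because \<open>q\<close> has mean zero.\<close>
  define M where "M = {m \<in> {1..k-2}. m mod 2 = k mod 2}"
  have M: "m \<in> M" if "m \<le> k - 1" "m mod 2 = k mod 2" "m \<noteq> 0" for m
  proof -
    have "m \<noteq> k - 1" using that n by (cases k) (auto simp: mod_2_eq_iff)
    then show ?thesis using that by (auto simp: M_def)
  qed
  have "n - 1 = Suc (n - 2)" using n by simp
  then have "pint q = 0" using pint_bern by (simp add: q_def del: bern.simps)
  then have b0: "b 0 = 0" by (simp add: b_def legendre_def)
  have "degree q \<le> k - 1" using degree_bern_le[of "n - 1"] n by (simp add: q_def)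
  then have q: "q = (\<Sum>m\<le>k-1. smult (b m) (legendre m))"
    unfolding b_def by (rule legendre_expansion)
  have jq: "(\<Sum>m\<in>M. b m * jump r (legendre m)) = 0" if "r \<in> R" for r
  proof -
    have "(\<Sum>m\<in>M. b m * jump r (legendre m)) = (\<Sum>m\<le>k-1. b m * jump r (legendre m))"
    proof (rule sum.mono_neutral_left)
      show "\<forall>m\<in>{..k - 1} - M. b m * jump r (legendre m) = 0"
      proof
        fix m assume "m \<in> {..k - 1} - M"
        then have "m = 0 \<or> m mod 2 \<noteq> k mod 2" using M by auto
        moreover have "even (m + r)" if "m mod 2 \<noteq> k mod 2"
          using that \<open>r \<in> R\<close> by (auto simp: R_def mod_2_eq_iff)
        ultimately show "b m * jump r (legendre m) = 0" using b0 by (auto simp: jump_legendre)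
      qed
    qed (auto simp: M_def)
    also have "\<dots> = jump r q" by (subst q) (simp add: jump_sum jump_smult)
    also have "\<dots> = 0" using that n by (auto simp: q_def jump_bern R_def)
    finally show ?thesis .
  qed
  have "h1_form E (bern n) = pint (pderiv E * q)" using n by (simp add: h1_form_bern q_def)
  also have "\<dots> = (\<Sum>m\<le>k-1. b m * pint (pderiv E * legendre m))"
    by (subst q) (simp add: sum_distrib_left pint_sum pint_smult)
  also have "\<dots> = (\<Sum>m\<in>M. b m * pint (pderiv E * legendre m))"
  proof (rule sum.mono_neutral_right)
    show "\<forall>m\<in>{..k - 1} - M. b m * pint (pderiv E * legendre m) = 0"
      using M b0 by (auto simp: E_def pint_pderiv_upoly_legendre)
  qed (auto simp: M_def)
  also have "\<dots> = (\<Sum>m\<in>M. b m * (\<Sum>r\<in>R. 2 * lam r * jump r (legendre m)))"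
  proof (rule sum.cong)
    fix m assume m: "m \<in> M"
    then have "{r. r < mu \<and> r mod 2 = (m + 1) mod 2} = R" by (auto simp: M_def R_def mod_2_eq_iff)
    then have "pint (pderiv E * legendre m) = (\<Sum>r\<in>R. 2 * (2 * lam r * legendre_deriv_at_1 r m))"
      using m lam[of m] by (simp add: E_def pint_pderiv_upoly_legendre M_def sum_distrib_left)
    also have "\<dots> = (\<Sum>r\<in>R. 2 * lam r * jump r (legendre m))"
    proof (rule sum.cong)
      fix r assume "r \<in> R"
      then have "odd (m + r)" using m by (auto simp: R_def M_def mod_2_eq_iff)
      then show "2 * (2 * lam r * legendre_deriv_at_1 r m) = 2 * lam r * jump r (legendre m)"
        by (simp add: jump_legendre)
    qed simp
    finally show "b m * pint (pderiv E * legendre m) = b m * (\<Sum>r\<in>R. 2 * lam r * jump r (legendre m))" by simp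
  qed simp
  also have "\<dots> = (\<Sum>r\<in>R. 2 * lam r * (\<Sum>m\<in>M. b m * jump r (legendre m)))"
    unfolding sum_distrib_left by (subst sum.swap) (simp add: mult_ac)
  also have "\<dots> = 0" using jq by (intro sum.neutral) simp
  finally show ?thesis by (simp add: E_def)
qed

text \<open>The multipliers are explicit. Expand \<open>L_m\<close> in Bernoulli polynomials: \<open>2 alpha_m = \<integral> E' L_m\<close> is the sum over
\<open>r\<close> of the halved jump of order \<open>r\<close> of \<open>L_m\<close> times \<open>\<integral> E' b_{r+1}\<close>. The terms with \<open>r \<ge> mu\<close> vanish by
orthogonality or by parity, and the others have the form required by (G) with
\<open>\<lambda>_r = (\<integral> E' b_{r+1}) / 4\<close>.\<close>

lemma orthogonal_imp_G_constraints:
  assumes "mu \<le> k - 1" "\<And>n. n \<in> bern_index k mu \<Longrightarrow> h1_form (upoly k c) (bern n) = 0"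
  shows "G_constraints k mu c"
proof -
  define E where "E = upoly k c"
  define h where "h = (\<lambda>j. pint (pderiv E * bern j))"
  have "alpha k c m = (\<Sum>r | r < mu \<and> r mod 2 = (m + 1) mod 2. 2 * (h (Suc r) / 4) * legendre_deriv_at_1 r m)"
    if m: "m \<in> {1..k-2}" "m mod 2 = k mod 2" for m
  proof -
    let ?L = "legendre m" and ?R = "{r. r < mu \<and> r mod 2 = (m + 1) mod 2}"
    have "pint ?L = 0"
      using legendre_orthogonal[of 1 m] m by simp
    then have "?L = (\<Sum>j=1..k-1. smult (jump (j - 1) ?L / 2) (bern j))"
      using bern_expansion[of ?L "k - 1", unfolded degree_legendre] m by auto
    also have "\<dots> = (\<Sum>r<k-1. smult (jump r ?L / 2) (bern (Suc r)))"
      by (rule sum.reindex_bij_witness[where i=Suc and j="\<lambda>j. j - 1"]) auto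
    finally have L: "?L = (\<Sum>r<k-1. smult (jump r ?L / 2) (bern (Suc r)))" .
    have "2 * alpha k c m = pint (pderiv E * ?L)"
      using m by (simp add: E_def pint_pderiv_upoly_legendre)
    also have "\<dots> = (\<Sum>r<k-1. jump r ?L / 2 * h (Suc r))"
      by (subst L) (simp add: sum_distrib_left pint_sum pint_smult h_def del: bern.simps)
    also have "\<dots> = (\<Sum>r\<in>?R. jump r ?L / 2 * h (Suc r))"
    proof (rule sum.mono_neutral_right)
      show "?R \<subseteq> {..<k - 1}" using assms(1) by auto
      show "\<forall>r\<in>{..<k - 1} - ?R. jump r ?L / 2 * h (Suc r) = 0"
      proof
        fix r assume r: "r \<in> {..<k - 1} - ?R"
        show "jump r ?L / 2 * h (Suc r) = 0"
        proof (cases "even (m + r)")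
          case True then show ?thesis by (simp add: jump_legendre)
        next
          case False
          then have "r mod 2 = (m + 1) mod 2" by (auto simp: mod_2_eq_iff)
          with r have "mu \<le> r" by simp
          moreover have "Suc (Suc r) mod 2 = (k + 1) mod 2" using False m by (auto simp: mod_2_eq_iff)
          ultimately have "Suc (Suc r) \<in> bern_index k mu" using r by (auto simp: bern_index_def)
          then have "h1_form E (bern (Suc (Suc r))) = 0" using assms(2) by (simp add: E_def del: bern.simps)
          then have "h (Suc r) = 0" by (simp add: h1_form_bern h_def del: bern.simps)
          then show ?thesis by simp
        qed
      qed
    qed simp
    also have "\<dots> = (\<Sum>r\<in>?R. legendre_deriv_at_1 r m * h (Suc r))"
    proof (rule sum.cong)
      fix r assume "r \<in> ?R"
      then have "odd (m + r)" by (auto simp: mod_2_eq_iff)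
      then show "jump r ?L / 2 * h (Suc r) = legendre_deriv_at_1 r m * h (Suc r)" by (simp add: jump_legendre)
    qed simp
    also have "\<dots> = 2 * (\<Sum>r\<in>?R. 2 * (h (Suc r) / 4) * legendre_deriv_at_1 r m)"
      unfolding sum_distrib_left by (intro sum.cong) simp_all
    finally show ?thesis by simp
  qed
  then show ?thesis unfolding G_constraints_def by (intro exI[of _ "\<lambda>r. h (Suc r) / 4"]) simp
qed

lemma G_constraints_iff:
  assumes "mu \<le> k - 1"
  shows "G_constraints k mu c \<longleftrightarrow> (\<forall>n\<in>bern_index k mu. h1_form (upoly k c) (bern n) = 0)"
  using G_constraints_imp_orthogonal orthogonal_imp_G_constraints[OF assms] by blast

lemma N_sum_eq_jump:
  assumes "s mod 2 = k mod 2"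
  shows "(\<Sum>j\<in>U k. c j * legendre_deriv_at_1 s j) = jump s (upoly k c) / 2"
  unfolding jump_upoly sum_divide_distrib
proof (rule sum.cong)
  fix j assume "j \<in> U k"
  then have "odd (j + s)" using assms by (auto simp: U_def mod_2_eq_iff)
  then show "c j * legendre_deriv_at_1 s j = c j * jump s (legendre j) / 2" by (simp add: jump_legendre)
qed simp

lemma jump_upoly_eq_0_parity: "s mod 2 \<noteq> k mod 2 \<Longrightarrow> jump s (upoly k c) = 0"
  unfolding jump_parity[OF reflect_upoly] by (auto simp: mod_2_eq_iff)

lemma N_constraints_iff: "N_constraints k mu c \<longleftrightarrow> (\<forall>s\<le>mu. jump s (upoly k c) = 0)"
  unfolding N_constraints_def using jump_upoly_eq_0_parity[of _ k c]
  by (auto simp: N_sum_eq_jump N_index_def)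

section \<open>Independence and unique solvability\<close>

definition bern_comb :: "nat \<Rightarrow> nat \<Rightarrow> (nat \<Rightarrow> real) \<Rightarrow> real poly" where
  "bern_comb k mu a = (\<Sum>n\<in>bern_index k mu. smult (a n) (bern n))"

lemma jump_bern_comb:
  "jump s (bern_comb k mu a) = (if Suc s \<in> bern_index k mu then 2 * a (Suc s) else 0)"
proof -
  have "jump s (bern_comb k mu a) = (\<Sum>n\<in>bern_index k mu. if n = Suc s then 2 * a n else 0)"
    unfolding bern_comb_def jump_sum by (intro sum.cong) (auto simp: jump_smult jump_bern)
  then show ?thesis by simp
qed

lemma reflect_bern_comb: "reflect (bern_comb k mu a) = smult ((-1) ^ (k + 1)) (bern_comb k mu a)"
proof -
  have "reflect (bern n) = smult ((-1) ^ (k + 1)) (bern n)" if "n \<in> bern_index k mu" for n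
    using that parity_eq[OF reflect_bern[of n], of "k + 1"] by (simp add: bern_index_def)
  then show ?thesis
    unfolding bern_comb_def pcompose_sum smult_sum_right pcompose_smult
    by (intro sum.cong refl) (simp add: mult.commute)
qed

lemma degree_bern_comb: "degree (bern_comb k mu a) \<le> k"
  unfolding bern_comb_def
  by (intro degree_sum_le)
     (auto intro!: order.trans[OF degree_smult_le] order.trans[OF degree_bern_le] simp: bern_index_def)

lemma h1_form_bern_comb_right: "h1_form p (bern_comb k mu a) = (\<Sum>n\<in>bern_index k mu. a n * h1_form p (bern n))"
  by (simp add: bern_comb_def h1_form_sum_right h1_form_smult_right)

text \<open>The normal equations are solvable because a polynomial orthogonal to the whole span, in particular to
itself, is constant if it lies in the span.\<close>

lemma ex_projection:
  "\<exists>a. \<forall>n\<in>bern_index k mu. h1_form (p - bern_comb k mu a) (bern n) = 0"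
proof -
  have "\<exists>a. \<forall>n\<in>bern_index k mu. h1_form p (bern n) = (\<Sum>m\<in>bern_index k mu. a m * h1_form (bern m) (bern n))"
  proof (rule functional_in_span)
    fix c assume c: "\<forall>m\<in>bern_index k mu. (\<Sum>n\<in>bern_index k mu. h1_form (bern m) (bern n) * c n) = 0"
    define Q where "Q = bern_comb k mu c"
    have "h1_form (bern m) Q = 0" if "m \<in> bern_index k mu" for m
      using c that by (simp add: Q_def h1_form_bern_comb_right mult.commute)
    then have "h1_form Q Q = 0"
      by (subst (2) Q_def) (simp add: h1_form_bern_comb_right h1_form_commute[of Q])
    then have "h1_form p Q = 0"
      using pderiv_eq_0_if_h1_form_self h1_form_eq_0_if_pderiv h1_form_commute by metis
    then show "(\<Sum>n\<in>bern_index k mu. h1_form p (bern n) * c n) = 0"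
      by (simp add: Q_def h1_form_bern_comb_right mult.commute)
  qed simp_all
  then show ?thesis
    by (simp add: h1_form_diff bern_comb_def h1_form_sum h1_form_smult)
qed

text \<open>Subtracting the projection onto the span of the \<open>b_n\<close> with \<open>n\<close> in \<open>bern_index k mu\<close> changes only the jumps of
orders between \<open>mu + 1\<close> and \<open>k - 1\<close>.\<close>

lemma ex_G_constraints_with_jumps:
  assumes "mu \<le> k - 1" "degree p \<le> k + 1" "reflect p = smult ((-1) ^ (k + 1)) p"
  obtains c where "G_constraints k mu c" "\<And>s. s \<le> mu \<or> s \<ge> k \<Longrightarrow> jump s (upoly k c) = jump s p"
proof -
  obtain a where a: "\<And>n. n \<in> bern_index k mu \<Longrightarrow> h1_form (p - bern_comb k mu a) (bern n) = 0"
    using ex_projection by blast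
  define q where "q = p - bern_comb k mu a"
  have "degree q \<le> k + 1"
    unfolding q_def using degree_bern_comb[of k mu a] assms(2) by (intro degree_diff_le) auto
  moreover have "reflect q = smult ((-1) ^ (k + 1)) q"
    unfolding q_def pcompose_diff smult_diff_right using assms(3) reflect_bern_comb by simp
  ultimately obtain c where c: "q = upoly k c" using parity_legendre_expansion by blast
  have "G_constraints k mu c"
    using a assms(1) by (simp add: G_constraints_iff q_def flip: c)
  moreover have "jump s (upoly k c) = jump s p" if "s \<le> mu \<or> s \<ge> k" for s
    using that unfolding c[symmetric] q_def jump_diff jump_bern_comb by (auto simp: bern_index_def)
  ultimately show thesis by (rule that)
qed

text \<open>The equations are the orthogonality relations of \<open>G_constraints_iff\<close>, renumbered. A linear combination of
them is the functional \<open>p \<mapsto> h1_form p Q\<close> with \<open>Q\<close> in the span of the test polynomials; if it vanishes on all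
\<open>L_j\<close>, then \<open>Q\<close> is orthogonal to itself, hence constant, and its jumps show that all weights are zero.\<close>

lemma ex_G_eliminated:
  assumes "mu \<le> k - 1"
  shows "\<exists>q g. G_eliminated k mu q g"
proof -
  define S where "S = bern_index k mu"
  obtain e where e: "bij_betw e {0..<card S} S"
    using ex_bij_betw_nat_finite[of S] by (auto simp: S_def)
  define g where "g = (\<lambda>i j. h1_form (legendre j) (bern (e i)))"
  define q where "q = card S"
  have e: "bij_betw e {..<q} S" using e by (simp add: q_def lessThan_atLeast0)
  have "lin_indep_family (U k) {..<q} g"
    unfolding lin_indep_family_def
  proof (intro allI impI ballI)
    fix w i assume w: "\<forall>j\<in>U k. (\<Sum>i<q. w i * g i j) = 0" and i: "i \<in> {..<q}"
    define a where "a = (\<lambda>n. w (inv_into {..<q} e n))"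
    define Q where "Q = bern_comb k mu a"
    have inj: "inj_on e {..<q}" using e by (rule bij_betw_imp_inj_on)
    have ae: "a (e i) = w i" if "i < q" for i
      using that by (simp add: a_def inv_into_f_f[OF inj])
    have zero: "h1_form (legendre j) Q = 0" if "j \<in> U k" for j
    proof -
      have "h1_form (legendre j) Q = (\<Sum>n\<in>S. a n * h1_form (legendre j) (bern n))"
        by (simp add: Q_def h1_form_bern_comb_right S_def)
      also have "\<dots> = (\<Sum>i<q. a (e i) * h1_form (legendre j) (bern (e i)))"
        by (rule sum.reindex_bij_betw[OF e, symmetric])
      also have "\<dots> = (\<Sum>i<q. w i * g i j)" by (intro sum.cong) (simp_all add: ae g_def)
      finally show ?thesis using w that by simp
    qed
    obtain c where "Q = upoly k c"
      using parity_legendre_expansion[of Q k] degree_bern_comb[of k mu a] reflect_bern_comb[of k mu a]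
      by (auto simp: Q_def)
    then have "h1_form Q Q = 0"
      using zero by (metis (no_types, lifting) h1_form_upoly mult_zero_right sum.neutral)
    then have "pderiv Q = 0" by (rule pderiv_eq_0_if_h1_form_self)
    have ei: "e i \<in> bern_index k mu" using e i by (auto simp: bij_betw_def S_def)
    then have "e i \<ge> 2" by (auto simp: bern_index_def)
    then have s: "e i = Suc (Suc (e i - 2))" by simp
    have "jump (Suc (e i - 2)) Q = 0"
      using \<open>pderiv Q = 0\<close> by (simp flip: jump_pderiv)
    then have "a (e i) = 0" using ei s by (simp add: Q_def jump_bern_comb)
    then show "w i = 0" using ae i by simp
  qed
  moreover have "(\<forall>i<q. (\<Sum>j\<in>U k. g i j * c j) = 0) \<longleftrightarrow> G_constraints k mu c" for c
  proof -
    have "(\<forall>i<q. (\<Sum>j\<in>U k. g i j * c j) = 0) \<longleftrightarrow> (\<forall>i\<in>{..<q}. h1_form (upoly k c) (bern (e i)) = 0)"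
      by (auto simp: h1_form_upoly g_def mult.commute)
    also have "\<dots> \<longleftrightarrow> (\<forall>n\<in>e ` {..<q}. h1_form (upoly k c) (bern n) = 0)" by simp
    also have "\<dots> \<longleftrightarrow> G_constraints k mu c"
      using e by (simp add: bij_betw_def S_def G_constraints_iff[OF assms])
    finally show ?thesis .
  qed
  ultimately show ?thesis unfolding G_eliminated_def by blast
qed

text \<open>Evaluating a vanishing combination at a vector that satisfies (G), and for which among the jumps up to
order \<open>mu\<close> exactly the one of order \<open>s\<close> is non-zero, isolates the weight of the equation \<open>s\<close> of (N). Once
the weights of (N) are zero, those of (G) are zero by hypothesis. The argument sees only the solution set
of the eliminated equations, so it covers every way of eliminating the parameters.\<close>

lemma lin_indep_G_N:
  assumes "mu \<le> k - 1" "G_eliminated k mu q g"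
  shows "lin_indep_family (U k) ({..<q} <+> N_index k mu)
          (case_sum g (\<lambda>s j. legendre_deriv_at_1 s j))"
  unfolding lin_indep_family_def
proof (intro allI impI)
  fix w :: "nat + nat \<Rightarrow> real"
  assume w: "\<forall>j\<in>U k. (\<Sum>i\<in>{..<q} <+> N_index k mu. w i * case_sum g legendre_deriv_at_1 i j) = 0"
  have w: "(\<Sum>i<q. w (Inl i) * g i j) + (\<Sum>s\<in>N_index k mu. w (Inr s) * legendre_deriv_at_1 s j) = 0"
    if "j \<in> U k" for j
    using w that by (simp add: sum.Plus)
  have g: "lin_indep_family (U k) {..<q} g"
    and G: "G_constraints k mu c \<Longrightarrow> i < q \<Longrightarrow> (\<Sum>j\<in>U k. g i j * c j) = 0" for c i
    using assms(2) by (auto simp: G_eliminated_def)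
  have N: "w (Inr s) = 0" if s: "s \<in> N_index k mu" for s
  proof -
    have s': "s \<le> mu" "s mod 2 = k mod 2" using s by (auto simp: N_index_def)
    have "degree (bern (Suc s)) \<le> k + 1" using degree_bern_le[of "Suc s"] s' assms(1) by linarith
    moreover have "reflect (bern (Suc s)) = smult ((-1) ^ (k + 1)) (bern (Suc s))"
      by (rule parity_eq[OF reflect_bern]) (use s' in \<open>auto simp: mod_2_eq_iff\<close>)
    ultimately obtain c where c: "G_constraints k mu c"
      and cj: "\<And>t. t \<le> mu \<or> t \<ge> k \<Longrightarrow> jump t (upoly k c) = jump t (bern (Suc s))"
      using ex_G_constraints_with_jumps[OF assms(1)] by blast
    have "0 = (\<Sum>j\<in>U k. c j * ((\<Sum>i<q. w (Inl i) * g i j) + (\<Sum>s\<in>N_index k mu. w (Inr s) * legendre_deriv_at_1 s j)))"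
      using w by (intro sum.neutral[symmetric]) simp
    also have "\<dots> = (\<Sum>i<q. w (Inl i) * (\<Sum>j\<in>U k. g i j * c j))
        + (\<Sum>s\<in>N_index k mu. w (Inr s) * (\<Sum>j\<in>U k. c j * legendre_deriv_at_1 s j))"
      unfolding distrib_left sum.distrib sum_distrib_left
      by (subst (1 2) sum.swap) (simp add: mult_ac)
    also have "(\<Sum>i<q. w (Inl i) * (\<Sum>j\<in>U k. g i j * c j)) = 0"
      using G[OF c] by simp
    also have "(\<Sum>s\<in>N_index k mu. w (Inr s) * (\<Sum>j\<in>U k. c j * legendre_deriv_at_1 s j))
        = (\<Sum>t\<in>N_index k mu. if t = s then w (Inr t) else 0)"
    proof (rule sum.cong)
      fix t assume "t \<in> N_index k mu"
      then have "t \<le> mu" "t mod 2 = k mod 2" by (auto simp: N_index_def)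
      then show "w (Inr t) * (\<Sum>j\<in>U k. c j * legendre_deriv_at_1 t j) = (if t = s then w (Inr t) else 0)"
        using cj[of t] by (simp add: N_sum_eq_jump jump_bern del: bern.simps)
    qed simp
    also have "\<dots> = w (Inr s)" using s by simp
    finally show ?thesis by simp
  qed
  then have "\<forall>j\<in>U k. (\<Sum>i<q. w (Inl i) * g i j) = 0" using w by simp
  then have "\<forall>i<q. w (Inl i) = 0"
    using g[unfolded lin_indep_family_def, rule_format, of "\<lambda>i. w (Inl i)"] by simp
  with N show "\<forall>i\<in>{..<q} <+> N_index k mu. w i = 0" by auto
qed

text \<open>With \<open>c (k + 1) = 0\<close>, the polynomial \<open>E\<close> has degree at most \<open>k\<close>, and by (N) its Bernoulli expansion contains
only constants and the test polynomials of (G). It is therefore orthogonal to itself and constant.\<close>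

lemma constraints_kernel:
  assumes "mu \<le> k - 1" "G_constraints k mu c" "N_constraints k mu c" "c (k + 1) = 0"
    and j: "j \<in> U k" "j \<noteq> 0"
  shows "c j = 0"
proof -
  define E where "E = upoly k c"
  have "degree E \<le> k" unfolding E_def using assms(4) by (rule degree_upoly_le)
  then have E: "E = [:pint E / 2:] + (\<Sum>n=1..k. smult (jump (n - 1) E / 2) (bern n))"
    by (rule bern_expansion)
  have "h1_form E (smult (jump (n - 1) E / 2) (bern n)) = 0" if "n \<in> {1..k}" for n
  proof (cases "n \<in> bern_index k mu")
    case True
    then show ?thesis using assms(1,2) by (simp add: h1_form_smult_right E_def G_constraints_iff)
  next
    case False
    then have "n - 1 \<le> mu \<or> (n - 1) mod 2 \<noteq> k mod 2"
      using that by (cases n) (auto simp: bern_index_def mod_2_eq_iff)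
    then have "jump (n - 1) E = 0"
      using assms(3) jump_upoly_eq_0_parity by (auto simp: E_def N_constraints_iff)
    then show ?thesis by (simp add: h1_form_commute[of E])
  qed
  then have "h1_form E (\<Sum>n=1..k. smult (jump (n - 1) E / 2) (bern n)) = 0"
    unfolding h1_form_sum_right by (intro sum.neutral) blast
  moreover have "h1_form E [:pint E / 2:] = 0" by (simp add: h1_form_def)
  ultimately have "h1_form E E = 0"
    by (subst (2) E) (simp add: h1_form_commute[of E] h1_form_add)
  then have "degree E = 0" using pderiv_eq_0_if_h1_form_self by (simp add: pderiv_eq_0_iff)
  then have "pint (E * legendre j) = 0" using j by (intro legendre_orthogonal) simp
  then show ?thesis using j by (auto simp: E_def pint_upoly_legendre add_eq_0_iff)
qed

text \<open>For even \<open>k\<close> the index \<open>0\<close> does not belong to \<open>U k\<close>, so the two cases of the definition agree.\<close>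

lemma ratio_index_eq: "ratio_index k = U k - {0, k + 1}"
  by (auto simp: ratio_index_def U_def)

lemma upoly_diff: "upoly k (\<lambda>j. c j - t * d j) = upoly k c - smult t (upoly k d)"
  unfolding upoly_def smult_sum_right sum_subtractf[symmetric]
  by (intro sum.cong) (simp_all add: smult_diff_left)

lemma constraints_diff:
  assumes "mu \<le> k - 1" "G_constraints k mu c" "N_constraints k mu c" "G_constraints k mu d" "N_constraints k mu d"
  shows "G_constraints k mu (\<lambda>j. c j - t * d j)" "N_constraints k mu (\<lambda>j. c j - t * d j)"
  using assms
  by (simp_all add: G_constraints_iff N_constraints_iff upoly_diff h1_form_diff h1_form_smult jump_diff jump_smult)

text \<open>A solution \<open>d\<close> with \<open>d (k + 1) \<noteq> 0\<close> arises from \<open>b_{k+1}\<close>, whose jumps up to order \<open>mu\<close> vanish while that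
of order \<open>k\<close> does not; the latter is zero for polynomials of degree at most \<open>k\<close>. The difference of any
solution and a suitable multiple of \<open>d\<close> lies in the kernel of the preceding lemma.\<close>

lemma ex_ratios:
  assumes "mu \<le> k - 1" and "k \<ge> 1"
  obtains rho where "determine_ratios k mu rho"
    "\<And>c j. G_constraints k mu c \<Longrightarrow> N_constraints k mu c \<Longrightarrow> j \<in> ratio_index k \<Longrightarrow> c j = rho j * c (k + 1)"
proof -
  obtain d where d: "G_constraints k mu d"
      and dj: "\<And>s. s \<le> mu \<or> s \<ge> k \<Longrightarrow> jump s (upoly k d) = jump s (bern (k + 1))"
    using ex_G_constraints_with_jumps[OF assms(1) degree_bern_le reflect_bern] by blast
  have N: "N_constraints k mu d"
    unfolding N_constraints_iff
  proof (intro allI impI)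
    fix s assume "s \<le> mu"
    then show "jump s (upoly k d) = 0"
      using dj[of s] jump_bern[of s "k + 1"] assms by simp
  qed
  have d0: "d (k + 1) \<noteq> 0"
  proof
    assume d0: "d (k + 1) = 0"
    then have "degree (upoly k d) \<le> k" by (rule degree_upoly_le)
    then have "jump k (upoly k d) = 0" by (rule jump_eq_0_if_degree)
    then show False using dj[of k] jump_bern[of k "k + 1"] by simp
  qed
  define rho where "rho = (\<lambda>j. d j / d (k + 1))"
  have eq: "c j = rho j * c (k + 1)"
    if c: "G_constraints k mu c" "N_constraints k mu c" and j: "j \<in> ratio_index k" for c j
  proof -
    define t where "t = c (k + 1) / d (k + 1)"
    have "c (k + 1) - t * d (k + 1) = 0" using d0 by (simp add: t_def)
    moreover have "j \<in> U k" "j \<noteq> 0" using j by (simp_all add: ratio_index_eq)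
    ultimately have "c j - t * d j = 0"
      using constraints_kernel[OF assms(1) constraints_diff(1)[OF assms(1) c d N, of t]
          constraints_diff(2)[OF assms(1) c d N, of t]] by blast
    then show ?thesis by (simp add: rho_def t_def)
  qed
  have "determine_ratios k mu rho"
    unfolding determine_ratios_def
  proof (intro conjI allI impI ballI)
    show "\<exists>c. G_constraints k mu c \<and> N_constraints k mu c \<and> c (k + 1) \<noteq> 0" using d N d0 by blast
    fix c j
    assume "G_constraints k mu c \<and> N_constraints k mu c \<and> c (k + 1) \<noteq> 0" "j \<in> ratio_index k"
    then show "c j / c (k + 1) = rho j" using eq[of c j] by simp
  qed
  from that[OF this eq] show thesis . 
qed

text \<open>The functional \<open>c \<mapsto> c j - \<rho>_j c (k + 1)\<close> vanishes on the common kernel of the constraints, hence it is a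
combination of them; \<open>K\<close> is the sum of the absolute values of the coefficients.\<close>

lemma ratio_error_bound:
  assumes "mu \<le> k - 1" "j \<in> ratio_index k"
    and rho: "\<And>c. G_constraints k mu c \<Longrightarrow> N_constraints k mu c \<Longrightarrow> c j = rho j * c (k + 1)"
  obtains K where "K \<ge> 0" "\<And>c \<delta>. (\<And>s. s \<le> mu \<Longrightarrow> \<bar>jump s (upoly k c)\<bar> \<le> \<delta>) \<Longrightarrow>
      (\<And>n. n \<in> bern_index k mu \<Longrightarrow> \<bar>h1_form (upoly k c) (bern n)\<bar> \<le> \<delta>) \<Longrightarrow>
      \<bar>c j - rho j * c (k + 1)\<bar> \<le> K * \<delta>"
proof -
  define I where "I = {..mu} <+> bern_index k mu"
  define v where "v = case_sum (\<lambda>s i. jump s (legendre i)) (\<lambda>n i. h1_form (legendre i) (bern n))"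
  define w where "w = (\<lambda>i. (if i = j then 1 else 0) - (if i = k + 1 then rho j else 0))"
  have [simp]: "finite I" by (simp add: I_def)
  have vl: "(\<Sum>i\<in>U k. v (Inl s) i * c i) = jump s (upoly k c)" for s c
    by (simp add: v_def jump_upoly mult.commute)
  have vr: "(\<Sum>i\<in>U k. v (Inr n) i * c i) = h1_form (upoly k c) (bern n)" for n c
    by (simp add: v_def h1_form_upoly mult.commute)
  have w: "(\<Sum>i\<in>U k. w i * c i) = c j - rho j * c (k + 1)" for c
  proof -
    have "(\<Sum>i\<in>U k. w i * c i) = (\<Sum>i\<in>U k. if i = j then c i else 0) - (\<Sum>i\<in>U k. if i = k + 1 then rho j * c i else 0)"
      unfolding w_def sum_subtractf[symmetric] by (intro sum.cong) (auto simp: algebra_simps)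
    moreover have "j \<in> U k" "k + 1 \<in> U k" using assms(2) by (auto simp: ratio_index_eq U_def)
    ultimately show ?thesis by simp
  qed
  have "\<exists>a. \<forall>i\<in>U k. w i = (\<Sum>m\<in>I. a m * v m i)"
  proof (rule functional_in_span)
    fix c assume c: "\<forall>m\<in>I. (\<Sum>i\<in>U k. v m i * c i) = 0"
    have "N_constraints k mu c"
      unfolding N_constraints_iff
    proof (intro allI impI)
      fix s assume "s \<le> mu"
      then show "jump s (upoly k c) = 0" using c[rule_format, of "Inl s"] by (auto simp: I_def vl)
    qed
    moreover have "G_constraints k mu c"
      unfolding G_constraints_iff[OF assms(1)]
    proof
      fix n assume "n \<in> bern_index k mu"
      then show "h1_form (upoly k c) (bern n) = 0" using c[rule_format, of "Inr n"] by (auto simp: I_def vr)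
    qed
    ultimately show "(\<Sum>i\<in>U k. w i * c i) = 0" using rho by (simp add: w)
  qed simp_all
  then obtain a where a: "\<And>i. i \<in> U k \<Longrightarrow> w i = (\<Sum>m\<in>I. a m * v m i)" by blast
  show thesis
  proof (rule that[of "\<Sum>m\<in>I. \<bar>a m\<bar>"])
    fix c \<delta>
    assume N: "\<And>s. s \<le> mu \<Longrightarrow> \<bar>jump s (upoly k c)\<bar> \<le> \<delta>"
      and G: "\<And>n. n \<in> bern_index k mu \<Longrightarrow> \<bar>h1_form (upoly k c) (bern n)\<bar> \<le> \<delta>"
    have "c j - rho j * c (k + 1) = (\<Sum>i\<in>U k. (\<Sum>m\<in>I. a m * v m i) * c i)"
      using w[of c] a by simp
    also have "\<dots> = (\<Sum>m\<in>I. a m * (\<Sum>i\<in>U k. v m i * c i))"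
      unfolding sum_distrib_left sum_distrib_right by (subst sum.swap) (simp add: mult_ac)
    also have "\<bar>\<dots>\<bar> \<le> (\<Sum>m\<in>I. \<bar>a m\<bar> * \<delta>)"
    proof (rule order.trans[OF sum_abs sum_mono])
      fix m assume "m \<in> I"
      then have "\<bar>\<Sum>i\<in>U k. v m i * c i\<bar> \<le> \<delta>"
        unfolding I_def by (rule PlusE) (auto simp: vl vr N G)
      then show "\<bar>a m * (\<Sum>i\<in>U k. v m i * c i)\<bar> \<le> \<bar>a m\<bar> * \<delta>"
        by (simp add: abs_mult mult_left_mono)
    qed
    finally show "\<bar>c j - rho j * c (k + 1)\<bar> \<le> (\<Sum>m\<in>I. \<bar>a m\<bar>) * \<delta>"
      by (simp add: sum_distrib_right)
  qed (simp add: sum_nonneg)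
qed

section \<open>Expansion of the error on one element\<close>

definition coeff_norm :: "real poly \<Rightarrow> real" where
  "coeff_norm p = (\<Sum>i\<le>degree p. \<bar>coeff p i\<bar>)"

lemma coeff_norm_nonneg: "coeff_norm p \<ge> 0"
  by (simp add: coeff_norm_def sum_nonneg)

lemma abs_poly_le_coeff_norm:
  assumes "\<bar>t\<bar> \<le> 1"
  shows "\<bar>poly p t\<bar> \<le> coeff_norm p"
proof -
  have "\<bar>poly p t\<bar> \<le> (\<Sum>i\<le>degree p. \<bar>coeff p i * t ^ i\<bar>)"
    unfolding poly_altdef by (rule sum_abs)
  also have "\<dots> \<le> (\<Sum>i\<le>degree p. \<bar>coeff p i\<bar>)"
    by (intro sum_mono) (use assms in \<open>auto simp: abs_mult power_abs power_le_one intro!: mult_left_le\<close>)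
  finally show ?thesis by (simp add: coeff_norm_def)
qed

definition legendre_norm :: "nat \<Rightarrow> real" where
  "legendre_norm k = (\<Sum>j\<le>k+1. \<Sum>s\<le>k+1. coeff_norm ((pderiv ^^ s) (legendre j)))"

lemma legendre_norm_nonneg: "legendre_norm k \<ge> 0"
  by (simp add: legendre_norm_def sum_nonneg coeff_norm_nonneg)

lemma legendre_le_norm:
  assumes "j \<le> k + 1" "s \<le> k + 1" "\<bar>t\<bar> \<le> 1"
  shows "\<bar>poly ((pderiv ^^ s) (legendre j)) t\<bar> \<le> legendre_norm k"
proof -
  have "coeff_norm ((pderiv ^^ s) (legendre j)) \<le> (\<Sum>s\<le>k+1. coeff_norm ((pderiv ^^ s) (legendre j)))"
    by (rule member_le_sum) (use assms coeff_norm_nonneg in auto)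
  also have "\<dots> \<le> legendre_norm k"
    unfolding legendre_norm_def
    by (rule member_le_sum[where f="\<lambda>j. \<Sum>s\<le>k+1. coeff_norm ((pderiv ^^ s) (legendre j))"])
       (use assms in \<open>auto simp del: sum.atMost_Suc intro!: sum_nonneg coeff_norm_nonneg\<close>)
  finally show ?thesis using abs_poly_le_coeff_norm[OF assms(3), of "(pderiv ^^ s) (legendre j)"] by linarith
qed

text \<open>The factor \<open>(2 k + 3) A + 1\<close>, where \<open>A\<close> is the bound of the Legendre polynomials, accounts for passing from a
function to its Legendre coefficients; the factor \<open>(k + 2) A\<close> for summing the series again, differentiated; the
last summand for the Taylor remainder.\<close>

definition expansion_const :: "nat \<Rightarrow> real" where
  "expansion_const k = real (k + 2) * (((2 * real k + 3) * legendre_norm k + 1) * legendre_norm k) + 1"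

lemma reference_point_in:
  assumes "h > 0" "\<bar>t\<bar> \<le> 1"
  shows "xm + h / 2 * t \<in> {xm - h / 2..xm + h / 2 :: real}"
proof -
  have "h / 2 * t \<le> h / 2 * 1" "h / 2 * (-1) \<le> h / 2 * t"
    using assms by (intro mult_left_mono; simp)+
  then show ?thesis by auto
qed

text \<open>Replacing \<open>u\<close> by its Taylor polynomial of degree \<open>k + 1\<close> at the midpoint turns the error into a polynomial of
degree at most \<open>k + 1\<close>, at the price of \<open>O(h^(k+2))\<close> in each derivative with respect to \<open>t\<close>. The coefficients of
this polynomial differ little from the prescribed ones, and since its degree is bounded, its derivatives
inherit the estimate.\<close>

lemma element_expansion:
  fixes D :: "nat \<Rightarrow> real \<Rightarrow> real"
  assumes S: "convex S"
    and D: "\<And>n y. n < k + 2 \<Longrightarrow> y \<in> S \<Longrightarrow> (D n has_real_derivative D (Suc n) y) (at y within S)"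
    and B: "\<And>y. y \<in> S \<Longrightarrow> \<bar>D (k + 2) y\<bar> \<le> B"
    and h: "h > 0" "{xm - h / 2..xm + h / 2} \<subseteq> S"
    and p: "degree p \<le> k"
    and e: "\<And>t. \<bar>t\<bar> \<le> 1 \<Longrightarrow> e (xm + h / 2 * t) = D 0 (xm + h / 2 * t) - poly p (xm + h / 2 * t)"
    and cU: "\<And>j. j \<in> U k \<Longrightarrow> \<bar>legendre_coeff e xm h j - c j\<bar> \<le> \<delta>"
    and c0: "\<And>j. j \<in> {0..k+1} - U k \<Longrightarrow> \<bar>legendre_coeff e xm h j\<bar> \<le> \<delta>"
    and s: "s \<le> k + 1" and t: "\<bar>t\<bar> \<le> 1"
  shows "\<bar>(h / 2) ^ s * (D s (xm + h / 2 * t) - poly ((pderiv ^^ s) p) (xm + h / 2 * t))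
           - poly ((pderiv ^^ s) (upoly k c)) t\<bar> \<le> expansion_const k * (\<delta> + B * h ^ (k + 2))"
proof -
  \<comment> \<open>The derivative of order \<open>s\<close>, with respect to \<open>t\<close>, of the Taylor polynomial of \<open>u\<close>.\<close>
  define T where "T = (\<lambda>s. \<Sum>i\<le>k+1-s. monom (D (s + i) xm * (h / 2) ^ (s + i) / fact i) i)"
  have inS: "xm + h / 2 * t \<in> S" if "\<bar>t\<bar> \<le> 1" for t
    using reference_point_in[OF h(1) that] h(2) by (rule rev_subsetD)
  have xmS: "xm \<in> S" using inS[of 0] by simp
  have B0: "B \<ge> 0" using B[OF xmS] by linarith
  define \<eta> where "\<eta> = B * h ^ (k + 2)"
  have \<eta>: "\<eta> \<ge> 0" using B0 h by (simp add: \<eta>_def)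
  have "k + 1 \<in> U k" by (simp add: U_def)
  then have \<delta>: "\<delta> \<ge> 0" using cU[of "k + 1"] by linarith
  have T_Suc: "pderiv (T s) = T (Suc s)" if "s \<le> k" for s
  proof -
    have "k + 1 - s = Suc (k + 1 - Suc s)" using that by simp
    then have "T s = monom (D s xm * (h / 2) ^ s) 0
        + (\<Sum>i\<le>k+1-Suc s. monom (D (Suc s + i) xm * (h / 2) ^ (Suc s + i) / fact (Suc i)) (Suc i))"
      unfolding T_def by (simp only: sum.atMost_Suc_shift) simp
    also have "pderiv \<dots> = T (Suc s)"
      unfolding T_def pderiv_add higher_pderiv_sum[where n=1, simplified] pderiv_monom
      by (simp add: field_simps del: of_nat_Suc)
    finally show ?thesis .
  qed
  have T_der: "(pderiv ^^ s) (T 0) = T s" if "s \<le> k + 1" for s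
    using that by (induction s) (simp_all add: T_Suc)
  have taylor: "\<bar>(h / 2) ^ s * D s (xm + h / 2 * t) - poly (T s) t\<bar> \<le> \<eta>"
    if s: "s \<le> k + 1" and t: "\<bar>t\<bar> \<le> 1" for s t
  proof -
    define y where "y = xm + h / 2 * t"
    have "norm (D (s + 0) y - (\<Sum>i\<le>k+1-s. D (s + i) xm * (y - xm) ^ i / fact i))
        \<le> B * norm (y - xm) ^ Suc (k + 1 - s) / fact (k + 1 - s)"
      by (intro field_Taylor[OF S, of "k + 1 - s" "\<lambda>i. D (s + i)"])
         (use s inS[OF t] xmS B in \<open>auto simp: y_def intro!: D\<close>)
    also have "\<dots> \<le> B * norm (y - xm) ^ Suc (k + 1 - s)"
      using divide_left_mono[of 1 "fact (k + 1 - s)" "B * norm (y - xm) ^ Suc (k + 1 - s)"] B0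
      by (simp del: power_Suc add: fact_ge_1)
    also have "\<dots> \<le> B * (h / 2) ^ Suc (k + 1 - s)"
      using t h B0 by (intro mult_left_mono power_mono) (auto simp: y_def abs_mult)
    finally have "\<bar>D s y - (\<Sum>i\<le>k+1-s. D (s + i) xm * (y - xm) ^ i / fact i)\<bar> \<le> B * (h / 2) ^ Suc (k + 1 - s)"
      by simp
    then have "(h / 2) ^ s * \<bar>D s y - (\<Sum>i\<le>k+1-s. D (s + i) xm * (y - xm) ^ i / fact i)\<bar>
        \<le> (h / 2) ^ s * (B * (h / 2) ^ Suc (k + 1 - s))"
      using h by (intro mult_left_mono) auto
    also have "\<dots> = B * (h / 2) ^ (k + 2)"
      using s by (simp add: mult.left_commute flip: power_add power_Suc)
    also have "\<dots> \<le> \<eta>"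
      unfolding \<eta>_def using B0 h by (intro mult_left_mono power_mono) auto
    finally have "(h / 2) ^ s * \<bar>D s y - (\<Sum>i\<le>k+1-s. D (s + i) xm * (y - xm) ^ i / fact i)\<bar> \<le> \<eta>" .
    moreover have "(h / 2) ^ s * (\<Sum>i\<le>k+1-s. D (s + i) xm * (y - xm) ^ i / fact i) = poly (T s) t"
    proof -
      have "y - xm = h / 2 * t" by (simp add: y_def)
      then have "(y - xm) ^ i = (h / 2) ^ i * t ^ i" for i by (simp only: power_mult_distrib)
      then show ?thesis
        unfolding T_def poly_sum poly_monom sum_distrib_left
        by (intro sum.cong) (simp_all add: power_add)
    qed
    moreover have "(h / 2) ^ s * \<bar>D s y - (\<Sum>i\<le>k+1-s. D (s + i) xm * (y - xm) ^ i / fact i)\<bar>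
      = \<bar>(h / 2) ^ s * D s y - (h / 2) ^ s * (\<Sum>i\<le>k+1-s. D (s + i) xm * (y - xm) ^ i / fact i)\<bar>"
      using h by (simp add: right_diff_distrib[symmetric] abs_mult del: times_divide_eq_left)
    ultimately show ?thesis by (simp add: y_def)
  qed
  \<comment> \<open>The error with \<open>u\<close> replaced by its Taylor polynomial, as a polynomial in \<open>t\<close>.\<close>
  define P where "P = T 0 - pcompose p [:xm, h / 2:]"
  have degP: "degree P \<le> k + 1"
    unfolding P_def
  proof (rule degree_diff_le)
    show "degree (T 0) \<le> k + 1"
      unfolding T_def by (intro degree_sum_le) (auto intro: order.trans[OF degree_monom_le])
    show "degree (pcompose p [:xm, h / 2:]) \<le> k + 1"
      using degree_pcompose_le[of p "[:xm, h / 2:]"] p by (simp split: if_splits)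
  qed
  have poly_P: "poly ((pderiv ^^ s) P) t = poly (T s) t - (h / 2) ^ s * poly ((pderiv ^^ s) p) (xm + h / 2 * t)"
    if "s \<le> k + 1" for s t
  proof -
    have "(pderiv ^^ s) P = (pderiv ^^ s) (T 0) - (pderiv ^^ s) (pcompose p [:xm, h / 2:])"
      using higher_pderiv_add[of s P "pcompose p [:xm, h / 2:]"] by (simp add: P_def)
    then show ?thesis using that by (simp add: T_der higher_pderiv_affine poly_pcompose mult.commute)
  qed
  define A where "A = legendre_norm k"
  have A: "A \<ge> 0" by (simp add: A_def legendre_norm_nonneg)
  define g where "g = (\<lambda>j. (2 * real j + 1) / 2 * pint (P * legendre j))"
  define b where "b = ((2 * real k + 3) * A + 1) * (\<delta> + \<eta>)"
  have b: "\<bar>g j - (if j \<in> U k then c j else 0)\<bar> \<le> b" if j: "j \<le> k + 1" for j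
  proof -
    \<comment> \<open>The part of the integrand of the Legendre coefficient that comes from the Taylor remainder.\<close>
    define R where "R = (\<lambda>t. (D 0 (xm + h / 2 * t) - poly (T 0) t) * poly (legendre j) t)"
    have contD: "continuous_on S (D 0)"
      using D[of 0] by (intro DERIV_continuous_on[of S "D 0" "D (Suc 0)"]) simp
    have contR: "continuous_on {-1..1} R"
      unfolding R_def
      by (intro continuous_intros continuous_on_compose2[OF contD]) (use inS in \<open>auto simp: abs_le_iff\<close>)
    have "\<bar>integral {-1..1} R\<bar> \<le> \<eta> * A * (1 - (-1))"
    proof -
      have "norm (R t) \<le> \<eta> * A" if "t \<in> {-1..1}" for t
        using taylor[of 0 t] legendre_le_norm[of j k 0 t] that j \<eta>
        by (auto simp: R_def abs_mult A_def intro!: mult_mono)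
      then show ?thesis using integral_bound[of "-1" 1 R "\<eta> * A"] contR by simp
    qed
    then have R: "\<bar>(2 * real j + 1) / 2 * integral {-1..1} R\<bar> \<le> (2 * real j + 1) / 2 * (\<eta> * A * 2)"
      unfolding abs_mult by (simp add: mult_left_mono)
    have "integral {-1..1} (\<lambda>t. e (xm + h / 2 * t) * poly (legendre j) t)
        = integral {-1..1} (\<lambda>t. poly (P * legendre j) t + R t)"
    proof (rule integral_cong)
      fix t :: real assume "t \<in> {-1..1}"
      then have "\<bar>t\<bar> \<le> 1" by auto
      then show "e (xm + h / 2 * t) * poly (legendre j) t = poly (P * legendre j) t + R t"
        using e[of t] by (simp add: P_def R_def poly_pcompose mult.commute[of t] left_diff_distrib)
    qed
    also have "\<dots> = pint (P * legendre j) + integral {-1..1} R"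
      unfolding pint_def
      by (intro integral_add poly_integrable_on integrable_continuous_interval contR)
    finally have lc: "legendre_coeff e xm h j = g j + (2 * real j + 1) / 2 * integral {-1..1} R"
      by (simp only: legendre_coeff_def g_def distrib_left)
    have "\<bar>legendre_coeff e xm h j - (if j \<in> U k then c j else 0)\<bar> \<le> \<delta>"
      using cU[of j] c0[of j] j by auto
    then have "\<bar>g j - (if j \<in> U k then c j else 0)\<bar> \<le> \<delta> + (2 * real j + 1) / 2 * (\<eta> * A * 2)"
      using lc R by linarith
    also have "(2 * real j + 1) / 2 * (\<eta> * A * 2) = (2 * real j + 1) * A * \<eta>" by simp
    also have "\<dots> \<le> (2 * real k + 3) * A * \<eta>"
      using j A \<eta> by (intro mult_right_mono) auto
    also have "\<delta> + (2 * real k + 3) * A * \<eta> \<le> b"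
      using A \<eta> \<delta> by (simp add: b_def algebra_simps)
    finally show ?thesis by simp
  qed
  have "P = (\<Sum>j\<le>k+1. smult (g j) (legendre j))"
    unfolding g_def using degP by (rule legendre_expansion)
  moreover have "upoly k c = (\<Sum>j\<le>k+1. smult (if j \<in> U k then c j else 0) (legendre j))"
    unfolding upoly_def by (intro sum.mono_neutral_cong_left) (auto simp: U_def)
  ultimately have "poly ((pderiv ^^ s) P) t - poly ((pderiv ^^ s) (upoly k c)) t
      = (\<Sum>j\<le>k+1. (g j - (if j \<in> U k then c j else 0)) * poly ((pderiv ^^ s) (legendre j)) t)"
    by (simp only: higher_pderiv_sum higher_pderiv_smult poly_sum poly_smult left_diff_distrib sum_subtractf)
  also have "\<bar>\<dots>\<bar> \<le> (\<Sum>j\<le>k+1. b * A)"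
  proof (rule order.trans[OF sum_abs sum_mono])
    fix j assume "j \<in> {..k+1}"
    then have j: "j \<le> k + 1" by simp
    have "0 \<le> b" using b[OF j] by linarith
    then show "\<bar>(g j - (if j \<in> U k then c j else 0)) * poly ((pderiv ^^ s) (legendre j)) t\<bar> \<le> b * A"
      unfolding abs_mult A_def by (intro mult_mono b j legendre_le_norm s t) simp_all
  qed
  finally have "\<bar>poly ((pderiv ^^ s) P) t - poly ((pderiv ^^ s) (upoly k c)) t\<bar> \<le> real (k + 2) * (b * A)"
    by simp
  moreover have "\<bar>(h / 2) ^ s * D s (xm + h / 2 * t) - poly (T s) t\<bar> \<le> \<delta> + \<eta>"
    using taylor[OF s t] \<delta> by linarith
  moreover have "expansion_const k * (\<delta> + \<eta>) = real (k + 2) * (b * A) + (\<delta> + \<eta>)"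
    by (simp add: expansion_const_def b_def A_def algebra_simps)
  moreover have "(h / 2) ^ s * (D s (xm + h / 2 * t) - poly ((pderiv ^^ s) p) (xm + h / 2 * t))
      = ((h / 2) ^ s * D s (xm + h / 2 * t) - poly (T s) t) + poly ((pderiv ^^ s) P) t"
    unfolding poly_P[OF s] by (simp only: right_diff_distrib)
  ultimately show ?thesis unfolding \<eta>_def[symmetric] by linarith
qed

section \<open>Locally supported splines\<close>

text \<open>Truncated powers divided by the factorial, so that differentiation lowers the exponent without producing a
factor.\<close>

definition tpow :: "nat \<Rightarrow> real \<Rightarrow> real" where
  "tpow m x = (if 0 \<le> x then x ^ m / fact m else 0)"

lemma tpow_nonpos: "m \<ge> 1 \<Longrightarrow> x \<le> 0 \<Longrightarrow> tpow m x = 0"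
  by (auto simp: tpow_def power_0_left)

lemma tpow_nonneg: "x \<ge> 0 \<Longrightarrow> tpow m x = x ^ m / fact m"
  by (simp add: tpow_def)

lemma continuous_on_tpow: "m \<ge> 1 \<Longrightarrow> continuous_on A (tpow m)"
proof -
  assume "m \<ge> 1"
  then have "tpow m = (\<lambda>x. max 0 x ^ m / fact m)"
    by (auto simp: tpow_def max_def power_0_left fun_eq_iff)
  then show ?thesis by (auto intro!: continuous_intros)
qed

lemma DERIV_tpow_off_0:
  assumes "x \<noteq> 0"
  shows "(tpow (Suc m) has_real_derivative tpow m x) (at x)"
proof (cases "x > 0")
  case True
  have "((\<lambda>x. x ^ Suc m / fact (Suc m)) has_real_derivative x ^ m / fact m) (at x)"
    using DERIV_cdivide[OF DERIV_pow[of "Suc m" x UNIV], of "fact (Suc m)"]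
    by (simp add: fact_Suc del: power_Suc of_nat_Suc)
  then have "(tpow (Suc m) has_real_derivative x ^ m / fact m) (at x)"
    by (rule DERIV_cong_ev[THEN iffD1, rotated -1, OF _ refl _ refl])
       (use True in \<open>auto simp: tpow_def intro!: eventually_mono[OF eventually_gt_at_top]
          eventually_nhds_in_open[of "{0<..}", THEN eventually_mono]\<close>)
  then show ?thesis using True by (simp add: tpow_def)
next
  case False
  then have "x < 0" using assms by simp
  have "((\<lambda>x. 0) has_real_derivative 0) (at x)" by simp
  then have "(tpow (Suc m) has_real_derivative 0) (at x)"
    by (rule has_field_derivative_transform_within_open[of _ _ _ "{..<0}"])
       (use \<open>x < 0\<close> in \<open>auto simp: tpow_def\<close>)
  then show ?thesis using \<open>x < 0\<close> by (simp add: tpow_def)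
qed

text \<open>At \<open>0\<close> the difference quotient is \<open>tpow m z / (m + 1)\<close>, which is continuous there for positive \<open>m\<close>.\<close>

lemma DERIV_tpow:
  assumes "m \<ge> 1 \<or> x \<noteq> 0"
  shows "(tpow (Suc m) has_real_derivative tpow m x) (at x)"
proof (cases "x = 0")
  case True
  then have m: "m \<ge> 1" using assms by simp
  have "isCont (tpow m) 0"
    using continuous_on_tpow[OF m, of UNIV] by (simp add: continuous_on_eq_continuous_at)
  then have "isCont (\<lambda>z. tpow m z / real (Suc m)) 0" by (auto intro!: continuous_intros)
  moreover have "\<forall>z. tpow (Suc m) z - tpow (Suc m) 0 = tpow m z / real (Suc m) * (z - 0)"
    by (simp add: tpow_def mult.commute)
  moreover have "tpow m 0 / real (Suc m) = tpow m 0" using m by (simp add: tpow_nonpos)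
  ultimately show ?thesis unfolding True CARAT_DERIV
    by (intro exI[of _ "\<lambda>z. tpow m z / real (Suc m)"] conjI)
qed (rule DERIV_tpow_off_0)

text \<open>A polynomial of degree at most \<open>n\<close> is determined by its values at the \<open>n + 1\<close> points \<open>0, -2, ..., -2n\<close>, so its
derivative at \<open>0\<close> is a combination of these values. The spacing is the length of the reference element.\<close>

lemma ex_differentiation_weights:
  "\<exists>a. \<forall>p. degree p \<le> n \<longrightarrow> poly (pderiv p) 0 + (\<Sum>l\<le>n. a l * poly p (- (2 * real l))) = 0"
proof -
  have "\<exists>a. \<forall>j\<in>{..n}. (if j = 1 then -1 else 0) = (\<Sum>l\<in>{..n}. a l * (- (2 * real l)) ^ j)"
  proof (rule functional_in_span)
    fix c :: "nat \<Rightarrow> real"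
    assume c: "\<forall>l\<in>{..n}. (\<Sum>j\<le>n. (- (2 * real l)) ^ j * c j) = 0"
    define r where "r = (\<Sum>j\<le>n. monom (c j) j)"
    have deg: "degree r \<le> n"
      unfolding r_def by (intro degree_sum_le) (auto intro: order.trans[OF degree_monom_le])
    have "r = 0"
    proof (rule ccontr)
      assume "r \<noteq> 0"
      have "(\<lambda>l. - (2 * real l)) ` {..n} \<subseteq> {x. poly r x = 0}"
        using c by (auto simp: r_def poly_sum poly_monom mult.commute)
      then have "card ((\<lambda>l. - (2 * real l)) ` {..n}) \<le> card {x. poly r x = 0}"
        by (intro card_mono poly_roots_finite \<open>r \<noteq> 0\<close>)
      moreover have "card ((\<lambda>l. - (2 * real l)) ` {..n}) = n + 1"
        by (subst card_image) (auto simp: inj_on_def)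
      moreover have "card {x. poly r x = 0} \<le> degree r" using \<open>r \<noteq> 0\<close> by (rule card_poly_roots_bound)
      ultimately show False using deg by simp
    qed
    have "c j = 0" if "j \<le> n" for j
    proof -
      have "coeff r j = c j" using that by (simp add: r_def coeff_sum if_distrib cong: if_cong)
      then show ?thesis using \<open>r = 0\<close> by simp
    qed
    then show "(\<Sum>j\<le>n. (if j = 1 then -1 else 0) * c j) = 0" by (intro sum.neutral) simp
  qed simp_all
  then obtain a where a: "\<And>j. j \<le> n \<Longrightarrow> (\<Sum>l\<le>n. a l * (- (2 * real l)) ^ j) = (if j = 1 then -1 else 0)"
    by (metis atMost_iff)
  have "poly (pderiv p) 0 + (\<Sum>l\<le>n. a l * poly p (- (2 * real l))) = 0" if p: "degree p \<le> n" for p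
  proof -
    have "(\<Sum>l\<le>n. a l * poly p (- (2 * real l))) = (\<Sum>l\<le>n. \<Sum>j\<le>n. coeff p j * (a l * (- (2 * real l)) ^ j))"
    proof (rule sum.cong)
      fix l
      have "poly p (- (2 * real l)) = (\<Sum>j\<le>n. coeff p j * (- (2 * real l)) ^ j)"
        unfolding poly_altdef using p by (intro sum.mono_neutral_left) (auto simp: coeff_eq_0)
      then show "a l * poly p (- (2 * real l)) = (\<Sum>j\<le>n. coeff p j * (a l * (- (2 * real l)) ^ j))"
        by (simp only: sum_distrib_left mult.left_commute)
    qed simp
    also have "\<dots> = (\<Sum>j\<le>n. coeff p j * (\<Sum>l\<le>n. a l * (- (2 * real l)) ^ j))"
      unfolding sum_distrib_left by (rule sum.swap)
    also have "\<dots> = (\<Sum>j\<le>n. if j = 1 then - coeff p j else 0)"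
      using a by (intro sum.cong) auto
    also have "\<dots> = - coeff p 1" using p by (auto simp: coeff_eq_0)
    finally show ?thesis by (simp add: poly_0_coeff_0 coeff_pderiv)
  qed
  then show ?thesis by blast
qed

definition diff_weights :: "nat \<Rightarrow> nat \<Rightarrow> real" where
  "diff_weights n = (SOME a. \<forall>p. degree p \<le> n \<longrightarrow> poly (pderiv p) 0 + (\<Sum>l\<le>n. a l * poly p (- (2 * real l))) = 0)"

lemma diff_weights: "degree p \<le> n \<Longrightarrow> poly (pderiv p) 0 + (\<Sum>l\<le>n. diff_weights n l * poly p (- (2 * real l))) = 0"
  using someI_ex[OF ex_differentiation_weights[of n]] unfolding diff_weights_def by blast

text \<open>For \<open>d = 0\<close> this is a spline with knots \<open>0, 2, ..., 2n\<close>; a positive \<open>d\<close> gives its derivative of order \<open>d\<close>. The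
term of degree \<open>n - 1\<close> creates a jump of the derivative of order \<open>n - 1\<close> at \<open>0\<close>. The terms of degree \<open>n\<close>
cancel it to the right of \<open>2n\<close>: there the sum is \<open>p'(x)\<close> plus its approximation by differences, with
the opposite sign, for \<open>p = x^n / n!\<close>. A spline of a single degree with compact support, such as a B-spline,
would not do, because its shifts add up to a constant.\<close>

definition tspline :: "nat \<Rightarrow> nat \<Rightarrow> real \<Rightarrow> real" where
  "tspline n d x = tpow (n - Suc d) x + (\<Sum>l\<le>n. diff_weights n l * tpow (n - d) (x - 2 * real l))"

text \<open>The polynomial that agrees with the spline between the knots \<open>2i\<close> and \<open>2i + 2\<close>.\<close>

definition tpiece :: "nat \<Rightarrow> nat \<Rightarrow> real poly" where
  "tpiece n i = monom (1 / fact (n - 1)) (n - 1)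
     + (\<Sum>l\<le>i. smult (diff_weights n l / fact n) ([:- (2 * real l), 1:] ^ n))"

lemma poly_tpiece:
  "poly (tpiece n i) x = x ^ (n - 1) / fact (n - 1) + (\<Sum>l\<le>i. diff_weights n l * ((x - 2 * real l) ^ n / fact n))"
  by (simp add: tpiece_def poly_monom poly_sum poly_power)

text \<open>Here the differentiation formula is applied to \<open>y \<mapsto> (x + y)^n / n!\<close>.\<close>

lemma tpiece_last: assumes "n \<ge> 1" shows "tpiece n n = 0"
proof -
  have "poly (tpiece n n) x = 0" for x
  proof -
    let ?p = "smult (1 / fact n) ([:x, 1:] ^ n)"
    have "degree ?p \<le> n" by (simp add: degree_power_eq)
    from diff_weights[OF this]
    have "poly (pderiv ?p) 0 + (\<Sum>l\<le>n. diff_weights n l * poly ?p (- (2 * real l))) = 0" .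
    moreover obtain m where "n = Suc m" using assms by (cases n) auto
    then have "poly (pderiv ?p) 0 = x ^ (n - 1) / fact (n - 1)"
      by (simp add: pderiv_smult pderiv_power_Suc pderiv_pCons poly_power field_simps del: power_Suc of_nat_Suc)
    ultimately show ?thesis by (simp add: poly_tpiece poly_power)
  qed
  then show ?thesis using poly_all_0_iff_0 by blast
qed

lemma degree_tpiece: "degree (tpiece n i) \<le> n"
  unfolding tpiece_def
  by (intro degree_add_le degree_sum_le)
     (auto intro!: order.trans[OF degree_monom_le] order.trans[OF degree_smult_le] simp: degree_power_eq)

lemma tspline_eq_tpiece:
  assumes "n \<ge> 2" "i < n" "2 * real i \<le> x" "x \<le> 2 * real i + 2"
  shows "tspline n 0 x = poly (tpiece n i) x"
proof -
  have "(\<Sum>l\<le>n. diff_weights n l * tpow n (x - 2 * real l)) = (\<Sum>l\<le>i. diff_weights n l * tpow n (x - 2 * real l))"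
  proof (rule sum.mono_neutral_right)
    show "\<forall>l\<in>{..n} - {..i}. diff_weights n l * tpow n (x - 2 * real l) = 0"
    proof
      fix l assume "l \<in> {..n} - {..i}"
      then have "real l \<ge> real i + 1" by auto
      then have "x - 2 * real l \<le> 0" using assms(4) by linarith
      then show "diff_weights n l * tpow n (x - 2 * real l) = 0" using assms(1) by (simp add: tpow_nonpos)
    qed
  qed (use assms in auto)
  also have "\<dots> = (\<Sum>l\<le>i. diff_weights n l * ((x - 2 * real l) ^ n / fact n))"
  proof (rule sum.cong)
    fix l assume "l \<in> {..i}"
    then have "x - 2 * real l \<ge> 0" using assms(3) by simp
    then show "diff_weights n l * tpow n (x - 2 * real l) = diff_weights n l * ((x - 2 * real l) ^ n / fact n)"
      by (simp add: tpow_nonneg)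
  qed simp
  moreover have "x \<ge> 0" using assms(3) of_nat_0_le_iff[of i] by linarith
  ultimately show ?thesis by (simp add: tspline_def poly_tpiece tpow_nonneg)
qed

lemma tspline_eq_0_left:
  assumes "n \<ge> d + 2" "x \<le> 0"
  shows "tspline n d x = 0"
proof -
  have "tpow (n - d) (x - 2 * real l) = 0" for l
    using assms by (intro tpow_nonpos) auto
  then show ?thesis using assms by (simp add: tspline_def tpow_nonpos)
qed

lemma tspline_eq_0_right:
  assumes "n \<ge> 2" "x \<ge> 2 * real n"
  shows "tspline n 0 x = 0"
proof -
  have "tpow n (x - 2 * real l) = (x - 2 * real l) ^ n / fact n" if "l \<le> n" for l
  proof (rule tpow_nonneg)
    have "real l \<le> real n" using that by simp
    then show "0 \<le> x - 2 * real l" using assms(2) by linarith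
  qed
  moreover have "x \<ge> 0" using assms(2) of_nat_0_le_iff[of n] by linarith
  ultimately have "tspline n 0 x = poly (tpiece n n) x" by (simp add: tspline_def poly_tpiece tpow_nonneg)
  then show ?thesis using assms(1) by (simp add: tpiece_last)
qed

lemma continuous_on_tspline:
  assumes "n \<ge> d + 2"
  shows "continuous_on A (tspline n d)"
  unfolding tspline_def
  by (intro continuous_intros continuous_on_compose2[OF continuous_on_tpow[of _ UNIV]] continuous_on_tpow)
     (use assms in auto)

lemma DERIV_tspline:
  assumes "n \<ge> d + 2" "n \<ge> d + 3 \<or> x \<noteq> 0"
  shows "(tspline n d has_real_derivative tspline n (Suc d) x) (at x)"
proof -
  have "(tpow (Suc (n - Suc (Suc d))) has_real_derivative tpow (n - Suc (Suc d)) x) (at x)"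
    by (rule DERIV_tpow) (use assms in auto)
  then have 1: "(tpow (n - Suc d) has_real_derivative tpow (n - Suc (Suc d)) x) (at x)"
    using assms by (simp add: Suc_diff_Suc)
  have 2: "((\<lambda>x. tpow (n - d) (x - 2 * real l)) has_real_derivative tpow (n - Suc d) (x - 2 * real l)) (at x)" for l
  proof -
    have "(tpow (Suc (n - Suc d)) has_real_derivative tpow (n - Suc d) (x - 2 * real l)) (at (x - 2 * real l))"
      by (rule DERIV_tpow) (use assms in auto)
    then have "(tpow (n - d) has_real_derivative tpow (n - Suc d) (x - 2 * real l)) (at (x - 2 * real l))"
      using assms by (simp add: Suc_diff_Suc)
    moreover have "((\<lambda>x. x - 2 * real l) has_real_derivative 1) (at x)"
      by (auto intro!: derivative_eq_intros)
    ultimately show ?thesis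
      using DERIV_chain2[of "tpow (n - d)" _ "\<lambda>x. x - 2 * real l"] by force
  qed
  show ?thesis
    unfolding tspline_def by (intro DERIV_add 1 DERIV_sum DERIV_cmult 2)
qed

lemma borel_measurable_tspline: "tspline n d \<in> borel_measurable borel"
  unfolding tspline_def tpow_def by measurable

section \<open>Folding the test spline\<close>

text \<open>The sum of the pieces of the test spline, each shifted to \<open>[-1, 1]\<close>.\<close>

definition tfold :: "nat \<Rightarrow> real poly" where
  "tfold n = (\<Sum>i<n. pcompose (tpiece n i) [:2 * real i + 1, 1:])"

lemma degree_tfold: "degree (tfold n) \<le> n"
  unfolding tfold_def
proof (intro degree_sum_le)
  fix i show "degree (pcompose (tpiece n i) [:2 * real i + 1, 1:]) \<le> n"
    using degree_pcompose_le[of "tpiece n i" "[:2 * real i + 1, 1:]"] degree_tpiece[of n i] by simp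
qed simp

lemma tpiece_Suc_match:
  assumes "s < n"
  shows "poly ((pderiv ^^ s) (tpiece n (Suc i))) (2 * real (Suc i)) = poly ((pderiv ^^ s) (tpiece n i)) (2 * real (Suc i))"
proof -
  let ?x = "2 * real (Suc i)"
  have "[:- ?x, 1:] ^ (n - s) dvd (pderiv ^^ s) ([:- ?x, 1:] ^ n)"
    by (rule linear_power_dvd_higher_pderiv) (use assms in auto)
  moreover have "[:- ?x, 1:] dvd [:- ?x, 1:] ^ (n - s)" using assms by (intro dvd_power) auto
  ultimately have "[:- ?x, 1:] dvd (pderiv ^^ s) ([:- ?x, 1:] ^ n)" by (rule dvd_trans[rotated])
  then have "poly ((pderiv ^^ s) ([:- ?x, 1:] ^ n)) ?x = 0" by (simp only: poly_eq_0_iff_dvd)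
  moreover have "tpiece n (Suc i) = tpiece n i + smult (diff_weights n (Suc i) / fact n) ([:- ?x, 1:] ^ n)"
    by (simp add: tpiece_def)
  ultimately show ?thesis
    by (simp only: higher_pderiv_add higher_pderiv_smult poly_add poly_smult mult_zero_right add_0_right)
qed

text \<open>The jumps of the shifted pieces telescope, since consecutive pieces agree at their common knot up to the
derivative of order \<open>n - 1\<close>; what remains comes from the first knot, to the left of which the spline is zero.\<close>

lemma jump_tfold:
  assumes "n \<ge> 1" "s < n"
  shows "jump s (tfold n) = (if s = n - 1 then -1 else 0)"
proof -
  define f where "f = (\<lambda>i. poly ((pderiv ^^ s) (tpiece n i)) (2 * real i))"
  have "jump s (tfold n) = (\<Sum>i<n. f (Suc i) - f i)"
    unfolding tfold_def jump_sum
  proof (rule sum.cong)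
    fix i
    show "jump s (pcompose (tpiece n i) [:2 * real i + 1, 1:]) = f (Suc i) - f i"
      unfolding f_def tpiece_Suc_match[OF assms(2)]
      by (simp add: jump_def higher_pderiv_affine poly_pcompose algebra_simps)
  qed simp
  also have "\<dots> = f n - f 0" by (rule sum_lessThan_telescope)
  also have "f n = 0" using assms(1) by (simp add: f_def tpiece_last)
  also have "f 0 = (if s = n - 1 then 1 else 0)"
  proof -
    have "[:0, 1:] ^ n = monom (1::real) n" by (simp add: monom_altdef)
    then have "coeff (tpiece n 0) s = (if s = n - 1 then 1 / fact (n - 1) else 0)"
      using assms(2) by (auto simp: tpiece_def)
    moreover have "f 0 = fact s * coeff (tpiece n 0) s"
      by (simp add: f_def poly_0_coeff_0 coeff_higher_pderiv pochhammer_fact)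
    ultimately show ?thesis by simp
  qed
  finally show ?thesis by simp
qed

text \<open>By \<open>jump_tfold\<close> the Bernoulli expansion of \<open>tfold n\<close> consists of a constant and the multiple \<open>-1/2\<close> of \<open>b_n\<close>.\<close>

lemma h1_form_tfold:
  assumes "n \<ge> 1"
  shows "h1_form p (tfold n) = - (1 / 2) * h1_form p (bern n)"
proof -
  have "(\<Sum>j=1..n. smult (jump (j - 1) (tfold n) / 2) (bern j)) = (\<Sum>j=1..n. if j = n then smult (- (1 / 2)) (bern n) else 0)"
    using assms by (intro sum.cong) (auto simp: jump_tfold)
  then have "tfold n = [:pint (tfold n) / 2:] + smult (- (1 / 2)) (bern n)"
    using bern_expansion[OF degree_tfold[of n]] assms by simp
  then have "pderiv (tfold n) = pderiv (smult (- (1 / 2)) (bern n))"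
    by (metis add_0_left pderiv_add pderiv_singleton)
  then have "h1_form p (tfold n) = h1_form p (smult (- (1 / 2)) (bern n))" by (simp add: h1_form_def)
  then show ?thesis by (simp only: h1_form_smult_right)
qed

section \<open>Splines on a mesh\<close>

text \<open>\<open>C_on\<close> with the derivatives named, so that they can be shared between statements.\<close>

definition deriv_chain :: "nat \<Rightarrow> real set \<Rightarrow> (nat \<Rightarrow> real \<Rightarrow> real) \<Rightarrow> bool" where
  "deriv_chain m S D \<longleftrightarrow>
     (\<forall>n<m. \<forall>y\<in>S. (D n has_real_derivative D (Suc n) y) (at y within S)) \<and> continuous_on S (D m)"

lemma C_on_chain: "C_on m S v \<longleftrightarrow> (\<exists>D. (\<forall>y\<in>S. D 0 y = v y) \<and> deriv_chain m S D)"
  by (auto simp: C_on_def deriv_chain_def)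

lemma deriv_chain_continuous:
  assumes "deriv_chain m S D" "n \<le> m"
  shows "continuous_on S (D n)"
proof (cases "n = m")
  case False
  then show ?thesis
    using assms by (intro DERIV_continuous_on[of S "D n" "D (Suc n)"]) (auto simp: deriv_chain_def)
qed (use assms in \<open>simp add: deriv_chain_def\<close>)

lemma deriv_chain_interior:
  assumes "deriv_chain m S D" "n < m" "y \<in> interior S"
  shows "(D n has_real_derivative D (Suc n) y) (at y)"
proof -
  have "y \<in> S" using assms(3) interior_subset by blast
  then have "(D n has_real_derivative D (Suc n) y) (at y within S)"
    using assms(1,2) by (simp add: deriv_chain_def)
  then show ?thesis using at_within_interior[OF assms(3)] by simp
qed

text \<open>In the interior of the interval derivatives of all orders are determined by the function; continuity of the
derivatives extends the identity to the end points, which may be nodes.\<close>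

lemma deriv_chain_poly:
  assumes D: "deriv_chain m {a<..<b} D" and sub: "l < r" "{l..r} \<subseteq> {a<..<b}"
    and p: "\<And>y. y \<in> {l..r} \<Longrightarrow> D 0 y = poly p y"
    and "s \<le> m" "y \<in> {l..r}"
  shows "D s y = poly ((pderiv ^^ s) p) y"
  using assms(5,6)
proof (induction s arbitrary: y)
  case 0
  then show ?case using p by simp
next
  case (Suc s)
  define f where "f = (\<lambda>y. D (Suc s) y - poly ((pderiv ^^ Suc s) p) y)"
  have "f z = 0" if z: "z \<in> {l<..<r}" for z
  proof -
    have "(D s has_real_derivative D (Suc s) z) (at z)"
      using deriv_chain_interior[OF D, of s z] Suc.prems z sub by (auto simp: interior_open subset_iff)
    moreover have "(D s has_real_derivative poly ((pderiv ^^ Suc s) p) z) (at z)"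
    proof (rule has_field_derivative_transform_within_open[of "poly ((pderiv ^^ s) p)" _ _ "{l<..<r}"])
      show "(poly ((pderiv ^^ s) p) has_real_derivative poly ((pderiv ^^ Suc s) p) z) (at z)"
        by (simp add: poly_DERIV)
    qed (use z Suc in auto)
    ultimately show ?thesis unfolding f_def by (simp add: DERIV_unique)
  qed
  moreover have "continuous_on (closure {l<..<r}) f"
    unfolding f_def using deriv_chain_continuous[OF D Suc.prems(1)] sub
    by (auto intro!: continuous_intros intro: continuous_on_subset)
  moreover have "y \<in> closure {l<..<r}" using Suc.prems sub by simp
  ultimately have "f y = 0" by (metis continuous_constant_on_closure)
  then show ?case by (simp add: f_def)
qed

lemma spline_pieces_match:
  assumes v: "C_on m {a<..<b} v" and sub: "a \<le> l" "l < X" "X < r" "r \<le> b"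
    and p: "\<And>y. y \<in> {l..X} \<Longrightarrow> v y = poly p y" and q: "\<And>y. y \<in> {X..r} \<Longrightarrow> v y = poly q y"
    and "s \<le> m"
  shows "poly ((pderiv ^^ s) p) X = poly ((pderiv ^^ s) q) X"
proof -
  obtain D where D0: "\<And>y. y \<in> {a<..<b} \<Longrightarrow> D 0 y = v y" and D: "deriv_chain m {a<..<b} D"
    using v unfolding C_on_chain by blast
  have "D s X = poly ((pderiv ^^ s) p) X"
    by (rule deriv_chain_poly[OF D, of "(l + X) / 2" X]) (use sub p D0 \<open>s \<le> m\<close> in auto)
  moreover have "D s X = poly ((pderiv ^^ s) q) X"
    by (rule deriv_chain_poly[OF D, of X "(X + r) / 2"]) (use sub q D0 \<open>s \<le> m\<close> in auto)
  ultimately show ?thesis by simp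
qed

definition pieces :: "nat \<Rightarrow> nat \<Rightarrow> (nat \<Rightarrow> real) \<Rightarrow> (real \<Rightarrow> real) \<Rightarrow> (nat \<Rightarrow> real poly) \<Rightarrow> bool" where
  "pieces k N x v P \<longleftrightarrow>
     (\<forall>i\<in>{1..N}. degree (P i) \<le> k \<and> (\<forall>y\<in>{x i..x (i + 1)}. v y = poly (P i) y))"

lemma ex_pieces: "v \<in> V_h k mu N x \<Longrightarrow> \<exists>P. pieces k N x v P"
  unfolding V_h_def spline_space_def pieces_def by (intro bchoice) auto

lemma V_h_boundary:
  assumes "v \<in> V_h k mu N x" "x 1 \<le> x (N + 1)"
  shows "v (x 1) = 0"
proof -
  obtain g where "\<forall>y\<in>{x 1..x (N + 1)}. v y = set_lebesgue_integral lborel {x 1..y} g"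
    using assms by (auto simp: V_h_def H01_def)
  then have "v (x 1) = set_lebesgue_integral lborel {x 1..x 1} g" using assms(2) by simp
  also have "\<dots> = 0"
  proof -
    have "AE y in lborel. y \<noteq> x 1" by (rule AE_lborel_singleton)
    then have "AE y in lborel. indicator {x 1..x 1} y *\<^sub>R g y = 0" by eventually_elim simp
    then show ?thesis unfolding set_lebesgue_integral_def by (rule integral_eq_zero_AE)
  qed
  finally show ?thesis .
qed

lemma mesh_less:
  assumes "is_mesh a b N x" "1 \<le> i" "i < j" "j \<le> N + 1"
  shows "x i < x j"
  using assms(3,4)
proof (induction j)
  case (Suc j)
  have "x j < x (Suc j)" using assms(1,2) Suc.prems by (auto simp: is_mesh_def)
  then show ?case using Suc by (cases "i = j") auto
qed simp

lemma mesh_le: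
  assumes "is_mesh a b N x" "1 \<le> i" "i \<le> j" "j \<le> N + 1"
  shows "x i \<le> x j"
  using mesh_less[OF assms(1,2), of j] assms(3,4) by (cases "i = j") auto

lemma mesh_bounds:
  assumes "is_mesh a b N x" "i \<in> {1..N+1}"
  shows "a \<le> x i" "x i \<le> b"
  using mesh_le[OF assms(1), of 1 i] mesh_le[OF assms(1), of i "N + 1"] assms by (auto simp: is_mesh_def)

lemma mesh_size_pos:
  assumes "is_mesh a b N x"
  shows "mesh_size N x > 0"
proof -
  have "0 < x (1 + 1) - x 1" using assms by (auto simp: is_mesh_def)
  also have "\<dots> \<le> mesh_size N x"
    unfolding mesh_size_def by (rule Max_ge) (use assms in \<open>auto simp: is_mesh_def\<close>)
  finally show ?thesis .
qed

lemma mesh_cover: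
  assumes "is_mesh a b N x" "y \<in> {a..b}"
  shows "\<exists>i\<in>{1..N}. y \<in> {x i..x (i + 1)}"
proof -
  have "\<exists>i\<in>{1..n}. y \<in> {x i..x (i + 1)}" if "n \<ge> 1" "n \<le> N" "y \<le> x (n + 1)" for n
    using that
  proof (induction n)
    case (Suc n)
    show ?case
    proof (cases "y \<le> x (n + 1) \<and> n \<ge> 1")
      case True
      then show ?thesis using Suc by (meson Suc_leD atLeastAtMost_iff le_SucI)
    next
      case False
      then have "x (Suc n) \<le> y" using assms by (cases "n = 0") (auto simp: is_mesh_def)
      then show ?thesis using Suc.prems by (intro bexI[of _ "Suc n"]) auto
    qed
  qed simp
  then show ?thesis using assms by (auto simp: is_mesh_def)
qed

lemma mesh_cover_open:
  assumes "is_mesh a b N x" "y \<in> {a..b} - x ` {1..N+1}"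
  shows "\<exists>i\<in>{1..N}. y \<in> {x i<..<x (i + 1)}"
proof -
  obtain i where i: "i \<in> {1..N}" "y \<in> {x i..x (i + 1)}" using mesh_cover[OF assms(1), of y] assms(2) by auto
  have "i \<in> {1..N+1}" "i + 1 \<in> {1..N+1}" using i by auto
  then have "y \<noteq> x i" "y \<noteq> x (i + 1)" using assms(2) by blast+
  with i show ?thesis by (intro bexI[of _ i]) auto
qed

text \<open>Values at the nodes are irrelevant, so continuity on each closed element is required only of a function that
agrees with \<open>f\<close> inside.\<close>

lemma mesh_integrable:
  fixes f :: "real \<Rightarrow> real"
  assumes "is_mesh a b N x"
    and g: "\<And>i. i \<in> {1..N} \<Longrightarrow> continuous_on {x i..x (i + 1)} (g i)"
    and f: "\<And>i y. i \<in> {1..N} \<Longrightarrow> y \<in> {x i<..<x (i + 1)} \<Longrightarrow> f y = g i y"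
  shows "f integrable_on {a..b}"
proof -
  have "f integrable_on {x 1..x (n + 1)}" if "n \<le> N" for n
    using that
  proof (induction n)
    case 0
    then show ?case using integrable_on_refl[of f "x 1"] by simp
  next
    case (Suc n)
    have "g (n + 1) integrable_on {x (n + 1)..x (n + 2)}"
      using g[of "n + 1"] Suc.prems by (simp add: integrable_continuous_interval)
    then have "f integrable_on {x (n + 1)..x (n + 2)}"
      by (rule integrable_spike_finite[rotated 2, where S="{x (n + 1), x (n + 2)}"])
         (use f[of "n + 1"] Suc.prems in auto)
    moreover have "x 1 \<le> x (n + 1)" "x (n + 1) \<le> x (n + 2)"
      using mesh_le[OF assms(1)] Suc.prems by auto
    ultimately show ?case using Henstock_Kurzweil_Integration.integrable_combine[where a="x 1" and c="x (n + 1)" and b="x (n + 2)" and f=f] Suc by simp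
  qed
  from this[of N] show ?thesis using assms(1) by (simp add: is_mesh_def)
qed

lemma pieces_continuous:
  assumes "is_mesh a b N x" "pieces k N x v P"
  shows "continuous_on {a..b} v"
proof -
  have "continuous_on {x 1..x (n + 1)} v" if "n \<le> N" for n
    using that
  proof (induction n)
    case (Suc n)
    have "continuous_on {x (n + 1)..x (n + 2)} (poly (P (n + 1)))" by (intro continuous_intros)
    then have "continuous_on {x (n + 1)..x (n + 2)} v"
    proof (rule continuous_on_eq)
      fix y assume "y \<in> {x (n + 1)..x (n + 2)}"
      then show "poly (P (n + 1)) y = v y"
        using assms(2)[unfolded pieces_def, rule_format, of "n + 1"] Suc.prems by simp
    qed
    then have "continuous_on ({x 1..x (n + 1)} \<union> {x (n + 1)..x (n + 2)}) v"
      using Suc by (intro continuous_on_closed_Un) auto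
    moreover have "x 1 \<le> x (n + 1)" "x (n + 1) \<le> x (n + 2)"
      using mesh_le[OF assms(1)] Suc.prems by auto
    ultimately show ?case by (simp add: ivl_disj_un_two_touch)
  qed simp
  from this[of N] show ?thesis using assms(1) by (simp add: is_mesh_def)
qed

lemma DERIV_piece:
  assumes "pieces k N x v P" "i \<in> {1..N}" "y \<in> {x i<..<x (i + 1)}"
  shows "(v has_real_derivative poly (pderiv (P i)) y) (at y)"
  by (rule has_field_derivative_transform_within_open[of "poly (P i)" _ _ "{x i<..<x (i + 1)}"])
     (use assms in \<open>auto simp: pieces_def poly_DERIV\<close>)

section \<open>The energy bound\<close>

lemma DERIV_error:
  assumes mesh: "is_mesh a b N x" and P: "pieces k N x uh P"
    and D: "deriv_chain m {a..b} D" "m \<ge> 1" and u: "\<And>y. y \<in> {a..b} \<Longrightarrow> D 0 y = u y"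
    and i: "i \<in> {1..N}" "y \<in> {x i<..<x (i + 1)}"
  shows "((\<lambda>z. u z - uh z) has_real_derivative (D 1 y - poly (pderiv (P i)) y)) (at y)"
proof -
  have ab: "a \<le> x i" "x (i + 1) \<le> b" using mesh_bounds[OF mesh] i by auto
  have "(D 0 has_real_derivative D (Suc 0) y) (at y)"
    by (rule deriv_chain_interior[OF D(1)]) (use D(2) i ab in auto)
  then have "(u has_real_derivative D 1 y) (at y)"
    by (intro has_field_derivative_transform_within_open[of "D 0" _ _ "{x i<..<x (i + 1)}" u])
       (use i ab u in auto)
  then show ?thesis by (intro DERIV_diff DERIV_piece[OF P i])
qed

text \<open>Testing with the discrete solution itself gives \<open>\<integral> e'\<^sup>2 = \<integral> e' u'\<close>, hence \<open>\<integral> e'\<^sup>2 \<le> \<integral> u'\<^sup>2\<close>. As \<open>e\<close> vanishes at the left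
end point, it is bounded by the integral of \<open>1 + e'\<^sup>2\<close>.\<close>

lemma galerkin_error_bound:
  assumes mesh: "is_mesh a b N x" and gal: "is_galerkin_solution k mu N x u uh"
    and D: "deriv_chain m {a..b} D" "m \<ge> 1" and u: "\<And>y. y \<in> {a..b} \<Longrightarrow> D 0 y = u y" "u a = 0"
    and B: "\<And>y. y \<in> {a..b} \<Longrightarrow> \<bar>D 1 y\<bar> \<le> B"
    and y: "y \<in> {a..b}"
  shows "\<bar>u y - uh y\<bar> \<le> (b - a) * (1 + B\<^sup>2)"
proof -
  have uh: "uh \<in> V_h k mu N x" using gal by (simp add: is_galerkin_solution_def)
  obtain P where P: "pieces k N x uh P" using ex_pieces[OF uh] ..
  have x1: "x 1 = a" "x (N + 1) = b" "a < b"
    using mesh mesh_less[OF mesh, of 1 "N + 1"] by (auto simp: is_mesh_def)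
  define e where "e = (\<lambda>z. u z - uh z)"
  define q where "q = deriv e"
  define S where "S = x ` {1..N+1}"
  have S: "finite S" "a \<in> S" "b \<in> S" using x1 by (auto simp: S_def image_iff intro: bexI[of _ 1] bexI[of _ "N + 1"])
  have De: "(e has_real_derivative q y) (at y)" "q y = D 1 y - poly (pderiv (P i)) y"
    if "i \<in> {1..N}" "y \<in> {x i<..<x (i + 1)}" for i y
    using DERIV_error[OF mesh P D u(1) that] by (auto simp: e_def q_def DERIV_imp_deriv)
  have sub: "{x i..x (i + 1)} \<subseteq> {a..b}" if "i \<in> {1..N}" for i
    using mesh_bounds[OF mesh, of i] mesh_bounds[OF mesh, of "i + 1"] that by auto
  have D1: "continuous_on {a..b} (D 1)" using deriv_chain_continuous[OF D(1)] D(2) by simp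
  have cont1: "continuous_on {x i..x (i + 1)} (D 1)" if "i \<in> {1..N}" for i
    using D1 sub[OF that] by (rule continuous_on_subset)
  have int_qq: "(\<lambda>y. q y * q y) integrable_on {a..b}"
    by (rule mesh_integrable[OF mesh, where g="\<lambda>i y. (D 1 y - poly (pderiv (P i)) y) * (D 1 y - poly (pderiv (P i)) y)"])
       (intro continuous_intros cont1, auto simp: De)
  have int_qu: "(\<lambda>y. q y * D 1 y) integrable_on {a..b}"
    by (rule mesh_integrable[OF mesh, where g="\<lambda>i y. (D 1 y - poly (pderiv (P i)) y) * D 1 y"])
       (intro continuous_intros cont1, auto simp: De)
  have int_uu: "(\<lambda>y. D 1 y * D 1 y) integrable_on {a..b}"
    by (intro integrable_continuous_interval continuous_intros D1)
  have "integral {a..b} (\<lambda>y. q y * (D 1 y - q y)) = integral {a..b} (\<lambda>y. deriv e y * deriv uh y)"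
  proof (rule integral_spike[OF negligible_finite[OF S(1)]])
    fix y assume "y \<in> {a..b} - S"
    then obtain i where i: "i \<in> {1..N}" "y \<in> {x i<..<x (i + 1)}"
      using mesh_cover_open[OF mesh, of y] by (auto simp: S_def)
    then show "deriv e y * deriv uh y = q y * (D 1 y - q y)"
      using De(2)[OF i] DERIV_imp_deriv[OF DERIV_piece[OF P i]] by (simp add: q_def)
  qed
  also have "\<dots> = integral {a<..<b} (\<lambda>y. deriv e y * deriv uh y)" by (rule integral_open_interval_real)
  also have "\<dots> = 0" using gal uh x1 by (simp add: is_galerkin_solution_def e_def)
  finally have "integral {a..b} (\<lambda>y. q y * D 1 y - q y * q y) = 0" by (simp add: right_diff_distrib)
  then have *: "integral {a..b} (\<lambda>y. q y * q y) = integral {a..b} (\<lambda>y. q y * D 1 y)"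
    using integral_diff[OF int_qu int_qq] by simp
  also have "\<dots> \<le> integral {a..b} (\<lambda>y. 1 / 2 * (q y * q y) + 1 / 2 * (D 1 y * D 1 y))"
  proof (rule integral_le[OF int_qu])
    show "(\<lambda>y. 1 / 2 * (q y * q y) + 1 / 2 * (D 1 y * D 1 y)) integrable_on {a..b}"
      by (intro integrable_add integrable_on_mult_right int_qq int_uu)
    fix y show "q y * D 1 y \<le> 1 / 2 * (q y * q y) + 1 / 2 * (D 1 y * D 1 y)"
      using zero_le_square[of "q y - D 1 y"] by (simp add: algebra_simps)
  qed
  also have "\<dots> = 1 / 2 * integral {a..b} (\<lambda>y. q y * q y) + 1 / 2 * integral {a..b} (\<lambda>y. D 1 y * D 1 y)"
    using integral_add[OF integrable_on_mult_right[OF int_qq, of "1 / 2"] integrable_on_mult_right[OF int_uu, of "1 / 2"]]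
    by simp
  finally have "integral {a..b} (\<lambda>y. q y * q y) \<le> integral {a..b} (\<lambda>y. D 1 y * D 1 y)" by simp
  also have "\<dots> \<le> integral {a..b} (\<lambda>y. B\<^sup>2)"
  proof (rule integral_le[OF int_uu])
    fix y assume "y \<in> {a..b}"
    then have "\<bar>D 1 y\<bar>\<^sup>2 \<le> B\<^sup>2" by (intro power_mono B) auto
    then show "D 1 y * D 1 y \<le> B\<^sup>2" by (simp add: power2_eq_square)
  qed auto
  also have "\<dots> = (b - a) * B\<^sup>2" using x1 by simp
  finally have energy: "integral {a..b} (\<lambda>y. q y * q y) \<le> (b - a) * B\<^sup>2" .
  have "continuous_on {a..b} u"
    using continuous_on_eq[OF deriv_chain_continuous[OF D(1), of 0] u(1)] by simp
  then have ce: "continuous_on {a..b} e"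
    unfolding e_def by (intro continuous_on_diff pieces_continuous[OF mesh P])
  have "(q has_integral (e y - e a)) {a..y}"
  proof (rule fundamental_theorem_of_calculus_interior_strong[OF S(1)])
    show "a \<le> y" using y by simp
    show "continuous_on {a..y} e" using ce by (rule continuous_on_subset) (use y in auto)
    fix z assume "z \<in> {a<..<y} - S"
    then obtain i where "i \<in> {1..N}" "z \<in> {x i<..<x (i + 1)}"
      using mesh_cover_open[OF mesh, of z] y by (auto simp: S_def)
    then show "(e has_vector_derivative q z) (at z)"
      using De(1) by (simp add: has_real_derivative_iff_has_vector_derivative)
  qed
  moreover have "e a = 0" using V_h_boundary[OF uh] u(2) x1 by (simp add: e_def)
  ultimately have q: "(q has_integral e y) {a..y}" by simp
  have int1: "(\<lambda>y. 1 + q y * q y) integrable_on {a..b}"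
    by (intro integrable_add int_qq) auto
  have int2: "(\<lambda>y. 1 + q y * q y) integrable_on {a..y}"
    by (rule integrable_on_subinterval[OF int1]) (use y in auto)
  have "\<bar>e y\<bar> = norm (integral {a..y} q)" using q by (simp add: integral_unique)
  also have "\<dots> \<le> integral {a..y} (\<lambda>y. 1 + q y * q y)"
  proof (rule integral_norm_bound_integral[OF _ int2])
    show "q integrable_on {a..y}" using q by blast
    fix y
    have "2 * \<bar>q y\<bar> \<le> 1 + q y * q y" using zero_le_square[of "\<bar>q y\<bar> - 1"] by (simp add: algebra_simps)
    then show "norm (q y) \<le> 1 + q y * q y" using zero_le_square[of "q y"] by simp
  qed
  also have "\<dots> \<le> integral {a..b} (\<lambda>y. 1 + q y * q y)"
    by (rule integral_subset_le[OF _ int2 int1]) (use y in auto)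
  also have "\<dots> = (b - a) + integral {a..b} (\<lambda>y. q y * q y)"
    using x1 by (subst integral_add[OF _ int_qq]) auto
  finally show ?thesis using energy by (simp add: e_def algebra_simps)
qed

section \<open>Testing with a locally supported spline\<close>

text \<open>The test spline with its first knot moved to \<open>z\<close> and the knot distance scaled to \<open>h\<close>.\<close>

definition test_fun :: "nat \<Rightarrow> real \<Rightarrow> real \<Rightarrow> real \<Rightarrow> real" where
  "test_fun n h z y = tspline n 0 (2 / h * (y - z))"

lemma abs_tpow_le:
  assumes "\<bar>x\<bar> \<le> R" "m \<le> n"
  shows "\<bar>tpow m x\<bar> \<le> (R + 1) ^ n"
proof -
  have "\<bar>tpow m x\<bar> \<le> \<bar>x\<bar> ^ m / fact m" by (simp add: tpow_def)
  also have "\<dots> \<le> \<bar>x\<bar> ^ m / 1"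
    by (intro divide_left_mono) (auto simp: fact_ge_1)
  also have "\<dots> \<le> (R + 1) ^ m" using assms by (auto intro: power_mono)
  also have "\<dots> \<le> (R + 1) ^ n" using assms by (intro power_increasing) auto
  finally show ?thesis .
qed

lemma abs_tspline_le:
  assumes "\<bar>x\<bar> \<le> R"
  shows "\<bar>tspline n d x\<bar> \<le> (1 + (\<Sum>l\<le>n. \<bar>diff_weights n l\<bar>)) * (R + 2 * real n + 1) ^ n"
proof -
  have "\<bar>tpow (n - Suc d) x\<bar> \<le> (R + 2 * real n + 1) ^ n"
    using assms by (intro abs_tpow_le) auto
  moreover have "\<bar>\<Sum>l\<le>n. diff_weights n l * tpow (n - d) (x - 2 * real l)\<bar> \<le> (\<Sum>l\<le>n. \<bar>diff_weights n l\<bar> * (R + 2 * real n + 1) ^ n)"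
  proof (rule order.trans[OF sum_abs sum_mono])
    fix l assume "l \<in> {..n}"
    then have "real l \<le> real n" by simp
    then have "\<bar>x - 2 * real l\<bar> \<le> R + 2 * real n" using assms by linarith
    then show "\<bar>diff_weights n l * tpow (n - d) (x - 2 * real l)\<bar> \<le> \<bar>diff_weights n l\<bar> * (R + 2 * real n + 1) ^ n"
      unfolding abs_mult by (intro mult_left_mono abs_tpow_le) auto
  qed
  ultimately show ?thesis
    unfolding tspline_def distrib_right sum_distrib_right by linarith
qed

lemma DERIV_tspline_scaled:
  assumes "n \<ge> d + 2" "n \<ge> d + 3 \<or> y \<noteq> z" "h > 0"
  shows "((\<lambda>y. (2 / h) ^ d * tspline n d (2 / h * (y - z))) has_real_derivative
           (2 / h) ^ Suc d * tspline n (Suc d) (2 / h * (y - z))) (at y)"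
proof -
  have "(tspline n d has_real_derivative tspline n (Suc d) (2 / h * (y - z))) (at (2 / h * (y - z)))"
    by (rule DERIV_tspline) (use assms in auto)
  moreover have "((\<lambda>y. 2 / h * (y - z)) has_real_derivative 2 / h) (at y)"
    using assms(3) by (auto intro!: derivative_eq_intros)
  ultimately have "((\<lambda>y. tspline n d (2 / h * (y - z))) has_real_derivative
      tspline n (Suc d) (2 / h * (y - z)) * (2 / h)) (at y)"
    by (rule DERIV_chain2)
  from DERIV_cmult[OF this, of "(2 / h) ^ d"] show ?thesis by (simp add: mult_ac)
qed

lemma continuous_on_tspline_scaled:
  assumes "n \<ge> d + 2"
  shows "continuous_on A (\<lambda>y. tspline n d (2 / h * (y - z)))"
  by (rule continuous_on_compose2[OF continuous_on_tspline[OF assms, of UNIV]])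
     (intro continuous_on_mult_left continuous_on_diff continuous_on_id continuous_on_const, auto)

lemma test_fun_C_on:
  assumes "n \<ge> mu + 2" "h > 0"
  shows "C_on mu S (test_fun n h z)"
  unfolding C_on_def
proof (intro exI[of _ "\<lambda>d y. (2 / h) ^ d * tspline n d (2 / h * (y - z))"] conjI allI impI ballI)
  fix d y assume "d < mu" "y \<in> S"
  then show "((\<lambda>y. (2 / h) ^ d * tspline n d (2 / h * (y - z))) has_real_derivative
           (2 / h) ^ Suc d * tspline n (Suc d) (2 / h * (y - z))) (at y within S)"
    using assms by (intro has_field_derivative_at_within[OF DERIV_tspline_scaled]) auto
next
  show "continuous_on S (\<lambda>y. (2 / h) ^ mu * tspline n mu (2 / h * (y - z)))"
    by (intro continuous_intros continuous_on_tspline_scaled) (use assms in auto)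
qed (simp add: test_fun_def)

text \<open>The spline is the primitive of its piecewise derivative, which is bounded and measurable; for \<open>n = 2\<close> the
derivative is discontinuous at the first knot.\<close>

lemma test_fun_H01:
  assumes "n \<ge> 2" "h > 0" "a \<le> z" "z + real n * h \<le> b"
  shows "test_fun n h z \<in> H01 a b"
proof -
  define g where "g = (\<lambda>y. (2 / h) ^ Suc 0 * tspline n (Suc 0) (2 / h * (y - z)))"
  define R where "R = 2 / h * (\<bar>a - z\<bar> + \<bar>b - z\<bar>)"
  define C where "C = (2 / h) ^ Suc 0 * ((1 + (\<Sum>l\<le>n. \<bar>diff_weights n l\<bar>)) * (R + 2 * real n + 1) ^ n)"
  have meas: "g \<in> borel_measurable lborel"
  proof -
    have [measurable]: "tspline n (Suc 0) \<in> borel_measurable borel" by (rule borel_measurable_tspline)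
    show ?thesis unfolding g_def by measurable
  qed
  have gC: "\<bar>g y\<bar> \<le> C" if "y \<in> {a..b}" for y
  proof -
    have "\<bar>2 / h * (y - z)\<bar> \<le> R"
      unfolding R_def abs_mult using that assms by (intro mult_mono) auto
    then have "\<bar>tspline n (Suc 0) (2 / h * (y - z))\<bar> \<le> (1 + (\<Sum>l\<le>n. \<bar>diff_weights n l\<bar>)) * (R + 2 * real n + 1) ^ n"
      by (rule abs_tspline_le)
    moreover have "\<bar>(2 / h) ^ Suc 0\<bar> = (2 / h) ^ Suc 0" using assms by simp
    ultimately show ?thesis
      unfolding g_def C_def abs_mult using assms by (intro mult_mono) auto
  qed
  have set_int: "set_integrable lborel {a..y} g" if "y \<in> {a..b}" for y
    unfolding set_integrable_def
    by (rule integrableI_bounded_set_indicator[where B=C])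
       (use meas gC that in \<open>auto simp: emeasure_lborel_Icc_eq\<close>)
  have set_int2: "set_integrable lborel {a..b} (\<lambda>y. (g y)\<^sup>2)"
    unfolding set_integrable_def
  proof (rule integrableI_bounded_set_indicator[where B="C\<^sup>2"])
    show "AE y in lborel. y \<in> {a..b} \<longrightarrow> norm ((g y)\<^sup>2) \<le> C\<^sup>2"
    proof (intro AE_I2 impI)
      fix y assume "y \<in> {a..b}"
      then have "\<bar>g y\<bar>\<^sup>2 \<le> C\<^sup>2" by (intro power_mono gC) auto
      then show "norm ((g y)\<^sup>2) \<le> C\<^sup>2" by simp
    qed
  qed (use meas in \<open>auto simp: emeasure_lborel_Icc_eq\<close>)
  have a0: "test_fun n h z a = 0"
    unfolding test_fun_def
  proof (rule tspline_eq_0_left)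
    show "2 / h * (a - z) \<le> 0" using assms by (intro mult_nonneg_nonpos) auto
  qed (use assms in auto)
  have b0: "test_fun n h z b = 0"
    unfolding test_fun_def
  proof (rule tspline_eq_0_right[OF assms(1)])
    have "2 / h * (real n * h) \<le> 2 / h * (b - z)"
      by (rule mult_left_mono) (use assms in auto)
    then show "2 * real n \<le> 2 / h * (b - z)" using assms by simp
  qed
  have "test_fun n h z y = set_lebesgue_integral lborel {a..y} g" if y: "y \<in> {a..b}" for y
  proof -
    have "(g has_integral (test_fun n h z y - test_fun n h z a)) {a..y}"
    proof (rule fundamental_theorem_of_calculus_interior_strong[of "{z}"])
      fix t assume "t \<in> {a<..<y} - {z}"
      then have "((\<lambda>y. (2 / h) ^ 0 * tspline n 0 (2 / h * (y - z))) has_real_derivative g t) (at t)"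
        unfolding g_def using assms by (intro DERIV_tspline_scaled) auto
      then show "(test_fun n h z has_vector_derivative g t) (at t)"
        by (simp add: test_fun_def[abs_def] has_real_derivative_iff_has_vector_derivative)
    next
      show "continuous_on {a..y} (test_fun n h z)"
        unfolding test_fun_def using assms by (intro continuous_on_tspline_scaled) auto
    qed (use y in auto)
    then have "test_fun n h z y = integral {a..y} g" by (simp add: a0 integral_unique)
    then show ?thesis using set_borel_integral_eq_integral(2)[OF set_int[OF y]] by simp
  qed
  then show ?thesis unfolding H01_def using meas set_int2 b0 by blast
qed

lemma uniform_run:
  assumes "\<forall>i<n. x (p + i + 1) - x (p + i) = h" "i \<le> n"
  shows "x (p + i) = x p + real i * (h :: real)"
  using assms(2)
proof (induction i)
  case (Suc i)
  then have "x (p + Suc i) = x (p + i) + h" using assms(1)[rule_format, of i] by simp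
  then show ?case using Suc by (simp add: algebra_simps)
qed simp

lemma test_fun_eq_tpiece:
  assumes "n \<ge> 2" "h > 0" "i < n" "y \<in> {z + real i * h..z + real (Suc i) * h}"
  shows "test_fun n h z y = poly (tpiece n i) (2 / h * (y - z))"
  unfolding test_fun_def
proof (rule tspline_eq_tpiece[OF assms(1,3)])
  have "2 / h * (real i * h) \<le> 2 / h * (y - z)" "2 / h * (y - z) \<le> 2 / h * (real (Suc i) * h)"
    by (rule mult_left_mono; use assms in auto)+
  then show "2 * real i \<le> 2 / h * (y - z)" "2 / h * (y - z) \<le> 2 * real i + 2"
    using assms(2) by (simp_all add: algebra_simps)
qed

lemma test_fun_eq_0:
  assumes "n \<ge> 2" "h > 0" "y \<le> z \<or> z + real n * h \<le> y"
  shows "test_fun n h z y = 0"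
  using assms(3)
proof
  assume "y \<le> z"
  then have "2 / h * (y - z) \<le> 0" using assms(2) by (intro mult_nonneg_nonpos) auto
  then show ?thesis unfolding test_fun_def using assms by (intro tspline_eq_0_left) auto
next
  assume y: "z + real n * h \<le> y"
  have "2 / h * (real n * h) \<le> 2 / h * (y - z)"
    by (rule mult_left_mono) (use assms y in auto)
  then show ?thesis unfolding test_fun_def using assms
    by (intro tspline_eq_0_right) auto
qed

text \<open>The knots of the spline are nodes of the mesh as long as its support lies in a run of elements of equal
length.\<close>

lemma test_fun_V_h:
  assumes mesh: "is_mesh a b N x" and n: "n \<ge> mu + 2" "n \<le> k" and p: "1 \<le> p" "p + n \<le> N + 1"
    and h: "h > 0" and run: "\<forall>i<n. x (p + i + 1) - x (p + i) = h"
  shows "test_fun n h (x p) \<in> V_h k mu N x"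
proof -
  let ?v = "test_fun n h (x p)"
  have n2: "n \<ge> 2" using n by simp
  have xp: "x (p + i) = x p + real i * h" if "i \<le> n" for i using uniform_run[OF run that] .
  have "\<exists>q :: real poly. degree q \<le> k \<and> (\<forall>y\<in>{x i..x (i + 1)}. ?v y = poly q y)" if i: "i \<in> {1..N}" for i
  proof (cases "p \<le> i \<and> i < p + n")
    case True
    then obtain j where j: "i = p + j" "j < n" using le_Suc_ex by (metis nat_add_left_cancel_less)
    let ?q = "pcompose (tpiece n j) [:- (2 / h * x p), 2 / h:]"
    have "degree ?q \<le> k"
      using degree_pcompose_le[of "tpiece n j" "[:- (2 / h * x p), 2 / h:]"] degree_tpiece[of n j] n h by simp
    moreover have "?v y = poly ?q y" if "y \<in> {x i..x (i + 1)}" for y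
    proof -
      have "y \<in> {x p + real j * h..x p + real (Suc j) * h}"
        using that xp[of j] xp[of "Suc j"] j by simp
      then have "?v y = poly (tpiece n j) (2 / h * (y - x p))"
        by (rule test_fun_eq_tpiece[OF n2 h j(2)])
      moreover have "poly [:- (2 / h * x p), 2 / h:] y = 2 / h * (y - x p)" by (simp add: algebra_simps diff_divide_distrib)
      ultimately show ?thesis by (simp only: poly_pcompose)
    qed
    ultimately show ?thesis by blast
  next
    case False
    have "?v y = 0" if y: "y \<in> {x i..x (i + 1)}" for y
    proof (rule test_fun_eq_0[OF n2 h])
      from False have "i + 1 \<le> p \<or> p + n \<le> i" by auto
      then show "y \<le> x p \<or> x p + real n * h \<le> y"
        using mesh_le[OF mesh, of "i + 1" p] mesh_le[OF mesh, of "p + n" i] xp[of n] y p i by auto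
    qed
    then show ?thesis by (intro exI[of _ 0]) auto
  qed
  moreover have "C_on mu {x 1<..<x (N + 1)} ?v" using n(1) h by (rule test_fun_C_on)
  moreover have "?v \<in> H01 (x 1) (x (N + 1))"
    using n2 h mesh_le[OF mesh, of 1 p] mesh_le[OF mesh, of "p + n" "N + 1"] xp[of n] p
    by (intro test_fun_H01) auto
  ultimately show ?thesis by (simp add: V_h_def spline_space_def)
qed

text \<open>Twice the bound of the derivative of each shifted piece, for the length of \<open>[-1, 1]\<close>.\<close>

definition fold_const :: "nat \<Rightarrow> real" where
  "fold_const n = (\<Sum>i<n. 2 * coeff_norm (pderiv (pcompose (tpiece n i) [:2 * real i + 1, 1:])))"

lemma has_integral_sum_intervals:
  fixes f :: "real \<Rightarrow> real"
  assumes "\<And>i. i < n \<Longrightarrow> X i \<le> X (Suc i)" "\<And>i. i < n \<Longrightarrow> (f has_integral I i) {X i..X (Suc i)}"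
  shows "(f has_integral (\<Sum>i<n. I i)) {X 0..X n} \<and> X 0 \<le> X n"
  using assms
proof (induction n)
  case (Suc n)
  then have "(f has_integral (\<Sum>i<n. I i)) {X 0..X n}" "X 0 \<le> X n" by auto
  then show ?case using has_integral_combine[of "X 0" "X n" "X (Suc n)" f] Suc.prems[of n]
    by (auto intro: order.trans)
qed (simp add: has_integral_refl)

text \<open>Galerkin orthogonality to the test spline is a sum over \<open>n\<close> elements. On the reference element each summand is,
up to the factor \<open>2 / h\<close>, the integral of \<open>E'\<close> against the derivative of a shifted piece, with an error
controlled by \<open>\<eta>\<close>. As \<open>E\<close> is common to all the elements, the shifted pieces may be added first.\<close>

lemma galerkin_test:
  assumes mesh: "is_mesh a b N x" and gal: "is_galerkin_solution k mu N x u uh"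
    and P: "pieces k N x uh P"
    and D: "deriv_chain m {a..b} D" "m \<ge> 1" and u: "\<And>y. y \<in> {a..b} \<Longrightarrow> D 0 y = u y"
    and n: "n \<ge> mu + 2" "n \<le> k" and p: "1 \<le> p" "p + n \<le> N + 1"
    and h: "h > 0" and run: "\<forall>i<n. x (p + i + 1) - x (p + i) = h"
    and E: "\<And>i t. i < n \<Longrightarrow> \<bar>t\<bar> \<le> 1 \<Longrightarrow>
       \<bar>h / 2 * (D 1 (midpoint_of x (p + i) + h / 2 * t) - poly (pderiv (P (p + i))) (midpoint_of x (p + i) + h / 2 * t))
          - poly (pderiv E) t\<bar> \<le> \<eta>"
  shows "\<bar>h1_form E (tfold n)\<bar> \<le> fold_const n * \<eta>"
proof -
  define v where "v = test_fun n h (x p)"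
  define e where "e = (\<lambda>z. u z - uh z)"
  define V where "V = (\<lambda>i. pcompose (tpiece n i) [:2 * real i + 1, 1:])"
  define xm where "xm = (\<lambda>i. midpoint_of x (p + i))"
  \<comment> \<open>The derivative of the error on the element \<open>i\<close> with respect to \<open>t\<close>.\<close>
  define w where "w = (\<lambda>i t. h / 2 * (D 1 (xm i + h / 2 * t) - poly (pderiv (P (p + i))) (xm i + h / 2 * t)))"
  define I where "I = (\<lambda>i. integral {-1..1} (\<lambda>t. w i t * poly (pderiv (V i)) t))"
  have n2: "n \<ge> 2" using n by simp
  have xp: "x (p + i) = x p + real i * h" if "i \<le> n" for i using uniform_run[OF run that] .
  have x1: "x 1 = a" "x (N + 1) = b" using mesh by (auto simp: is_mesh_def)
  have in_mesh: "p + i \<in> {1..N}" if "i < n" for i using that p by auto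
  have xmi: "xm i = x (p + i) + h / 2" "x (p + i + 1) = x (p + i) + h" if "i < n" for i
    using xp[of i] xp[of "Suc i"] that by (simp_all add: xm_def midpoint_of_def field_simps)
  have ab: "a \<le> x (p + i)" "x (p + i + 1) \<le> b" if "i < n" for i
    using mesh_bounds[OF mesh, of "p + i"] mesh_bounds[OF mesh, of "p + i + 1"] in_mesh[OF that] by auto
  have in_ab: "xm i + h / 2 * t \<in> {a..b}" if "i < n" "\<bar>t\<bar> \<le> 1" for i t
    using reference_point_in[OF h that(2), of "xm i"] ab[OF that(1)] xmi[OF that(1)] by auto
  have D1: "continuous_on {a..b} (D 1)" using deriv_chain_continuous[OF D(1)] D(2) by simp
  have cont_w: "continuous_on {-1..1} (w i)" if "i < n" for i
    unfolding w_def
    by (intro continuous_intros continuous_on_compose2[OF D1]) (use in_ab[OF that] in \<open>auto simp: abs_le_iff\<close>)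
  have elem: "((\<lambda>y. deriv e y * deriv v y) has_integral (2 / h * I i)) {x (p + i)..x (p + Suc i)}"
    if i: "i < n" for i
  proof -
    define f where "f = (\<lambda>t. (2 / h) ^ 2 * (w i t * poly (pderiv (V i)) t))"
    have "((\<lambda>t. w i t * poly (pderiv (V i)) t) has_integral I i) {-1..1}"
      unfolding I_def
      by (intro integrable_integral integrable_continuous_interval continuous_intros cont_w i)
    then have "(f has_integral ((2 / h) ^ 2 * I i)) (cbox (-1) 1)"
      unfolding f_def by (simp add: has_integral_mult_right)
    moreover have "2 / h > 0" using h by simp
    ultimately have "((\<lambda>y. f ((2 / h) *\<^sub>R y + - (2 / h * xm i))) has_integral (((2 / h) ^ 2 * I i) /\<^sub>R (2 / h) ^ DIM(real)))
        (cbox ((- 1 - - (2 / h * xm i)) /\<^sub>R (2 / h)) ((1 - - (2 / h * xm i)) /\<^sub>R (2 / h)))"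
      by (rule has_integral_affinity')
    moreover have "((2 / h) ^ 2 * I i) /\<^sub>R (2 / h) ^ DIM(real) = 2 / h * I i"
      using h by (simp add: power2_eq_square)
    moreover have "(- 1 - - (2 / h * xm i)) /\<^sub>R (2 / h) = x (p + i)"
      using h xmi[OF i] by (simp add: field_simps)
    moreover have "(1 - - (2 / h * xm i)) /\<^sub>R (2 / h) = x (p + Suc i)"
      using h xmi[OF i] by (simp add: field_simps)
    ultimately have int: "((\<lambda>y. f (2 / h * y - 2 / h * xm i)) has_integral 2 / h * I i) {x (p + i)..x (p + Suc i)}"
      by (simp only: real_scaleR_def box_real diff_conv_add_uminus)
    show ?thesis
    proof (rule has_integral_spike_finite[OF _ _ int, of "{x (p + i), x (p + Suc i)}"])
      fix y assume "y \<in> {x (p + i)..x (p + Suc i)} - {x (p + i), x (p + Suc i)}"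
      then have y: "y \<in> {x (p + i)<..<x (p + i + 1)}" by auto
      define t where "t = 2 / h * y - 2 / h * xm i"
      have yt: "y = xm i + h / 2 * t" using h by (simp add: t_def field_simps)
      have "deriv e y = D 1 y - poly (pderiv (P (p + i))) y"
        unfolding e_def by (rule DERIV_imp_deriv, rule DERIV_error[OF mesh P D u in_mesh[OF i] y])
      then have 1: "deriv e y = 2 / h * w i t" using h by (simp add: w_def yt)
      have "(v has_real_derivative (2 / h * poly (pderiv (tpiece n i)) (2 / h * (y - x p)))) (at y)"
      proof (rule has_field_derivative_transform_within_open[of "\<lambda>y. poly (tpiece n i) (2 / h * (y - x p))" _ _ "{x (p + i)<..<x (p + i + 1)}"])
        show "((\<lambda>y. poly (tpiece n i) (2 / h * (y - x p))) has_real_derivative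
            2 / h * poly (pderiv (tpiece n i)) (2 / h * (y - x p))) (at y)"
          using h by (auto intro!: derivative_eq_intros)
        fix s assume s: "s \<in> {x (p + i)<..<x (p + i + 1)}"
        have "s \<in> {x p + real i * h..x p + real (Suc i) * h}"
          using s xp[of i] xp[of "Suc i"] i by simp
        then show "poly (tpiece n i) (2 / h * (s - x p)) = v s"
          unfolding v_def by (rule test_fun_eq_tpiece[OF n2 h i, symmetric])
      qed (use y in auto)
      moreover have "2 / h * (y - x p) = 2 * real i + 1 + t"
        using h xmi(1)[OF i] xp[of i] i by (simp add: yt field_simps)
      ultimately have "deriv v y = 2 / h * poly (pderiv (V i)) t"
        by (simp add: DERIV_imp_deriv V_def pderiv_pcompose pderiv_pCons poly_pcompose add.commute)
      then show "deriv e y * deriv v y = f (2 / h * y - 2 / h * xm i)"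
        unfolding f_def t_def[symmetric] using 1 by (simp add: power2_eq_square)
    qed simp
  qed
  have "((\<lambda>y. deriv e y * deriv v y) has_integral (\<Sum>i<n. 2 / h * I i)) {x (p + 0)..x (p + n)}"
    using has_integral_sum_intervals[of n "\<lambda>i. x (p + i)" "\<lambda>y. deriv e y * deriv v y" "\<lambda>i. 2 / h * I i"]
      elem xmi h by fastforce
  then have int0: "((\<lambda>y. deriv e y * deriv v y) has_integral (\<Sum>i<n. 2 / h * I i)) {x (p + 0)..x (p + n)}" .
  have dv0: "deriv v y = 0" if "y \<notin> {x (p + 0)..x (p + n)}" for y
  proof -
    have "(v has_real_derivative 0) (at y)"
    proof (rule has_field_derivative_transform_within_open[of "\<lambda>_. 0" _ _ "- {x (p + 0)..x (p + n)}"])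
      fix s assume "s \<in> - {x (p + 0)..x (p + n)}"
      then show "0 = v s" unfolding v_def using xp[of n]
        by (intro test_fun_eq_0[OF n2 h, symmetric]) auto
    qed (use that in auto)
    then show ?thesis by (rule DERIV_imp_deriv)
  qed
  have sub: "{x (p + 0)..x (p + n)} \<subseteq> {a..b}"
    using mesh_bounds[OF mesh, of p] mesh_bounds[OF mesh, of "p + n"] p by auto
  have "((\<lambda>y. deriv e y * deriv v y) has_integral (\<Sum>i<n. 2 / h * I i)) {a..b}"
    by (rule has_integral_on_superset[OF int0 _ sub]) (simp add: dv0)
  then have "integral {x 1<..<x (N + 1)} (\<lambda>y. deriv e y * deriv v y) = (\<Sum>i<n. 2 / h * I i)"
    unfolding x1 integral_open_interval_real[symmetric] by (rule integral_unique)
  moreover have "v \<in> V_h k mu N x" unfolding v_def by (rule test_fun_V_h[OF mesh n p h run])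
  ultimately have "(\<Sum>i<n. 2 / h * I i) = 0"
    using gal unfolding is_galerkin_solution_def e_def by auto
  then have "2 / h * (\<Sum>i<n. I i) = 0" by (simp only: sum_distrib_left)
  then have sumI: "(\<Sum>i<n. I i) = 0" using h by simp
  have "h1_form E (tfold n) = (\<Sum>i<n. h1_form E (V i) - I i)"
    using sumI by (simp add: tfold_def h1_form_sum_right V_def sum_subtractf)
  also have "\<bar>\<dots>\<bar> \<le> (\<Sum>i<n. 2 * coeff_norm (pderiv (V i)) * \<eta>)"
  proof (rule order.trans[OF sum_abs sum_mono])
    fix i assume "i \<in> {..<n}"
    then have i: "i < n" by simp
    have "I i - h1_form E (V i) = integral {-1..1} (\<lambda>t. (w i t - poly (pderiv E) t) * poly (pderiv (V i)) t)"
      unfolding I_def h1_form_def pint_def poly_mult left_diff_distrib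
      by (intro integral_diff[symmetric] integrable_continuous_interval continuous_intros cont_w i)
    also have "norm \<dots> \<le> \<eta> * coeff_norm (pderiv (V i)) * (1 - (-1))"
    proof (rule integral_bound)
      show "continuous_on {-1..1} (\<lambda>t. (w i t - poly (pderiv E) t) * poly (pderiv (V i)) t)"
        by (intro continuous_intros cont_w i)
      fix t :: real assume "t \<in> {-1..1}"
      then have t: "\<bar>t\<bar> \<le> 1" by auto
      have "\<bar>w i t - poly (pderiv E) t\<bar> \<le> \<eta>" using E[OF i t] by (simp add: w_def xm_def)
      then show "norm ((w i t - poly (pderiv E) t) * poly (pderiv (V i)) t) \<le> \<eta> * coeff_norm (pderiv (V i))"
        using abs_poly_le_coeff_norm[OF t, of "pderiv (V i)"] by (auto simp: abs_mult intro!: mult_mono)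
    qed simp
    finally show "\<bar>h1_form E (V i) - I i\<bar> \<le> 2 * coeff_norm (pderiv (V i)) * \<eta>"
      by (simp add: abs_minus_commute mult_ac)
  qed
  also have "\<dots> = fold_const n * \<eta>" by (simp add: fold_const_def V_def sum_distrib_right)
  finally show ?thesis .
qed

section \<open>The finite element error near the centre of the patch\<close>

text \<open>The \<open>n\<close> elements are taken from the middle of the patch, where their midpoints are within \<open>(n + 1) h\<close> of \<open>x0\<close>;
rounding to whole elements moves the run by at most half an element.\<close>

lemma uniform_patch_runs:
  assumes mesh: "is_mesh a b N x" and patch: "uniform_patch N x x0 d"
  defines "h \<equiv> mesh_size N x"
  obtains L where "L \<ge> 1" "2 * d = real L * h"
    "\<And>n. n \<le> L \<Longrightarrow> \<exists>p\<ge>1. p + n \<le> N + 1 \<and> (\<forall>i<n. x (p + i + 1) - x (p + i) = h) \<and>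
        (\<forall>i<n. {x (p + i)..x (p + i + 1)} \<subseteq> {x0 - d..x0 + d} \<and> \<bar>midpoint_of x (p + i) - x0\<bar> \<le> (real n + 1) * h)"
proof -
  obtain l r where lr: "1 \<le> l" "l < r" "r \<le> N + 1" "x l = x0 - d" "x r = x0 + d"
      and len: "\<And>i. i \<in> {l..<r} \<Longrightarrow> x (i + 1) - x i = h"
    using patch unfolding uniform_patch_def h_def by blast
  have h: "h > 0" unfolding h_def by (rule mesh_size_pos[OF mesh])
  have xl: "x (l + i) = x0 - d + real i * h" if "i \<le> r - l" for i
    using uniform_run[of "r - l" x l h i] that lr len by simp
  have d: "2 * d = real (r - l) * h" using xl[of "r - l"] lr by simp
  show thesis
  proof (rule that[of "r - l"])
    fix n assume n: "n \<le> r - l"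
    define m where "m = (r - l - n) div 2"
    have m: "m + n \<le> r - l" using n unfolding m_def by linarith
    have m2: "2 * real m \<le> real (r - l) - real n" "real (r - l) - real n \<le> 2 * real m + 1"
      using n unfolding m_def by (simp_all add: of_nat_diff[symmetric] del: of_nat_diff)
    show "\<exists>p\<ge>1. p + n \<le> N + 1 \<and> (\<forall>i<n. x (p + i + 1) - x (p + i) = h) \<and>
        (\<forall>i<n. {x (p + i)..x (p + i + 1)} \<subseteq> {x0 - d..x0 + d} \<and> \<bar>midpoint_of x (p + i) - x0\<bar> \<le> (real n + 1) * h)"
    proof (intro exI[of _ "l + m"] conjI allI impI)
      fix i assume i: "i < n"
      show "x (l + m + i + 1) - x (l + m + i) = h" using len[of "l + m + i"] i m by simp
      have a: "x (l + m + i) = x0 - d + real (m + i) * h" "x (l + m + i + 1) = x0 - d + real (m + i + 1) * h"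
        using xl[of "m + i"] xl[of "m + i + 1"] i m by (simp_all add: add.assoc)
      show "{x (l + m + i)..x (l + m + i + 1)} \<subseteq> {x0 - d..x0 + d}"
        using mesh_le[OF mesh, of l "l + m + i"] mesh_le[OF mesh, of "l + m + i + 1" r] lr i m by auto
      define q where "q = real m + real i + 1 / 2 - real (r - l) / 2"
      obtain T where T: "T = real (r - l)" by simp
      have "real i + 1 \<le> real n" using i by simp
      then have "\<bar>q\<bar> \<le> real n + 1"
        using m2 unfolding q_def abs_le_iff T[symmetric] by (intro conjI) linarith+
      then have "\<bar>q\<bar> * h \<le> (real n + 1) * h" using h by (intro mult_right_mono) auto
      moreover have "midpoint_of x (l + m + i) - x0 = q * h"
        unfolding midpoint_of_def a q_def using d by (simp add: field_simps)
      ultimately show "\<bar>midpoint_of x (l + m + i) - x0\<bar> \<le> (real n + 1) * h"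
        using h by (simp add: abs_mult)
    qed (use lr m in auto)
  qed (use lr d in auto)
qed

lemma fold_const_nonneg: "fold_const n \<ge> 0"
  by (simp add: fold_const_def sum_nonneg coeff_norm_nonneg)

text \<open>(N) is tested at the node between the first two elements of the run: the derivatives of order \<open>s\<close> of the error
on the two sides coincide there, and they are close to those of \<open>E\<close> at \<open>1\<close> and \<open>-1\<close>. (G) is tested with the
splines supported on the first \<open>n\<close> elements of the run.\<close>

lemma constraints_residual:
  assumes mesh: "is_mesh a b N x" and gal: "is_galerkin_solution k mu N x u uh"
    and D: "deriv_chain (k + 2) {a..b} D" and u: "\<And>y. y \<in> {a..b} \<Longrightarrow> D 0 y = u y"
    and B: "\<And>y. y \<in> {a..b} \<Longrightarrow> \<bar>D (k + 2) y\<bar> \<le> B"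
    and k: "k \<ge> 2" "mu \<le> k - 1"
    and p: "1 \<le> p" "p + k \<le> N + 1"
    and h: "h > 0" and run: "\<forall>i<k. x (p + i + 1) - x (p + i) = h"
    and cU: "\<And>i j. i < k \<Longrightarrow> j \<in> U k \<Longrightarrow>
       \<bar>legendre_coeff (\<lambda>y. u y - uh y) (midpoint_of x (p + i)) h j - c j\<bar> \<le> \<delta>"
    and c0: "\<And>i j. i < k \<Longrightarrow> j \<in> {0..k+1} - U k \<Longrightarrow>
       \<bar>legendre_coeff (\<lambda>y. u y - uh y) (midpoint_of x (p + i)) h j\<bar> \<le> \<delta>"
  defines "\<eta> \<equiv> expansion_const k * (\<delta> + B * h ^ (k + 2))"
  shows "s \<le> mu \<Longrightarrow> \<bar>jump s (upoly k c)\<bar> \<le> 2 * \<eta>"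
    and "n \<in> bern_index k mu \<Longrightarrow> \<bar>h1_form (upoly k c) (bern n)\<bar> \<le> 2 * fold_const n * \<eta>"
proof -
  have uh: "uh \<in> V_h k mu N x" using gal by (simp add: is_galerkin_solution_def)
  obtain P where P: "pieces k N x uh P" using ex_pieces[OF uh] ..
  have x1: "x 1 = a" "x (N + 1) = b" using mesh by (auto simp: is_mesh_def)
  have xi: "x (p + i + 1) = x (p + i) + h" if "i < k" for i using run that by (metis add_diff_cancel_left' diff_add_cancel add.commute)
  have xm: "midpoint_of x (p + i) = x (p + i) + h / 2" if "i < k" for i
    using xi[OF that] by (simp add: midpoint_of_def field_simps)
  have est: "\<bar>(h / 2) ^ s * (D s (midpoint_of x (p + i) + h / 2 * t) - poly ((pderiv ^^ s) (P (p + i))) (midpoint_of x (p + i) + h / 2 * t))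
           - poly ((pderiv ^^ s) (upoly k c)) t\<bar> \<le> \<eta>"
    if i: "i < k" and s: "s \<le> k + 1" and t: "\<bar>t\<bar> \<le> 1" for i s t
    unfolding \<eta>_def
  proof (rule element_expansion[where S="{a..b}" and D=D and k=k and e="\<lambda>y. u y - uh y", OF _ _ B h])
    have ab: "a \<le> x (p + i)" "x (p + i + 1) \<le> b"
      using mesh_bounds[OF mesh, of "p + i"] mesh_bounds[OF mesh, of "p + i + 1"] p i by auto
    show "{midpoint_of x (p + i) - h / 2..midpoint_of x (p + i) + h / 2} \<subseteq> {a..b}"
      using ab xm[OF i] xi[OF i] by auto
    show "degree (P (p + i)) \<le> k" using P p i by (auto simp: pieces_def)
    fix t :: real assume t: "\<bar>t\<bar> \<le> 1"
    have y: "midpoint_of x (p + i) + h / 2 * t \<in> {x (p + i)..x (p + i + 1)}"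
      using reference_point_in[OF h t, of "midpoint_of x (p + i)"] xm[OF i] xi[OF i] by auto
    then have "midpoint_of x (p + i) + h / 2 * t \<in> {a..b}" using ab by auto
    moreover have "p + i \<in> {1..N}" using p i by auto
    ultimately show "u (midpoint_of x (p + i) + h / 2 * t) - uh (midpoint_of x (p + i) + h / 2 * t) =
        D 0 (midpoint_of x (p + i) + h / 2 * t) - poly (P (p + i)) (midpoint_of x (p + i) + h / 2 * t)"
      using P y u unfolding pieces_def by auto
  qed (use D cU[OF i] c0[OF i] s t in \<open>auto simp: deriv_chain_def\<close>)
  show "\<bar>jump s (upoly k c)\<bar> \<le> 2 * \<eta>" if s: "s \<le> mu"
  proof -
    define X where "X = x (p + 1)"
    have X: "midpoint_of x (p + 0) + h / 2 * 1 = X" "midpoint_of x (p + 1) + h / 2 * (-1) = X"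
      using xm[of 0] xm[of 1] xi[of 0] k by (simp_all add: X_def)
    have "poly ((pderiv ^^ s) (P p)) X = poly ((pderiv ^^ s) (P (p + 1))) X"
    proof (rule spline_pieces_match[of mu a b uh "x p" _ "x (p + 2)"])
      show "C_on mu {a<..<b} uh" using uh x1 by (auto simp: V_h_def spline_space_def)
      show "a \<le> x p" "x (p + 2) \<le> b"
        using mesh_bounds[OF mesh, of p] mesh_bounds[OF mesh, of "p + 2"] p k by auto
      show "x p < X" "X < x (p + 2)" unfolding X_def using xi[of 0] xi[of 1] h k by (simp_all add: numeral_2_eq_2)
      show "uh y = poly (P p) y" if "y \<in> {x p..X}" for y
        using P that p k unfolding pieces_def X_def by auto
      show "uh y = poly (P (p + 1)) y" if "y \<in> {X..x (p + 2)}" for y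
        using P[unfolded pieces_def, rule_format, of "p + 1"] that p k unfolding X_def by (simp add: numeral_2_eq_2)
    qed (rule s)
    then have match: "poly ((pderiv ^^ s) (P (p + 0))) X = poly ((pderiv ^^ s) (P (p + 1))) X" by simp
    have "\<bar>(h / 2) ^ s * (D s X - poly ((pderiv ^^ s) (P (p + 1))) X) - poly ((pderiv ^^ s) (upoly k c)) 1\<bar> \<le> \<eta>"
      using est[of 0 s 1] s k unfolding X match by simp
    moreover have "\<bar>(h / 2) ^ s * (D s X - poly ((pderiv ^^ s) (P (p + 1))) X) - poly ((pderiv ^^ s) (upoly k c)) (-1)\<bar> \<le> \<eta>"
      using est[of 1 s "-1"] s k unfolding X by simp
    ultimately show ?thesis unfolding jump_def by linarith
  qed
  show "\<bar>h1_form (upoly k c) (bern n)\<bar> \<le> 2 * fold_const n * \<eta>" if "n \<in> bern_index k mu"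
  proof -
    have n: "n \<ge> mu + 2" "n \<le> k" using that by (auto simp: bern_index_def)
    have "\<bar>h1_form (upoly k c) (tfold n)\<bar> \<le> fold_const n * \<eta>"
    proof (rule galerkin_test[OF mesh gal P D _ u n p(1) _ h])
      show "\<forall>i<n. x (p + i + 1) - x (p + i) = h" using run n by auto
      show "\<bar>h / 2 * (D 1 (midpoint_of x (p + i) + h / 2 * t) - poly (pderiv (P (p + i))) (midpoint_of x (p + i) + h / 2 * t))
          - poly (pderiv (upoly k c)) t\<bar> \<le> \<eta>" if "i < n" "\<bar>t\<bar> \<le> 1" for i t
        using est[of i 1 t] that n by simp
    qed (use n p in auto)
    then show ?thesis using n by (simp add: h1_form_tfold abs_mult)
  qed
qed

lemma legendre_coeff_bound:
  assumes "j \<le> k + 1" "continuous_on S e" "\<And>t. \<bar>t\<bar> \<le> 1 \<Longrightarrow> xm + h / 2 * t \<in> S"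
    and "\<And>y. y \<in> S \<Longrightarrow> \<bar>e y\<bar> \<le> M"
  shows "\<bar>legendre_coeff e xm h j\<bar> \<le> (2 * real k + 3) * (M * legendre_norm k)"
proof -
  have "norm (integral {-1..1} (\<lambda>t. e (xm + h / 2 * t) * poly (legendre j) t)) \<le> M * legendre_norm k * (1 - (-1))"
  proof (rule integral_bound)
    show "continuous_on {-1..1} (\<lambda>t. e (xm + h / 2 * t) * poly (legendre j) t)"
      by (intro continuous_intros continuous_on_compose2[OF assms(2)])
         (use assms(3) in \<open>auto simp: abs_le_iff\<close>)
    fix t :: real assume "t \<in> {-1..1}"
    then have t: "\<bar>t\<bar> \<le> 1" by auto
    have "\<bar>e (xm + h / 2 * t)\<bar> \<le> M" using assms(3,4) t by blast
    moreover have "\<bar>poly (legendre j) t\<bar> \<le> legendre_norm k" using legendre_le_norm[of j k 0 t] assms(1) t by simp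
    ultimately show "norm (e (xm + h / 2 * t) * poly (legendre j) t) \<le> M * legendre_norm k"
      unfolding real_norm_def abs_mult by (intro mult_mono) auto
  qed simp
  then have *: "\<bar>integral {-1..1} (\<lambda>t. e (xm + h / 2 * t) * poly (legendre j) t)\<bar> \<le> 2 * (M * legendre_norm k)" by simp
  have "\<bar>legendre_coeff e xm h j\<bar> \<le> (2 * real j + 1) / 2 * (2 * (M * legendre_norm k))"
    unfolding legendre_coeff_def abs_mult using * by (intro mult_mono) auto
  also have "\<dots> = (2 * real j + 1) * (M * legendre_norm k)" by simp
  also have "\<dots> \<le> (2 * real k + 3) * (M * legendre_norm k)"
  proof (rule mult_right_mono)
    show "0 \<le> M * legendre_norm k" using * by linarith
  qed (use assms(1) in simp)
  finally show ?thesis .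
qed

text \<open>If fewer than \<open>k\<close> elements fit into the patch, then its radius, which is about \<open>Cstar h |ln h|\<close>, is less than
\<open>k h / 2\<close>, and \<open>|ln h|\<close> is bounded.\<close>

lemma coarse_mesh_size:
  fixes h d Cstar :: real
  assumes "h > 0" "Cstar > 0" "2 * d = real L * h" "L < k" "\<bar>d - Cstar * h * \<bar>ln h\<bar>\<bar> \<le> h"
  shows "exp (- ((real k / 2 + 1) / Cstar)) \<le> h"
proof -
  have "Cstar * h * \<bar>ln h\<bar> \<le> d + h" using assms(5) by linarith
  also have "\<dots> \<le> (real k / 2 + 1) * h"
  proof -
    have "real L * h \<le> real k * h" using assms by (intro mult_right_mono) auto
    then show ?thesis using assms(3) by (simp add: algebra_simps)
  qed
  finally have "(Cstar * \<bar>ln h\<bar>) * h \<le> (real k / 2 + 1) * h" by (simp add: mult_ac)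
  then have "Cstar * \<bar>ln h\<bar> \<le> real k / 2 + 1" using assms(1) by simp
  then have "\<bar>ln h\<bar> \<le> (real k / 2 + 1) / Cstar" using assms(2) by (simp add: pos_le_divide_eq mult.commute)
  then have "- ((real k / 2 + 1) / Cstar) \<le> ln h" by linarith
  then show ?thesis using assms(1) by (simp add: ln_ge_iff)
qed

text \<open>With at least \<open>k\<close> elements in the patch the residuals of the constraints are \<open>O(h^(k+2))\<close>. Otherwise \<open>h\<close> is
bounded below and the coefficients themselves are bounded by a constant multiple of \<open>h^(k+2)\<close>; they are
tied to the finite element error by one element, which every patch contains.\<close>

lemma fe_ratio_error:
  fixes c :: "'i \<Rightarrow> nat \<Rightarrow> real"
  assumes k: "k \<ge> 2" "mu \<le> k - 1"
    and fe: "fe_setting k mu a b f u x0 Cstar N x d uh"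
    and lc: "leading_order_coeffs k u x0 N x d uh c"
    and j: "j \<in> ratio_index k"
    and rho: "\<And>c. G_constraints k mu c \<Longrightarrow> N_constraints k mu c \<Longrightarrow> c j = rho j * c (k + 1)"
  shows "\<exists>C. \<forall>\<iota>. \<bar>c \<iota> j - rho j * c \<iota> (k + 1)\<bar> \<le> C * mesh_size (N \<iota>) (x \<iota>) ^ (k + 2)"
proof -
  define h where "h = (\<lambda>\<iota>. mesh_size (N \<iota>) (x \<iota>))"
  have ab: "a < b" and Cs: "Cstar > 0" and ua: "u a = 0" and "C_on (k + 2) {a..b} u"
    using fe by (auto simp: fe_setting_def)
  then obtain D where D: "deriv_chain (k + 2) {a..b} D" and u: "\<And>y. y \<in> {a..b} \<Longrightarrow> D 0 y = u y"
    unfolding C_on_chain by blast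
  have mesh: "is_mesh a b (N \<iota>) (x \<iota>)" and gal: "is_galerkin_solution k mu (N \<iota>) (x \<iota>) u (uh \<iota>)"
    and patch: "uniform_patch (N \<iota>) (x \<iota>) x0 (d \<iota>)"
    and d: "\<bar>d \<iota> - Cstar * h \<iota> * \<bar>ln (h \<iota>)\<bar>\<bar> \<le> h \<iota>" for \<iota>
    using fe by (auto simp: fe_setting_def h_def Let_def)
  have h: "h \<iota> > 0" for \<iota> unfolding h_def by (rule mesh_size_pos[OF mesh])
  have bdd: "\<exists>B. \<forall>y\<in>{a..b}. \<bar>D n y\<bar> \<le> B" if "n \<le> k + 2" for n
  proof -
    have "bounded (D n ` {a..b})"
      by (intro compact_imp_bounded compact_continuous_image deriv_chain_continuous[OF D that] compact_Icc)
    then show ?thesis by (auto simp: bounded_iff)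
  qed
  obtain B1 where B1: "\<And>y. y \<in> {a..b} \<Longrightarrow> \<bar>D 1 y\<bar> \<le> B1" proof -
    have "1 \<le> k + 2" by simp
    from bdd[OF this] show thesis using that by blast
  qed
  obtain B2 where B2: "\<And>y. y \<in> {a..b} \<Longrightarrow> \<bar>D (k + 2) y\<bar> \<le> B2" using bdd[of "k + 2"] by blast
  obtain C0 where C0: "\<And>\<iota> i. i \<in> {1..N \<iota>} \<Longrightarrow> {x \<iota> i..x \<iota> (i + 1)} \<subseteq> {x0 - d \<iota>..x0 + d \<iota>} \<Longrightarrow>
      \<bar>midpoint_of (x \<iota>) i - x0\<bar> \<le> (real k + 1) * h \<iota> \<Longrightarrow>
      (\<forall>j \<in> U k. \<bar>legendre_coeff (\<lambda>y. u y - uh \<iota> y) (midpoint_of (x \<iota>) i) (h \<iota>) j - c \<iota> j\<bar> \<le> C0 * h \<iota> ^ (k + 2)) \<and>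
      (\<forall>j \<in> {0..k+1} - U k. \<bar>legendre_coeff (\<lambda>y. u y - uh \<iota> y) (midpoint_of (x \<iota>) i) (h \<iota>) j\<bar> \<le> C0 * h \<iota> ^ (k + 2))"
    using lc[unfolded leading_order_coeffs_def Let_def, rule_format, of "real k + 1"] unfolding h_def by blast
  obtain K where K: "K \<ge> 0" and bound: "\<And>c \<delta>. (\<And>s. s \<le> mu \<Longrightarrow> \<bar>jump s (upoly k c)\<bar> \<le> \<delta>) \<Longrightarrow>
      (\<And>n. n \<in> bern_index k mu \<Longrightarrow> \<bar>h1_form (upoly k c) (bern n)\<bar> \<le> \<delta>) \<Longrightarrow>
      \<bar>c j - rho j * c (k + 1)\<bar> \<le> K * \<delta>"
    using ratio_error_bound[where rho=rho, OF k(2) j rho] by blast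
  define F where "F = 2 + (\<Sum>n\<le>k. 2 * fold_const n)"
  define h0 where "h0 = exp (- ((real k / 2 + 1) / Cstar))"
  define Q where "Q = (2 * real k + 3) * ((b - a) * (1 + B1\<^sup>2) * legendre_norm k)"
  define C1 where "C1 = K * (F * (expansion_const k * (C0 + B2)))"
  define C2 where "C2 = (1 + \<bar>rho j\<bar>) * (C0 + Q / h0 ^ (k + 2))"
  have "\<bar>c \<iota> j - rho j * c \<iota> (k + 1)\<bar> \<le> max C1 C2 * h \<iota> ^ (k + 2)" for \<iota>
  proof -
    have hk: "h \<iota> ^ (k + 2) > 0" using h by simp
    have jU: "j \<in> U k" "k + 1 \<in> U k" using j by (auto simp: ratio_index_eq U_def)
    obtain L where L: "L \<ge> 1" "2 * d \<iota> = real L * h \<iota>"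
      and runs: "\<And>n. n \<le> L \<Longrightarrow> \<exists>p\<ge>1. p + n \<le> N \<iota> + 1 \<and> (\<forall>i<n. x \<iota> (p + i + 1) - x \<iota> (p + i) = h \<iota>) \<and>
        (\<forall>i<n. {x \<iota> (p + i)..x \<iota> (p + i + 1)} \<subseteq> {x0 - d \<iota>..x0 + d \<iota>} \<and>
           \<bar>midpoint_of (x \<iota>) (p + i) - x0\<bar> \<le> (real n + 1) * h \<iota>)"
      using uniform_patch_runs[OF mesh patch] unfolding h_def by blast
    show ?thesis
    proof (cases "k \<le> L")
      case True
      from runs[OF this] obtain p where p: "p \<ge> 1" "p + k \<le> N \<iota> + 1"
        and run: "\<forall>i<k. x \<iota> (p + i + 1) - x \<iota> (p + i) = h \<iota>"
        and near: "\<And>i. i < k \<Longrightarrow> {x \<iota> (p + i)..x \<iota> (p + i + 1)} \<subseteq> {x0 - d \<iota>..x0 + d \<iota>} \<and>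
           \<bar>midpoint_of (x \<iota>) (p + i) - x0\<bar> \<le> (real k + 1) * h \<iota>" by blast
      define \<eta> where "\<eta> = expansion_const k * (C0 * h \<iota> ^ (k + 2) + B2 * h \<iota> ^ (k + 2))"
      have c: "(\<forall>j \<in> U k. \<bar>legendre_coeff (\<lambda>y. u y - uh \<iota> y) (midpoint_of (x \<iota>) (p + i)) (h \<iota>) j - c \<iota> j\<bar> \<le> C0 * h \<iota> ^ (k + 2)) \<and>
        (\<forall>j \<in> {0..k+1} - U k. \<bar>legendre_coeff (\<lambda>y. u y - uh \<iota> y) (midpoint_of (x \<iota>) (p + i)) (h \<iota>) j\<bar> \<le> C0 * h \<iota> ^ (k + 2))"
        if "i < k" for i
        using near[OF that] p that by (intro C0) auto
      note res = constraints_residual[OF mesh gal D u B2 k p h run, where c="c \<iota>" and \<delta>="C0 * h \<iota> ^ (k + 2)",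
          folded \<eta>_def]
      have jump: "\<bar>jump s (upoly k (c \<iota>))\<bar> \<le> 2 * \<eta>" if "s \<le> mu" for s
        using res(1)[OF _ _ _ _ that] c by blast
      have hf: "\<bar>h1_form (upoly k (c \<iota>)) (bern n)\<bar> \<le> 2 * fold_const n * \<eta>" if "n \<in> bern_index k mu" for n
        using res(2)[OF _ _ _ _ that] c by blast
      have \<eta>: "\<eta> \<ge> 0" using jump[of 0] by simp
      have Fn: "2 \<le> F" "\<And>n. n \<le> k \<Longrightarrow> 2 * fold_const n \<le> F"
      proof -
        show "2 \<le> F" by (simp add: F_def sum_nonneg fold_const_nonneg)
        fix n assume "n \<le> k"
        then have "2 * fold_const n \<le> (\<Sum>n\<le>k. 2 * fold_const n)"
          by (intro member_le_sum) (auto simp: fold_const_nonneg)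
        then show "2 * fold_const n \<le> F" by (simp add: F_def)
      qed
      have "\<bar>c \<iota> j - rho j * c \<iota> (k + 1)\<bar> \<le> K * (F * \<eta>)"
      proof (rule bound)
        fix s assume "s \<le> mu"
        then show "\<bar>jump s (upoly k (c \<iota>))\<bar> \<le> F * \<eta>"
          using jump[of s] mult_right_mono[OF Fn(1) \<eta>] by linarith
      next
        fix n assume n: "n \<in> bern_index k mu"
        then have "n \<le> k" by (auto simp: bern_index_def)
        then show "\<bar>h1_form (upoly k (c \<iota>)) (bern n)\<bar> \<le> F * \<eta>"
          using hf[OF n] mult_right_mono[OF Fn(2) \<eta>] by force
      qed
      also have "\<dots> = C1 * h \<iota> ^ (k + 2)" unfolding C1_def \<eta>_def by (simp only: distrib_right mult.assoc)
      also have "\<dots> \<le> max C1 C2 * h \<iota> ^ (k + 2)" using hk by (intro mult_right_mono) auto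
      finally show ?thesis .
    next
      case False
      from runs[OF L(1)] obtain p where p: "p \<ge> 1" "p + 1 \<le> N \<iota> + 1"
        and run: "x \<iota> (p + 1) - x \<iota> p = h \<iota>"
        and near: "{x \<iota> p..x \<iota> (p + 1)} \<subseteq> {x0 - d \<iota>..x0 + d \<iota>}" "\<bar>midpoint_of (x \<iota>) p - x0\<bar> \<le> 2 * h \<iota>"
        by auto
      have pN: "p \<in> {1..N \<iota>}" using p by auto
      have "2 * h \<iota> \<le> (real k + 1) * h \<iota>" using k h[of \<iota>] by (intro mult_right_mono) auto
      then have c: "\<bar>legendre_coeff (\<lambda>y. u y - uh \<iota> y) (midpoint_of (x \<iota>) p) (h \<iota>) i - c \<iota> i\<bar> \<le> C0 * h \<iota> ^ (k + 2)"
        if "i \<in> U k" for i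
        using C0[OF pN near(1)] near(2) that by auto
      have h0: "h0 \<le> h \<iota>" unfolding h0_def
        by (rule coarse_mesh_size[OF h Cs L(2) _ d]) (use False in auto)
      have h0pos: "h0 > 0" by (simp add: h0_def)
      have M: "\<bar>u y - uh \<iota> y\<bar> \<le> (b - a) * (1 + B1\<^sup>2)" if "y \<in> {a..b}" for y
        by (rule galerkin_error_bound[OF mesh gal D _ u ua B1 that]) simp_all
      have "continuous_on {a..b} u"
        using continuous_on_eq[OF deriv_chain_continuous[OF D, of 0] u] by simp
      moreover obtain P where P: "pieces k (N \<iota>) (x \<iota>) (uh \<iota>) P"
        using ex_pieces gal unfolding is_galerkin_solution_def by blast
      ultimately have cont: "continuous_on {a..b} (\<lambda>y. u y - uh \<iota> y)"
        using pieces_continuous[OF mesh P] by (blast intro: continuous_on_diff)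
      have in_ab: "midpoint_of (x \<iota>) p + h \<iota> / 2 * t \<in> {a..b}" if "\<bar>t\<bar> \<le> 1" for t
      proof -
        note reference_point_in[OF h[of \<iota>] that, of "midpoint_of (x \<iota>) p"]
        moreover have "midpoint_of (x \<iota>) p = x \<iota> p + h \<iota> / 2" using run by (simp add: midpoint_of_def field_simps)
        moreover have "a \<le> x \<iota> p" "x \<iota> (p + 1) \<le> b"
          using mesh_bounds[OF mesh[of \<iota>], of p] mesh_bounds[OF mesh[of \<iota>], of "p + 1"] p by auto
        ultimately show ?thesis using run by auto
      qed
      have ci: "\<bar>c \<iota> i\<bar> \<le> (C0 + Q / h0 ^ (k + 2)) * h \<iota> ^ (k + 2)" if i: "i \<in> U k" for i
      proof -
        have "\<bar>legendre_coeff (\<lambda>y. u y - uh \<iota> y) (midpoint_of (x \<iota>) p) (h \<iota>) i\<bar> \<le> Q"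
          unfolding Q_def by (rule legendre_coeff_bound[OF _ cont in_ab M]) (use i in \<open>auto simp: U_def\<close>)
        then have "Q \<ge> 0" and cQ: "\<bar>c \<iota> i\<bar> \<le> C0 * h \<iota> ^ (k + 2) + Q" using c[OF i] by linarith+
        have "Q * h0 ^ (k + 2) \<le> Q * h \<iota> ^ (k + 2)"
          using \<open>Q \<ge> 0\<close> h0 h0pos by (intro mult_left_mono power_mono) auto
        then have "Q \<le> Q / h0 ^ (k + 2) * h \<iota> ^ (k + 2)"
          using h0pos by (simp add: pos_le_divide_eq)
        then show ?thesis using cQ by (simp only: distrib_right)
      qed
      have "\<bar>c \<iota> j - rho j * c \<iota> (k + 1)\<bar> \<le> \<bar>c \<iota> j\<bar> + \<bar>rho j\<bar> * \<bar>c \<iota> (k + 1)\<bar>"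
        unfolding abs_mult[symmetric] by linarith
      also have "\<dots> \<le> (C0 + Q / h0 ^ (k + 2)) * h \<iota> ^ (k + 2) + \<bar>rho j\<bar> * ((C0 + Q / h0 ^ (k + 2)) * h \<iota> ^ (k + 2))"
        using ci[OF jU(1)] ci[OF jU(2)] by (intro add_mono mult_left_mono) auto
      also have "\<dots> = C2 * h \<iota> ^ (k + 2)" unfolding C2_def by (simp add: distrib_right)
      also have "\<dots> \<le> max C1 C2 * h \<iota> ^ (k + 2)" using hk by (intro mult_right_mono) auto
      finally show ?thesis .
    qed
  qed
  then show ?thesis unfolding h_def by blast
qed

theorem theorem4p7:
  fixes k mu :: nat
  assumes "k \<ge> 2" and "0 \<le> mu" and "mu \<le> k - 1"
  shows "(\<exists>q g. G_eliminated k mu q g) \<and>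
     (\<forall>q g. G_eliminated k mu q g \<longrightarrow>
        lin_indep_family (U k) ({..<q} <+> N_index k mu)
          (case_sum g (\<lambda>s j. legendre_deriv_at_1 s j))) \<and>
     (\<exists>rho :: nat \<Rightarrow> real.
        determine_ratios k mu rho \<and>
        (\<forall>a b f u x0 Cstar (N :: 'i \<Rightarrow> nat) x d uh c.
           fe_setting k mu a b f u x0 Cstar N x d uh \<and>
           leading_order_coeffs k u x0 N x d uh c \<longrightarrow>
           (\<forall>j \<in> ratio_index k. \<exists>C. \<forall>\<iota>.
              \<bar>c \<iota> j - rho j * c \<iota> (k + 1)\<bar> \<le> C * mesh_size (N \<iota>) (x \<iota>) ^ (k + 2))))"
proof (intro conjI allI impI)
  show "\<exists>q g. G_eliminated k mu q g" using assms(3) by (rule ex_G_eliminated)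
  show "lin_indep_family (U k) ({..<q} <+> N_index k mu) (case_sum g (\<lambda>s j. legendre_deriv_at_1 s j))"
    if "G_eliminated k mu q g" for q g
    using assms(3) that by (rule lin_indep_G_N)
  have "1 \<le> k" using assms(1) by simp
  then obtain rho where rho: "determine_ratios k mu rho"
    "\<And>c j. G_constraints k mu c \<Longrightarrow> N_constraints k mu c \<Longrightarrow> j \<in> ratio_index k \<Longrightarrow> c j = rho j * c (k + 1)"
    using ex_ratios[OF assms(3)] by blast
  show "\<exists>rho :: nat \<Rightarrow> real.
        determine_ratios k mu rho \<and>
        (\<forall>a b f u x0 Cstar (N :: 'i \<Rightarrow> nat) x d uh c.
           fe_setting k mu a b f u x0 Cstar N x d uh \<and>
           leading_order_coeffs k u x0 N x d uh c \<longrightarrow>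
           (\<forall>j \<in> ratio_index k. \<exists>C. \<forall>\<iota>.
              \<bar>c \<iota> j - rho j * c \<iota> (k + 1)\<bar> \<le> C * mesh_size (N \<iota>) (x \<iota>) ^ (k + 2)))"
  proof (intro exI[of _ rho] conjI allI impI ballI rho(1))
    fix a b f u x0 Cstar x d uh c j and N :: "'i \<Rightarrow> nat"
    assume fe: "fe_setting k mu a b f u x0 Cstar N x d uh \<and> leading_order_coeffs k u x0 N x d uh c"
      and j: "j \<in> ratio_index k"
    show "\<exists>C. \<forall>\<iota>. \<bar>c \<iota> j - rho j * c \<iota> (k + 1)\<bar> \<le> C * mesh_size (N \<iota>) (x \<iota>) ^ (k + 2)"
      using assms(1,3) conjunct1[OF fe] conjunct2[OF fe] j
    proof (rule fe_ratio_error)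
      fix c assume "G_constraints k mu c" "N_constraints k mu c"
      then show "c j = rho j * c (k + 1)" using j by (rule rho(2))
    qed
  qed
qed

end
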